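(* Let $p$ be a prime, and let $G=\coprod_{x\in X}G_x\amalg P$ and $G_s=\coprod_{x\in X}{}^{s}\,G_x\amalg^s P$ be, respectively, the free profinite and the free prosoluble product of pro-$p$ groups $G_x$ over a profinite space $X$ and a prosoluble projective group $P$. Then the natural epimorphism $\alpha:G\to G_s$ that sends identically the factors of the free profinite product to the factors of the free prosoluble product admits a retraction $r:G_s\to G$ (i.e. a homomorphism with $\alpha\circ r=\mathrm{id}_{G_s}$) such that $r(G_x)$ is conjugate in $G$ to $G_x$ for every $x\in X$.
   Context: All groups are profinite, subgroups are closed, homomorphisms are continuous. A profinite group is projective if it is projective in the category of profinite groups (every finite embedding problem is weakly solvable). Let $\mathcal{C}$ be the class of all finite groups (resp. of all finite soluble groups). A family $\{G_x\mid x\in X\}$ of closed subgroups of a pro-$\mathcal{C}$ group $L$ indexed by a profinite space $X$ is a continuous system if for every open subgroup $U$ of $L$ the set $\{x\in X\mid G_x\le U\}$ is open in $X$. $L$ is the free pro-$\mathcal{C}$ product of the continuous system if (a) $G_x\cap G_y=1$ for $x\neq y$; (b) for every pro-$\mathcal{C}$ group $K$, every continuous map $\bigcup_x G_x\to K$ whose restriction to each $G_x$ is a homomorphism extends uniquely to a continuous homomorphism $L\to K$. It is denoted $\coprod_{x\in X}G_x$ (free profinite product) for $\mathcal{C}$ the class of all finite groups, and $\coprod_{x\in X}{}^{s}\,G_x$ (free prosoluble product) for $\mathcal{C}$ the class of finite soluble groups; $\amalg$ and $\amalg^s$ denote the corresponding products of two groups. The same (abstract) continuous family of pro-$p$ groups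 $G_x$ is used in $G$ and in $G_s$. *)

theory Defs
  imports
    "HOL-Analysis.T1_Spaces"
    "HOL-Algebra.Solvable_Groups"
    "HOL-Computational_Algebra.Primes"
begin

section \<open>Profinite spaces and pro-C groups\<close>

text \<open>
  A universe is fixed: all groups have their carrier in one type \<open>'u\<close>, and the quantifiers over
  groups in \<open>free_pro_product\<close> and \<open>projective_group\<close> range over the groups whose carrier lies in
  \<open>'u\<close>. Each of these two notions is meant for infinite \<open>'u\<close>, so that every finite group has
  an isomorphic copy in the universe. As a pro-C group is an inverse limit of its quotients by
  open normal subgroups, having the universal property of a free pro-C product for the pro-C
  groups in an infinite universe is the same as having it for all pro-C groups whatsoever.
\<close>

record 'a tgroup = "'a monoid" +
  gtop :: "'a topology"

definition profinite_space :: "'a topology \<Rightarrow> bool" where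
  "profinite_space X \<longleftrightarrow>
     compact_space X \<and> Hausdorff_space X \<and> (\<forall>S. connectedin X S \<longrightarrow> (\<exists>a. S \<subseteq> {a}))"

definition topological_group :: "'a tgroup \<Rightarrow> bool" where
  "topological_group G \<longleftrightarrow>
     group G \<and> topspace (gtop G) = carrier G \<and>
     continuous_map (prod_topology (gtop G) (gtop G)) (gtop G) (\<lambda>(x, y). x \<otimes>\<^bsub>G\<^esub> y) \<and>
     continuous_map (gtop G) (gtop G) (\<lambda>x. inv\<^bsub>G\<^esub> x)"

definition profinite_group :: "'a tgroup \<Rightarrow> bool" where
  "profinite_group G \<longleftrightarrow> topological_group G \<and> profinite_space (gtop G)"

text \<open>A class C of finite groups enters as a predicate on the groups \<open>G Mod N\<close>, whose elements
  are cosets; this is why its argument is a group of sets.\<close>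

definition pro_C_group :: "('a set monoid \<Rightarrow> bool) \<Rightarrow> 'a tgroup \<Rightarrow> bool" where
  "pro_C_group C G \<longleftrightarrow>
     profinite_group G \<and> (\<forall>N. N \<lhd> G \<and> openin (gtop G) N \<longrightarrow> C (G Mod N))"

definition finite_grp :: "'a monoid \<Rightarrow> bool" where
  "finite_grp Q \<longleftrightarrow> finite (carrier Q)"

definition finite_soluble_grp :: "'a monoid \<Rightarrow> bool" where
  "finite_soluble_grp Q \<longleftrightarrow> finite (carrier Q) \<and> solvable Q"

definition finite_p_grp :: "nat \<Rightarrow> 'a monoid \<Rightarrow> bool" where
  "finite_p_grp p Q \<longleftrightarrow> finite (carrier Q) \<and> (\<exists>n. order Q = p ^ n)"

definition closed_subgroup :: "'a set \<Rightarrow> 'a tgroup \<Rightarrow> bool" where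
  "closed_subgroup H G \<longleftrightarrow> subgroup H G \<and> closedin (gtop G) H"

definition tsub :: "'a tgroup \<Rightarrow> 'a set \<Rightarrow> 'a tgroup" where
  "tsub G H = G\<lparr>carrier := H, gtop := subtopology (gtop G) H\<rparr>"

definition cont_hom :: "'a tgroup \<Rightarrow> 'b tgroup \<Rightarrow> ('a \<Rightarrow> 'b) set" where
  "cont_hom G H = {f \<in> hom G H. continuous_map (gtop G) (gtop H) f}"

definition top_iso :: "'a tgroup \<Rightarrow> 'b tgroup \<Rightarrow> ('a \<Rightarrow> 'b) set" where
  "top_iso G H = {f \<in> iso G H. homeomorphic_map (gtop G) (gtop H) f}"

text \<open>Every finite embedding problem \<open>(\<phi> : P \<rightarrow> B, \<pi> : A \<rightarrow> B)\<close>, with \<open>\<phi>\<close> and \<open>\<pi>\<close>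
  surjective and the finite groups \<open>A\<close>, \<open>B\<close> discrete, is weakly solvable: the solution
  \<open>\<psi>\<close> need not be surjective.\<close>

definition projective_group :: "'u tgroup \<Rightarrow> bool" where
  "projective_group P \<longleftrightarrow>
     profinite_group P \<and>
     (\<forall>(A :: 'u tgroup) (B :: 'u tgroup) \<pi> \<phi>.
        group A \<and> finite (carrier A) \<and> gtop A = discrete_topology (carrier A) \<and>
        group B \<and> finite (carrier B) \<and> gtop B = discrete_topology (carrier B) \<and>
        \<pi> \<in> epi A B \<and> \<phi> \<in> cont_hom P B \<and> \<phi> \<in> epi P B \<longrightarrow>
        (\<exists>\<psi> \<in> cont_hom P A. \<forall>g \<in> carrier P. \<pi> (\<psi> g) = \<phi> g))"

section \<open>Free pro-C products\<close>

definition continuous_system :: "'u tgroup \<Rightarrow> 'x topology \<Rightarrow> ('x \<Rightarrow> 'u set) \<Rightarrow> bool" where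
  "continuous_system L X A \<longleftrightarrow>
     profinite_space X \<and> (\<forall>x \<in> topspace X. closed_subgroup (A x) L) \<and>
     (\<forall>U. subgroup U L \<and> openin (gtop L) U \<longrightarrow> openin X {x \<in> topspace X. A x \<subseteq> U})"

definition system_union :: "'u tgroup \<Rightarrow> 'x topology \<Rightarrow> ('x \<Rightarrow> 'u set) \<Rightarrow> 'u topology" where
  "system_union L X A = subtopology (gtop L) (\<Union>x \<in> topspace X. A x)"

definition free_pro_product ::
  "('u set monoid \<Rightarrow> bool) \<Rightarrow> 'u tgroup \<Rightarrow> 'x topology \<Rightarrow> ('x \<Rightarrow> 'u set) \<Rightarrow> bool" where
  "free_pro_product C L X A \<longleftrightarrow>
     pro_C_group C L \<and> continuous_system L X A \<and>
     (\<forall>x \<in> topspace X. \<forall>y \<in> topspace X. x \<noteq> y \<longrightarrow> A x \<inter> A y = {\<one>\<^bsub>L\<^esub>}) \<and>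
     (\<forall>(K :: 'u tgroup) f.
        pro_C_group C K \<and>
        continuous_map (system_union L X A) (gtop K) f \<and>
        (\<forall>x \<in> topspace X. f \<in> hom (tsub L (A x)) K) \<longrightarrow>
        (\<exists>h \<in> cont_hom L K.
           (\<forall>x \<in> topspace X. \<forall>a \<in> A x. h a = f a) \<and>
           (\<forall>h' \<in> cont_hom L K. (\<forall>x \<in> topspace X. \<forall>a \<in> A x. h' a = f a) \<longrightarrow>
              (\<forall>g \<in> carrier L. h' g = h g))))"

definition free_pro_product2 ::
  "('u set monoid \<Rightarrow> bool) \<Rightarrow> 'u tgroup \<Rightarrow> 'u set \<Rightarrow> 'u set \<Rightarrow> bool" where
  "free_pro_product2 C G H P \<longleftrightarrow>
     free_pro_product C G (discrete_topology (UNIV :: bool set)) (\<lambda>b. if b then H else P)"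

text \<open>\<open>(L, A)\<close> and \<open>(M, B)\<close> realise the same abstract continuous family over \<open>X\<close>, via the
  identification \<open>\<theta>\<close> of the unions of their members.\<close>

definition system_iso ::
  "'x topology \<Rightarrow> 'u tgroup \<Rightarrow> ('x \<Rightarrow> 'u set) \<Rightarrow> 'v tgroup \<Rightarrow> ('x \<Rightarrow> 'v set) \<Rightarrow> ('u \<Rightarrow> 'v) \<Rightarrow> bool"
where
  "system_iso X L A M B \<theta> \<longleftrightarrow>
     homeomorphic_map (system_union L X A) (system_union M X B) \<theta> \<and>
     (\<forall>x \<in> topspace X. \<theta> \<in> top_iso (tsub L (A x)) (tsub M (B x)))"

text \<open>The homomorphisms that are the identity on the factors \<open>A x\<close> and \<open>P\<close> of \<open>G\<close>, up to
  the identifications \<open>\<theta>\<close>, \<open>\<eta>\<close> of these with the corresponding factors of \<open>G'\<close>.\<close>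

definition natural_hom ::
  "'u tgroup \<Rightarrow> 'v tgroup \<Rightarrow> 'x topology \<Rightarrow> ('x \<Rightarrow> 'u set) \<Rightarrow> ('u \<Rightarrow> 'v) \<Rightarrow>
   'u set \<Rightarrow> ('u \<Rightarrow> 'v) \<Rightarrow> ('u \<Rightarrow> 'v) \<Rightarrow> bool" where
  "natural_hom G G' X A \<theta> P \<eta> \<alpha> \<longleftrightarrow>
     \<alpha> \<in> cont_hom G G' \<and> (\<forall>x \<in> topspace X. \<forall>a \<in> A x. \<alpha> a = \<theta> a) \<and> (\<forall>a \<in> P. \<alpha> a = \<eta> a)"

end

theory Submission
  imports Defs "HOL-Analysis.Abstract_Topological_Spaces" "HOL-Algebra.Group_Action"
    "HOL-Algebra.Sylow" "HOL-Algebra.SndIsomorphismGrp" "HOL-Algebra.Elementary_Groups"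
    "HOL-Algebra.Multiplicative_Group"
begin

text \<open>
  Among the closed subgroups \<open>S\<close> of \<open>G\<close> with \<open>\<alpha> S = Gs\<close> that contain a Sylow pro-p subgroup of
  \<open>G\<close>, a minimal one is prosoluble. This is a statement on a finite quotient \<open>F\<close> of \<open>S\<close>: if \<open>F\<close>
  has no proper subgroup of index prime to \<open>p\<close> that supplements a normal subgroup \<open>D\<close> with \<open>F/D\<close>
  soluble, then Frattini's argument makes \<open>F\<close> soluble.

  Every \<open>A x\<close> is conjugate into \<open>S\<close> by an element of \<open>K = ker \<alpha>\<close>. Such conjugators \<open>\<nu> x\<close> can be
  chosen continuously in \<open>x\<close>: by Zorn's lemma one refines a continuous choice modulo closed normal
  subgroups \<open>N\<close> of \<open>G\<close> until \<open>N = 1\<close>. The refinement from \<open>N\<close> to \<open>N \<inter> W\<close> with \<open>W\<close> open is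
  possible locally on \<open>X\<close>, and \<open>X\<close> is zero-dimensional.

  Since \<open>S\<close> is prosoluble, the maps \<open>\<theta> a \<mapsto> \<nu> x a (\<nu> x)\<inverse>\<close> extend to \<open>Ls \<rightarrow> S\<close>. Projectivity of
  \<open>P\<close> yields a section \<open>Ps \<rightarrow> S\<close>, and the two homomorphisms together define \<open>r : Gs \<rightarrow> S\<close>.
\<close>

section \<open>Finite groups\<close>

text \<open>The universal property of \<open>Gs\<close> speaks only of prosoluble targets, and
  \<open>G\<close> is in general not one; hence the search for a prosoluble \<open>S\<close> inside
  \<open>G\<close>. A minimal supplement without further condition would be prosoluble too, but it
  may be too small to contain conjugates of the pro-p groups \<open>A x\<close>. The condition at p
  repairs this; its price is that the Frattini argument may only use supplements of index prime to
  p. The conjugators have to lie in \<open>K\<close>: then \<alpha> does not see the conjugation,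
  and \<open>\<alpha> \<circ> r\<close> is the identity on the factors, hence everywhere by
  uniqueness. They have to depend continuously on \<open>x\<close>, since a free product over a
  space extends only maps that are continuous on the union of the factors. The infinite universe
  enters through projectivity: finite quotients are groups of cosets and must be copied into
  \<open>'u\<close> before they can form an embedding problem.\<close>

definition coprime_index :: "nat \<Rightarrow> 'a set \<Rightarrow> 'a set \<Rightarrow> bool" where
  "coprime_index p E S \<longleftrightarrow> (\<exists>k. card E = k * card S \<and> \<not> p dvd k)"

lemma (in group) card_rcosets_mult:
  assumes "subgroup S G" "subgroup E G" "S \<subseteq> E" "finite E"
  shows "\<exists>k. card E = k * card S"
proof -
  have "group (G\<lparr>carrier := E\<rparr>)" "subgroup S (G\<lparr>carrier := E\<rparr>)"
    using assms subgroup_imp_group subgroup_incl by auto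
  from group.lagrange[OF this] have "card (rcosets\<^bsub>G\<lparr>carrier := E\<rparr>\<^esub> S) * card S = card E"
    by (simp add: order_def)
  then show ?thesis by metis
qed

lemma (in group)
  assumes "subgroup S G" "subgroup E G" "subgroup F G" "S \<subseteq> E" "E \<subseteq> F" "finite F"
    "coprime_index p F S"
  shows coprime_index_lower: "coprime_index p E S" and coprime_index_upper: "coprime_index p F E"
proof -
  obtain k where k: "card F = k * card S" "\<not> p dvd k"
    using assms(7) unfolding coprime_index_def by auto
  obtain a where a: "card F = a * card E" using card_rcosets_mult assms by metis
  obtain b where b: "card E = b * card S"
    using card_rcosets_mult assms finite_subset by metis
  have "card S > 0"
    using assms subgroup.one_closed finite_subset by (metis card_gt_0_iff empty_iff subset_trans)
  then have "k = a * b" using k a b by simp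
  then show "coprime_index p E S" "coprime_index p F E"
    using a b k(2) unfolding coprime_index_def by (metis dvd_mult, metis dvd_mult2)
qed

lemma (in group_hom) subgroup_vimage:
  assumes M: "subgroup M H"
  shows "subgroup {x \<in> carrier G. h x \<in> M} G"
proof (rule G.subgroupI)
  show "{x \<in> carrier G. h x \<in> M} \<noteq> {}"
    using subgroup.one_closed[OF M] hom_one by (metis (mono_tags) G.one_closed empty_Collect_eq)
qed (use M in \<open>auto simp: subgroup.m_closed subgroup.m_inv_closed\<close>)

text \<open>Left translation by an element of \<open>H\<close> is an injective self-map of a finite
  set, hence onto; that \<one> is attained gives the inverse.\<close>

lemma (in group) finite_closed_subgroup:
  assumes fin: "finite H" and sub: "H \<subseteq> carrier G" and one: "\<one> \<in> H"
    and mult: "\<And>x y. x \<in> H \<Longrightarrow> y \<in> H \<Longrightarrow> x \<otimes> y \<in> H"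
  shows "subgroup H G"
proof (rule subgroupI)
  fix x assume x: "x \<in> H"
  have "inj_on (\<lambda>y. x \<otimes> y) H" using x sub by (intro inj_onI) (metis Units_eq Units_l_cancel subsetD)
  then have "(\<lambda>y. x \<otimes> y) ` H = H"
    using endo_inj_surj[OF fin, of "\<lambda>y. x \<otimes> y"] mult x by auto
  then obtain y where y: "y \<in> H" "x \<otimes> y = \<one>" using one by (metis imageE)
  then have "inv x = y" using x sub by (metis inv_equality inv_inv subsetD inv_comm)
  then show "inv x \<in> H" using y by simp
qed (use sub one mult in auto)

lemma (in group) subset_set_mult:
  assumes "subgroup A G" "subgroup B G"
  shows "A \<subseteq> A <#> B" "B \<subseteq> A <#> B"
proof -
  have "\<one> \<in> A" "\<one> \<in> B" "A \<subseteq> carrier G" "B \<subseteq> carrier G"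
    using assms subgroup.one_closed[OF assms(1)] subgroup.one_closed[OF assms(2)]
      subgroup.subset[OF assms(1)] subgroup.subset[OF assms(2)] by auto
  then show "A \<subseteq> A <#> B" "B \<subseteq> A <#> B"
    unfolding set_mult_def using r_one l_one by (auto; metis subsetD)+
qed

lemma (in group) set_mult_subgroup:
  assumes "subgroup S G" "N \<lhd> G"
  shows "subgroup (S <#> N) G" "S <#> N = N <#> S"
  using assms commut_normal second_isomorphism_grp.normal_set_mult_subgroup[of N G S]
  by (auto simp: second_isomorphism_grp_def second_isomorphism_grp_axioms_def)

lemma (in group) cancel_inv:
  assumes "x \<in> carrier G" "y \<in> carrier G"
  shows "inv x \<otimes> (x \<otimes> y) = y" "x \<otimes> (inv x \<otimes> y) = y"
  using assms by (simp_all flip: m_assoc)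

text \<open>Orbit lengths divide \<open>p ^ n\<close>, so an orbit with more than one point has
  length divisible by p, and the moved points are the disjoint union of these orbits. The action is
  a plain function here, which spares its users the group of bijections.\<close>

lemma (in group) card_fixed_points_cong:
  assumes p: "prime p" and ord: "order G = p ^ n" and fin: "finite E"
    and closed: "\<And>g x. g \<in> carrier G \<Longrightarrow> x \<in> E \<Longrightarrow> act g x \<in> E"
    and one: "\<And>x. x \<in> E \<Longrightarrow> act \<one> x = x"
    and mult: "\<And>g h x. g \<in> carrier G \<Longrightarrow> h \<in> carrier G \<Longrightarrow> x \<in> E \<Longrightarrow> act (g \<otimes> h) x = act g (act h x)"
  shows "p dvd card (E - {x \<in> E. \<forall>g \<in> carrier G. act g x = x})"
proof -
  \<comment> \<open>Elements of \<open>BijGroup E\<close> are \<open>undefined\<close> outside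
    \<open>E\<close>, hence the restriction.\<close>
  define \<phi> where "\<phi> = (\<lambda>g. restrict (act g) E)"
  have bij: "\<phi> g \<in> Bij E" if g: "g \<in> carrier G" for g
  proof -
    have "bij_betw (act g) E E"
      by (rule bij_betw_byWitness[where f' = "act (inv g)"])
         (use g closed in \<open>auto simp: mult[symmetric] one\<close>)
    then have "bij_betw (\<phi> g) E E"
      unfolding \<phi>_def by (simp add: bij_betw_cong[of E "act g" "\<lambda>x. if x \<in> E then act g x else undefined"] restrict_def)
    then show ?thesis unfolding Bij_def \<phi>_def by auto
  qed
  have hom: "\<phi> \<in> hom G (BijGroup E)"
  proof (rule homI)
    fix g h assume gh: "g \<in> carrier G" "h \<in> carrier G"
    show "\<phi> (g \<otimes> h) = \<phi> g \<otimes>\<^bsub>BijGroup E\<^esub> \<phi> h"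
      using gh bij closed unfolding BijGroup_def
      by (auto simp: compose_def mult \<phi>_def restrict_def fun_eq_iff)
  qed (use bij in \<open>auto simp: BijGroup_def\<close>)
  interpret A: group_action G E \<phi>
    using hom by (intro group_action.intro) (simp add: group_hom_def group_hom_axioms_def is_group group_BijGroup)
  let ?F = "{x \<in> E. \<forall>g \<in> carrier G. act g x = x}"
  let ?C = "{W \<in> orbits G E \<phi>. card W \<noteq> 1}"
  have orb_sub: "W \<subseteq> E" if "W \<in> orbits G E \<phi>" for W
    using that A.orbits_coverture by blast
  have orb_self: "x \<in> orbit G \<phi> x" if "x \<in> E" for x
    using that A.orbit_refl by auto
  have eq: "E - ?F = \<Union>?C"
  proof (intro equalityI subsetI)
    fix x assume x: "x \<in> E - ?F"
    then obtain g where g: "g \<in> carrier G" "act g x \<noteq> x" by auto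
    have "\<phi> g x \<in> orbit G \<phi> x" using g unfolding orbit_def by auto
    moreover have "\<phi> g x \<noteq> x" using g x unfolding \<phi>_def by auto
    ultimately have "card (orbit G \<phi> x) \<noteq> 1"
      using orb_self[of x] x by (auto simp: card_1_singleton_iff)
    moreover have "orbit G \<phi> x \<in> orbits G E \<phi>" using x unfolding orbits_def by auto
    ultimately show "x \<in> \<Union>?C" using x orb_self[of x] by blast
  next
    fix x assume "x \<in> \<Union>?C"
    then obtain W where W: "W \<in> orbits G E \<phi>" "card W \<noteq> 1" "x \<in> W" by auto
    have xE: "x \<in> E" using W orb_sub by auto
    have "orbit G \<phi> x \<in> orbits G E \<phi>" using xE unfolding orbits_def by auto
    then have Ox: "W = orbit G \<phi> x"
      using A.disjoint_union[OF W(1)] W(3) orb_self[OF xE] by auto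
    have "x \<notin> ?F"
    proof
      assume "x \<in> ?F"
      then have "orbit G \<phi> x \<subseteq> {x}" using xE unfolding orbit_def \<phi>_def by auto
      then have "orbit G \<phi> x = {x}" using orb_self[OF xE] by blast
      then show False using W(2) Ox by simp
    qed
    then show "x \<in> E - ?F" using xE by auto
  qed
  have "p dvd card (\<Union>?C)"
  proof (rule dvd_partition)
    show "finite (\<Union> ?C)" unfolding eq[symmetric] using fin by simp
    show "\<forall>c\<in>?C. p dvd card c"
    proof
      fix W assume W: "W \<in> ?C"
      then obtain x where x: "x \<in> E" "W = orbit G \<phi> x" unfolding orbits_def by auto
      have "card W dvd p ^ n"
        using A.orbit_stabilizer_theorem[OF x(1)] ord x(2) by (metis dvd_triv_left)
      then obtain k where "card W = p ^ k" using p divides_primepow_nat by blast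
      then show "p dvd card W" using W by (cases k) auto
    qed
    show "\<forall>c1\<in>?C. \<forall>c2\<in>?C. c1 \<noteq> c2 \<longrightarrow> c1 \<inter> c2 = {}" using A.disjoint_union by auto
  qed
  then show ?thesis using eq by simp
qed

text \<open>This turns fixed points of an action on cosets into conjugators: a coset
  \<open>S #> g\<close> fixed by all of \<open>H\<close> is the same as an element g that conjugates
  \<open>H\<close> into \<open>S\<close>.\<close>

lemma (in group) rcos_conj_fixed:
  assumes S: "subgroup S G" and g: "g \<in> carrier G" and h: "h \<in> carrier G"
  shows "(S #> g) #> h = S #> g \<longleftrightarrow> g \<otimes> h \<otimes> inv g \<in> S"
proof -
  have SG: "S \<subseteq> carrier G" using S subgroup.subset by auto
  have 1: "(S #> g) #> h = S #> (g \<otimes> h)" using coset_mult_assoc SG g h by auto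
  have 2: "(S #> (g \<otimes> h) = S #> g) \<longleftrightarrow> S #> (g \<otimes> h \<otimes> inv g) = S"
    using SG g h by (metis coset_mult_inv1 coset_mult_inv2 m_closed)
  have 3: "S #> (g \<otimes> h \<otimes> inv g) = S \<longleftrightarrow> g \<otimes> h \<otimes> inv g \<in> S"
    using S g h by (meson coset_join1 coset_join2 inv_closed m_closed)
  show ?thesis using 1 2 3 by simp
qed

lemma (in group) p_dvd_card_moved_cosets:
  assumes fin: "finite (carrier G)" and p: "prime p" and S: "subgroup S G" and H: "subgroup H G"
    and cH: "card H = p ^ n"
  shows "p dvd card (rcosets S - {C \<in> rcosets S. \<forall>h \<in> H. C #> h = C})"
proof -
  let ?H = "G\<lparr>carrier := H\<rparr>"
  let ?E = "rcosets S"
  \<comment> \<open>Right multiplication is a right action; the inverse makes it a left one. As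
    \<open>H\<close> is closed under inverses, the fixed cosets are the same.\<close>
  let ?act = "\<lambda>h C. C #> inv h"
  have SG: "S \<subseteq> carrier G" "H \<subseteq> carrier G" using S H subgroup.subset by auto
  interpret H: group ?H using subgroup_imp_group[OF H] .
  have sub: "C \<subseteq> carrier G" if "C \<in> ?E" for C
    using that SG(1) by (auto simp: RCOSETS_def r_coset_def)
  have "p dvd card (?E - {x \<in> ?E. \<forall>g \<in> carrier ?H. ?act g x = x})"
  proof (rule H.card_fixed_points_cong[OF p, of n])
    show "order ?H = p ^ n" using cH by (simp add: order_def)
    show "finite ?E" using fin by (simp add: RCOSETS_def)
    fix h x assume h: "h \<in> carrier ?H" and x: "x \<in> ?E"
    then have hG: "h \<in> carrier G" using SG by auto
    obtain a where a: "a \<in> carrier G" "x = S #> a" using x unfolding RCOSETS_def by auto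
    show "?act h x \<in> ?E"
      using a hG SG by (auto simp: coset_mult_assoc intro!: rcosetsI)
  next
    fix x assume x: "x \<in> ?E"
    then show "?act \<one>\<^bsub>?H\<^esub> x = x" using sub by simp
  next
    fix g h x assume gh: "g \<in> carrier ?H" "h \<in> carrier ?H" and x: "x \<in> ?E"
    then have "g \<in> carrier G" "h \<in> carrier G" using SG by auto
    then show "?act (g \<otimes>\<^bsub>?H\<^esub> h) x = ?act g (?act h x)"
      using sub[OF x] by (simp add: coset_mult_assoc inv_mult_group)
  qed
  moreover have "(\<forall>h \<in> H. C #> inv h = C) \<longleftrightarrow> (\<forall>h \<in> H. C #> h = C)" for C
    using subgroup.m_inv_closed[OF H] SG(2) by (metis inv_inv subsetD)
  ultimately show ?thesis by simp
qed

text \<open>The number of cosets of \<open>S\<close> is prime to p, whereas p divides the number of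
  cosets moved by \<open>H\<close>. So \<open>H\<close> fixes some \<open>S #> g\<close>. This is
  the conjugacy part of Sylow's theorem, with any subgroup of index prime to p in place of a Sylow
  subgroup.\<close>

lemma (in group) p_subgroup_conj_into:
  assumes fin: "finite (carrier G)" and p: "prime p" and S: "subgroup S G" and H: "subgroup H G"
    and cH: "card H = p ^ n" and ci: "coprime_index p (carrier G) S"
  obtains g where "g \<in> carrier G" "\<And>h. h \<in> H \<Longrightarrow> g \<otimes> h \<otimes> inv g \<in> S"
proof -
  let ?F = "{C \<in> rcosets S. \<forall>h \<in> H. C #> h = C}"
  have SG: "S \<subseteq> carrier G" "H \<subseteq> carrier G" using S H subgroup.subset by auto
  have "card (carrier G) = card (rcosets S) * card S" using lagrange[OF S] by (simp add: order_def)
  moreover have "card S > 0" using S fin SG subgroup.one_closed finite_subset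
    by (metis card_gt_0_iff empty_iff)
  ultimately have "\<not> p dvd card (rcosets S)" using ci unfolding coprime_index_def by auto
  then have "?F \<noteq> {}"
    using p_dvd_card_moved_cosets[OF fin p S H cH] by (metis (no_types, lifting) Diff_empty)
  then obtain C where C: "C \<in> rcosets S" "\<And>h. h \<in> H \<Longrightarrow> C #> h = C" by auto
  obtain g where g: "g \<in> carrier G" "C = S #> g" using C(1) unfolding RCOSETS_def by auto
  have "g \<otimes> h \<otimes> inv g \<in> S" if h: "h \<in> H" for h
    using C(2)[OF h] rcos_conj_fixed[OF S g(1), of h] g h SG by auto
  then show ?thesis using that g(1) by blast
qed

lemma (in group) p_subgroup_conj_into_within:
  assumes fin: "finite E" and p: "prime p" and E: "subgroup E G" and S: "subgroup S G" and H: "subgroup H G"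
    and sub: "S \<subseteq> E" "H \<subseteq> E"
    and cH: "card H = p ^ n" and ci: "coprime_index p E S"
  obtains g where "g \<in> E" "\<And>h. h \<in> H \<Longrightarrow> g \<otimes> h \<otimes> inv g \<in> S"
proof -
  let ?E = "G\<lparr>carrier := E\<rparr>"
  interpret E: group ?E using subgroup_imp_group[OF E] .
  obtain g where g: "g \<in> E" "\<And>h. h \<in> H \<Longrightarrow> g \<otimes> h \<otimes> inv\<^bsub>?E\<^esub> g \<in> S"
    using E.p_subgroup_conj_into[of p S H n] fin p subgroup_incl[OF S E] subgroup_incl[OF H E] sub cH ci
    by auto
  then show ?thesis using that m_inv_consistent[OF E] by auto
qed

lemma (in group) generate_singleton_comm:
  assumes a: "a \<in> carrier G" and gen: "generate G {a} = carrier G"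
  shows "comm_group G"
proof -
  have "subgroup_generated G {a} = G"
    using gen a unfolding subgroup_generated_def by (simp add: Int_absorb1)
  then have "cyclic_group G" using a unfolding cyclic_group_def by auto
  then show ?thesis by (rule cyclic_imp_abelian_group)
qed

text \<open>Only an inclusion of the conjugate of \<open>R\<close> in \<open>R\<close> is asked for.
  It makes the set closed under multiplication, and finiteness of \<open>K\<close> supplies the
  inverses.\<close>

lemma (in group) normalizer_subgroup:
  assumes fin: "finite K" and K: "subgroup K G" and R: "R \<subseteq> carrier G"
  shows "subgroup {g \<in> K. \<forall>r \<in> R. g \<otimes> r \<otimes> inv g \<in> R} G"
proof (rule finite_closed_subgroup)
  show "{g \<in> K. \<forall>r \<in> R. g \<otimes> r \<otimes> inv g \<in> R} \<subseteq> carrier G" using subgroup.subset[OF K] by auto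
  fix x y assume xy: "x \<in> {g \<in> K. \<forall>r \<in> R. g \<otimes> r \<otimes> inv g \<in> R}"
    "y \<in> {g \<in> K. \<forall>r \<in> R. g \<otimes> r \<otimes> inv g \<in> R}"
  then have "x \<in> carrier G" "y \<in> carrier G" using subgroup.mem_carrier[OF K] by auto
  then have "x \<otimes> y \<otimes> g \<otimes> inv (x \<otimes> y) = x \<otimes> (y \<otimes> g \<otimes> inv y) \<otimes> inv x" if "g \<in> R" for g
    using that R by (auto simp: inv_mult_group m_assoc subset_iff)
  then show "x \<otimes> y \<in> {g \<in> K. \<forall>r \<in> R. g \<otimes> r \<otimes> inv g \<in> R}"
    using xy subgroup.m_closed[OF K] by auto
qed (use fin R subgroup.one_closed[OF K] in auto)

lemma (in group) prime_order_comm_group: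
  assumes p: "prime (order G)"
  shows "comm_group G"
proof -
  have fin: "finite (carrier G)" using prime_gt_0_nat[OF p] by (simp add: order_gt_0_iff_finite)
  have "carrier G \<noteq> {\<one>}" using p by (auto simp: order_def)
  then obtain a where a: "a \<in> carrier G" "a \<noteq> \<one>" by blast
  let ?K = "generate G {a}"
  have K: "subgroup ?K G" using a by (intro generate_is_subgroup) auto
  have "card ?K dvd order G" using lagrange[OF K] by (metis dvd_triv_right)
  then have "card ?K = 1 \<or> card ?K = order G" using p by (simp add: prime_nat_iff)
  moreover have "card ?K \<noteq> 1"
  proof
    assume "card ?K = 1"
    moreover have "a \<in> ?K" by (auto intro: generate.incl)
    ultimately show False using subgroup.one_closed[OF K] a(2) by (metis card_1_singletonE singletonD)
  qed
  ultimately have "?K = carrier G"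
    using card_subset_eq[OF fin subgroup.subset[OF K]] by (simp add: order_def)
  then show ?thesis using generate_singleton_comm[OF a(1)] by simp
qed

text \<open>A subgroup \<open>M\<close> of index \<open>p\<close> in \<open>H\<close> fixes its own coset, hence fewer than \<open>p\<close> cosets are
  moved by \<open>M\<close>; their number being divisible by \<open>p\<close>, there are none, so \<open>M\<close> is normal.\<close>

lemma (in group) p_group_solvable_seq:
  assumes p: "prime p" and "subgroup H G" and "card H = p ^ n"
  shows "solvable_seq G H"
  using assms(2,3)
proof (induction n arbitrary: H)
  case 0
  then have "H = {\<one>}" using subgroup.one_closed[OF 0(1)] by (metis card_1_singletonE power_0 singletonD)
  then show ?case using solvable_seq.unity by metis
next
  case (Suc n)
  let ?H = "G\<lparr>carrier := H\<rparr>"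
  have H: "subgroup H G" and HG: "H \<subseteq> carrier G" using Suc.prems subgroup.subset by auto
  have finH: "finite H" using Suc.prems(2) p by (metis card.infinite not_prime_0 power_not_zero)
  interpret H: group ?H using subgroup_imp_group[OF H] .
  have "order ?H = p ^ n * p" using Suc.prems(2) by (simp add: order_def)
  then obtain M where MH: "subgroup M ?H" and M: "card M = p ^ n"
    using sylow_thm[OF p H.is_group] finH by auto
  have Ms: "subgroup M G" using incl_subgroup[OF H MH] .
  have sub: "M \<subseteq> H" using subgroup.subset[OF MH] by simp
  let ?E = "rcosets\<^bsub>?H\<^esub> M" and ?F = "{C \<in> rcosets\<^bsub>?H\<^esub> M. \<forall>h \<in> M. C #>\<^bsub>?H\<^esub> h = C}"
  have finE: "finite ?E" using finH by (simp add: RCOSETS_def)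
  have cE: "card ?E = p" using H.lagrange[OF MH] M Suc.prems(2) p by (auto simp: order_def)
  have "M \<in> ?F"
    using H.coset_join2[OF _ MH] sub subgroup.subgroup_in_rcosets[OF MH H.is_group] by auto
  then have "card (?E - ?F) < p" using cE psubset_card_mono[OF finE, of "?E - ?F"] by blast
  then have "card (?E - ?F) = 0"
    using H.p_dvd_card_moved_cosets[OF _ p MH MH M] finH by (auto dest: dvd_imp_le)
  then have EF: "?E - ?F = {}" using finE by simp
  have "a \<otimes> g \<otimes> inv a \<in> M" if a: "a \<in> H" and g: "g \<in> M" for a g
  proof -
    have "M #>\<^bsub>?H\<^esub> a \<in> ?F" using EF H.rcosetsI[of M a] a sub by auto
    then show ?thesis using rcos_conj_fixed[OF Ms, of a g] a g sub HG by auto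
  qed
  then have N: "M \<lhd> ?H" unfolding H.normal_inv_iff using MH m_inv_consistent[OF H] by auto
  interpret Q: group "?H Mod M" by (rule normal.factorgroup_is_group[OF N])
  have "prime (order (?H Mod M))" using cE p by (simp add: order_def FactGroup_def)
  from solvable_seq.extension[OF Suc.IH[OF Ms M] N H Q.prime_order_comm_group[OF this]] show ?case .
qed

section \<open>Conjugation, Frattini's argument and soluble supplements\<close>

lemma (in group) conj_group_hom:
  assumes "g \<in> carrier G"
  shows "group_hom G G (\<lambda>h. g \<otimes> h \<otimes> inv g)"
  using assms
  by (auto intro!: homI simp: group_hom_def group_hom_axioms_def is_group m_assoc cancel_inv)

lemma (in group) conj_subgroup:
  assumes "g \<in> carrier G" "subgroup H G"
  shows "subgroup ((\<lambda>h. g \<otimes> h \<otimes> inv g) ` H) G"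
  using group_hom.subgroup_img_is_subgroup[OF conj_group_hom] assms by blast

lemma (in group) conj_inj:
  assumes "g \<in> carrier G"
  shows "inj_on (\<lambda>h. g \<otimes> h \<otimes> inv g) (carrier G)"
  using assms by (auto intro!: inj_onI)

text \<open>As \<open>D\<close> and \<open>N\<close> together generate everything, intersecting with
  \<open>D\<close> is a bijection from the cosets of \<open>N\<close> to the cosets of
  \<open>D \<inter> N\<close> in \<open>D\<close>, so the two indices agree.\<close>

lemma (in group) Frattini_coprime_index:
  assumes fin: "finite (carrier G)" and D: "D \<lhd> G" and N: "subgroup N G"
    and cov: "\<And>s. s \<in> carrier G \<Longrightarrow> \<exists>d \<in> D. d \<otimes> s \<in> N"
    and ci: "coprime_index p D (D \<inter> N)"
  shows "coprime_index p (carrier G) N"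
proof -
  let ?D = "G\<lparr>carrier := D\<rparr>"
  have Ds: "subgroup D G" and DG: "D \<subseteq> carrier G" and NG: "N \<subseteq> carrier G"
    using D N normal_imp_subgroup subgroup.subset by blast+
  interpret D: group ?D using subgroup_imp_group[OF Ds] .
  have DN: "subgroup (D \<inter> N) G" using subgroups_Inter_pair Ds N by auto
  have DND: "subgroup (D \<inter> N) ?D" using subgroup_incl[OF DN Ds] by auto
  let ?R = "rcosets\<^bsub>?D\<^esub> (D \<inter> N)"
  have int: "(N #> d) \<inter> D = (D \<inter> N) #> d" if d: "d \<in> D" for d
  proof (intro equalityI subsetI)
    fix x assume "x \<in> (N #> d) \<inter> D"
    then obtain n where n: "n \<in> N" "x = n \<otimes> d" "x \<in> D" unfolding r_coset_def by auto
    then have "n = x \<otimes> inv d" using d DG NG by (simp add: inv_solve_right subset_iff)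
    then have "n \<in> D" using n d Ds by (metis subgroup.m_closed subgroup.m_inv_closed)
    then show "x \<in> (D \<inter> N) #> d" using n unfolding r_coset_def by auto
  next
    fix x assume "x \<in> (D \<inter> N) #> d"
    then show "x \<in> (N #> d) \<inter> D" using d Ds subgroup.m_closed unfolding r_coset_def by fastforce
  qed
  \<comment> \<open>\<open>cov\<close> is applied to the inverse of s, because
    \<open>e \<otimes> inv s \<in> N\<close> says that e and s have the same right coset.\<close>
  have rep: "\<exists>d \<in> D. C = N #> d" if C: "C \<in> rcosets N" for C
  proof -
    obtain s where s: "s \<in> carrier G" "C = N #> s" using C unfolding RCOSETS_def by auto
    obtain e where e: "e \<in> D" "e \<otimes> inv s \<in> N" using cov[of "inv s"] s by auto
    have eG: "e \<in> carrier G" using e DG by auto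
    have "e \<in> N #> s"
      using e s eG unfolding r_coset_def by (auto intro!: bexI[of _ "e \<otimes> inv s"] simp: m_assoc)
    then show ?thesis using repr_independence[OF _ s(1) N] s(2) e(1) by metis
  qed
  have "bij_betw (\<lambda>C. C \<inter> D) (rcosets N) ?R"
  proof (rule bij_betwI')
    fix C C' assume CC: "C \<in> rcosets N" "C' \<in> rcosets N"
    show "(C \<inter> D = C' \<inter> D) = (C = C')"
    proof
      assume eq: "C \<inter> D = C' \<inter> D"
      obtain d where d: "d \<in> D" "C = N #> d" using rep CC by metis
      then have "d \<in> C \<inter> D" using rcos_self[OF _ N] DG by auto
      then have "C \<inter> C' \<noteq> {}" using eq by auto
      then show "C = C'" using rcos_disjoint[OF N] CC unfolding pairwise_def disjnt_def by blast
    qed auto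
  next
    fix C assume "C \<in> rcosets N"
    then obtain d where d: "d \<in> D" "C = N #> d" using rep by metis
    then show "C \<inter> D \<in> ?R" using int unfolding RCOSETS_def r_coset_def by auto
  next
    fix C assume "C \<in> ?R"
    then obtain d where d: "d \<in> D" "C = (D \<inter> N) #> d" unfolding RCOSETS_def r_coset_def by auto
    then show "\<exists>C'\<in>rcosets N. C = C' \<inter> D" using int rcosetsI[OF NG, of d] DG by auto
  qed
  then have "card (rcosets N) = card ?R" by (rule bij_betw_same_card)
  moreover have "card ?R * card (D \<inter> N) = card D" using D.lagrange[OF DND] by (simp add: order_def)
  moreover have "card (rcosets N) * card N = card (carrier G)" using lagrange[OF N] by (simp add: order_def)
  moreover have "card (D \<inter> N) > 0"
    using subgroup.one_closed[OF DN] fin DG finite_subset by (metis card_gt_0_iff empty_iff finite_Int)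
  ultimately show ?thesis using ci unfolding coprime_index_def by (metis mult_right_cancel not_gr_zero)
qed

text \<open>\<open>T <#> R\<close> and \<open>R\<close> have the same image in the quotient by
  \<open>T\<close>, so the product is an extension of a soluble image of \<open>R\<close> by
  \<open>T\<close>.\<close>

lemma (in group) solvable_seq_normal_mult:
  assumes T: "T \<lhd> G" "solvable_seq G T" and R: "subgroup R G" "solvable_seq G R"
  shows "solvable_seq G (T <#> R)"
proof -
  interpret T: normal T G by (rule T(1))
  have TG: "T \<subseteq> carrier G" "R \<subseteq> carrier G" using T.subset R subgroup.subset by auto
  let ?pi = "\<lambda>x. T #> x"
  have pi: "group_hom G (G Mod T) ?pi"
    using T.r_coset_hom_Mod T.factorgroup_is_group by (simp add: group_hom_def group_hom_axioms_def is_group)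
  show ?thesis
  proof (rule solvable_seq_condition[of G G id "G Mod T" ?pi T])
    show "group_hom G G id" by (simp add: group_hom_def group_hom_axioms_def is_group hom_def)
    show "group_hom G (G Mod T) ?pi" by (rule pi)
    show "id ` T \<subseteq> T <#> R"
      using subset_set_mult(1)[OF T.is_subgroup R(1)] by simp
    show "kernel G (G Mod T) ?pi \<subseteq> id ` T"
      using coset_join1[OF _ _ T.is_subgroup] by (auto simp: kernel_def)
    show "subgroup (T <#> R) G"
      using set_mult_subgroup[OF R(1) T(1)] by simp
    have "?pi ` (T <#> R) = ?pi ` R"
    proof (intro equalityI subsetI)
      fix y assume "y \<in> ?pi ` (T <#> R)"
      then obtain t r where tr: "t \<in> T" "r \<in> R" "y = T #> (t \<otimes> r)" unfolding set_mult_def by auto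
      then have "y = T #> t #> r" using TG coset_mult_assoc by (metis subsetD)
      also have "T #> t = T" using tr TG coset_join2 T.is_subgroup by (metis subsetD)
      finally show "y \<in> ?pi ` R" using tr by auto
    next
      fix y assume "y \<in> ?pi ` R"
      then obtain r where "r \<in> R" "y = T #> r" by auto
      moreover then have "r = \<one> \<otimes> r" using TG by auto
      ultimately show "y \<in> ?pi ` (T <#> R)" using T.one_closed unfolding set_mult_def by blast
    qed
    then show "solvable_seq (G Mod T) (?pi ` (T <#> R))"
      using group_hom.solvable_imp_solvable_img[OF pi R(2)] by simp
  qed (rule T(2))
qed

text \<open>Frattini arguments inside the kernel: a maximal soluble normal subgroup \<open>T\<close> of \<open>G\<close> in the
  kernel is the whole kernel, as otherwise \<open>T R\<close> with \<open>R\<close> a Sylow subgroup of the kernel would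
  be normal by minimality.\<close>

theorem (in group_hom) minimal_supplement_solvable:
  assumes fin: "finite (carrier G)" and p: "prime p" and sol: "solvable H"
    and minimal: "\<And>S. subgroup S G \<Longrightarrow> h ` S = h ` carrier G \<Longrightarrow> coprime_index p (carrier G) S \<Longrightarrow> S = carrier G"
  shows "solvable G"
proof -
  define D where "D = kernel G H h"
  have D: "D \<lhd> G" unfolding D_def by (rule normal_kernel)
  have Ds: "subgroup D G" and DG: "D \<subseteq> carrier G"
    using D normal_imp_subgroup subgroup.subset by blast+
  have finD: "finite D" using DG fin finite_subset by auto
  interpret D: group "G\<lparr>carrier := D\<rparr>" using G.subgroup_imp_group[OF Ds] .
  define \<T> where "\<T> = {T. T \<lhd> G \<and> T \<subseteq> D \<and> solvable_seq G T}"
  have "{\<one>} \<in> \<T>"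
    unfolding \<T>_def using G.one_is_normal solvable_seq.unity subgroup.one_closed[OF Ds] by auto
  moreover have "finite \<T>" unfolding \<T>_def using finD by (auto intro: finite_subset[of _ "Pow D"])
  ultimately obtain T where T: "T \<in> \<T>" and Tmax: "\<And>T'. T' \<in> \<T> \<Longrightarrow> T \<subseteq> T' \<Longrightarrow> T' = T"
    using finite_has_maximal[of \<T>] by (metis empty_iff)
  then have Tn: "T \<lhd> G" and TD: "T \<subseteq> D" and Tsol: "solvable_seq G T" unfolding \<T>_def by auto
  interpret T: normal T G by (rule Tn)
  have "T = D"
  proof (rule ccontr)
    assume "T \<noteq> D"
    obtain c where c: "card D = c * card T"
      using G.card_rcosets_mult[OF T.is_subgroup Ds TD finD] by auto
    have "c \<noteq> 1"
      using c \<open>T \<noteq> D\<close> TD finD by (metis card_subset_eq mult_1)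
    \<comment> \<open>If p divides the index c of \<open>T\<close> in \<open>D\<close>, take q = p,
      otherwise any prime factor of c. This choice is what keeps the index of the normalizer
      \<open>M\<close> below prime to p.\<close>
    then obtain q where q: "prime q" "q dvd c" "q = p \<or> \<not> p dvd c"
      using p prime_factor_nat by metis
    have cD: "card D \<noteq> 0" using finD subgroup.one_closed[OF Ds] by auto
    obtain m where m: "card D = q ^ multiplicity q (card D) * m" "\<not> q dvd m"
      using multiplicity_decompose'[of "card D" q] cD q(1) by (metis not_prime_unit)
    define a where "a = multiplicity q (card D)"
    obtain R where R: "subgroup R (G\<lparr>carrier := D\<rparr>)" "card R = q ^ a"
      using sylow_thm[OF q(1) D.is_group, of a m] m(1) finD unfolding a_def order_def by auto
    have Rs: "subgroup R G" using G.incl_subgroup[OF Ds R(1)] .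
    have RD: "R \<subseteq> D" using subgroup.subset[OF R(1)] by simp
    have ciR: "coprime_index q D R" unfolding coprime_index_def using m R a_def by (metis mult.commute)
    define Q where "Q = T <#> R"
    have Qs: "subgroup Q G" unfolding Q_def using G.set_mult_subgroup[OF Rs Tn] by simp
    have QD: "Q \<subseteq> D" unfolding Q_def set_mult_def using TD RD subgroup.m_closed[OF Ds] by auto
    have Qsol: "solvable_seq G Q"
      unfolding Q_def using G.solvable_seq_normal_mult[OF Tn Tsol Rs] G.p_group_solvable_seq[OF q(1) Rs R(2)] by auto
    have TQ: "T \<subseteq> Q" and RQ: "R \<subseteq> Q"
      unfolding Q_def using G.subset_set_mult[OF T.is_subgroup Rs] by auto
    \<comment> \<open>\<open>card R\<close> is the full q-part of \<open>card D\<close>, while q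
      divides the index of \<open>T\<close>.\<close>
    have "\<not> R \<subseteq> T"
    proof
      assume "R \<subseteq> T"
      then obtain k where k: "card T = k * card R"
        using G.card_rcosets_mult[OF Rs T.is_subgroup] finite_subset[OF TD finD] by auto
      obtain c' where "c = q * c'" using q(2) by auto
      then have "q ^ a * m = q ^ a * (q * c' * k)" using c k m(1) R(2) a_def by (simp add: mult_ac)
      then have "q dvd m" using q(1) by (simp add: prime_gt_0_nat)
      then show False using m(2) by simp
    qed
    then have "Q \<noteq> T" using RQ by auto
    define M where "M = {g \<in> carrier G. \<forall>x \<in> Q. g \<otimes> x \<otimes> inv g \<in> Q}"
    have Ms: "subgroup M G"
      unfolding M_def using G.normalizer_subgroup[OF fin G.subgroup_self subgroup.subset[OF Qs]] .
    have QM: "Q \<subseteq> M"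
      unfolding M_def using Qs by (auto simp: subgroup.m_closed subgroup.m_inv_closed subgroup.mem_carrier)
    \<comment> \<open>Frattini: conjugation by s moves \<open>R\<close> to a subgroup of
      \<open>D\<close> of the same order, and some d in \<open>D\<close> moves that back into
      \<open>R\<close>. So \<open>d \<otimes> s\<close> normalizes \<open>R\<close>, and with the
      normal subgroup \<open>T\<close> also \<open>Q\<close>.\<close>
    have cov: "\<exists>d \<in> D. d \<otimes> s \<in> M" if s: "s \<in> carrier G" for s
    proof -
      let ?H = "(\<lambda>x. s \<otimes> x \<otimes> inv s) ` R"
      have "subgroup ?H G" using G.conj_subgroup[OF s Rs] .
      moreover have "?H \<subseteq> D" using RD s normal.inv_op_closed2[OF D] by auto
      moreover have "card ?H = q ^ a"
        using R(2) card_image[OF inj_on_subset[OF G.conj_inj[OF s]]] RD DG by auto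
      ultimately obtain d where d: "d \<in> D" "\<And>x. x \<in> ?H \<Longrightarrow> d \<otimes> x \<otimes> inv d \<in> R"
        using G.p_subgroup_conj_into_within[OF finD q(1) Ds Rs _ RD _ _ ciR] by metis
      have dG: "d \<in> carrier G" using d DG by auto
      have "d \<otimes> s \<otimes> x \<otimes> inv (d \<otimes> s) \<in> Q" if x: "x \<in> Q" for x
      proof -
        obtain t r where tr: "t \<in> T" "r \<in> R" "x = t \<otimes> r" using x unfolding Q_def set_mult_def by auto
        have G: "t \<in> carrier G" "r \<in> carrier G" using tr TD RD DG by auto
        have "d \<otimes> s \<otimes> x \<otimes> inv (d \<otimes> s) = (d \<otimes> s \<otimes> t \<otimes> inv (d \<otimes> s)) \<otimes> (d \<otimes> (s \<otimes> r \<otimes> inv s) \<otimes> inv d)"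
          using G tr(3) dG s by (simp add: G.m_assoc G.inv_mult_group G.cancel_inv)
        moreover have "d \<otimes> s \<otimes> t \<otimes> inv (d \<otimes> s) \<in> T" using T.inv_op_closed2 tr dG s by simp
        moreover have "d \<otimes> (s \<otimes> r \<otimes> inv s) \<otimes> inv d \<in> R" using d(2) tr by auto
        ultimately show ?thesis unfolding Q_def set_mult_def by auto
      qed
      then show ?thesis using d(1) dG s unfolding M_def by auto
    qed
    have DM: "subgroup (D \<inter> M) G" using G.subgroups_Inter_pair Ds Ms by auto
    \<comment> \<open>\<open>D \<inter> M\<close> contains \<open>R\<close> and \<open>T\<close>.
      For q = p the Sylow subgroup \<open>R\<close> has index prime to p in \<open>D\<close>;
      otherwise \<open>T\<close> has, by the choice of q.\<close>
    have "coprime_index p D (D \<inter> M)"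
    proof (cases "q = p")
      case True
      then show ?thesis
        using G.coprime_index_upper[OF Rs DM Ds _ _ finD] ciR RQ QM RD by auto
    next
      case False
      then have "coprime_index p D T" using c q(3) unfolding coprime_index_def by auto
      then show ?thesis
        using G.coprime_index_upper[OF T.is_subgroup DM Ds _ _ finD] TQ QM TD by auto
    qed
    then have "coprime_index p (carrier G) M"
      using G.Frattini_coprime_index[OF fin D Ms cov] by auto
    moreover have "h ` M = h ` carrier G"
    proof (intro equalityI subsetI)
      fix y assume "y \<in> h ` carrier G"
      then obtain s where s: "s \<in> carrier G" "y = h s" by auto
      obtain d where d: "d \<in> D" "d \<otimes> s \<in> M" using cov s by auto
      then have "h (d \<otimes> s) = h s" using s DG unfolding D_def kernel_def by auto
      then show "y \<in> h ` M" using d(2) s(2) by (metis imageI)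
    qed (use subgroup.subset[OF Ms] in auto)
    ultimately have "M = carrier G" using minimal[OF Ms] by auto
    then have "Q \<lhd> G" unfolding G.normal_inv_iff using Qs unfolding M_def by auto
    then have "Q \<in> \<T>" unfolding \<T>_def using QD Qsol by auto
    then show False using Tmax TQ \<open>Q \<noteq> T\<close> by auto
  qed
  have "solvable_seq G (carrier G)"
  proof (rule solvable_seq_condition[of G G id H h D])
    show "group_hom G G id" by (simp add: group_hom_def group_hom_axioms_def G.is_group hom_def)
    show "group_hom G H h" by unfold_locales
    show "solvable_seq G D" using Tsol \<open>T = D\<close> by simp
    show "solvable_seq H (h ` carrier G)"
      using H.solvable_subgroup[OF img_is_subgroup sol] .
  qed (use DG G.subgroup_self in \<open>auto simp: D_def\<close>)
  then show ?thesis unfolding solvable_def .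
qed

text \<open>Cauchy's theorem, as Sylow's theorem with exponent 1: another prime q dividing
  \<open>card H\<close> would give an element of order q, which no power of p annihilates.\<close>

lemma (in group) p_torsion_card:
  assumes fin: "finite (carrier G)" and p: "prime p" and H: "subgroup H G"
    and tor: "\<And>h. h \<in> H \<Longrightarrow> \<exists>n. h [^] (p ^ n :: nat) = \<one>"
  obtains n where "card H = p ^ n"
proof -
  have finH: "finite H" using fin H subgroup.subset finite_subset by metis
  have c0: "card H \<noteq> 0" using finH subgroup.one_closed[OF H] by auto
  have "q = p" if q: "prime q" "q dvd card H" for q
  proof (rule ccontr)
    assume "q \<noteq> p"
    interpret H: group "G\<lparr>carrier := H\<rparr>" using subgroup_imp_group[OF H] .
    obtain m where m: "order (G\<lparr>carrier := H\<rparr>) = q ^ 1 * m" using q(2) by (auto simp: order_def)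
    obtain C where C: "subgroup C (G\<lparr>carrier := H\<rparr>)" "card C = q"
      using sylow_thm[OF q(1) H.is_group m] finH by auto
    have Cs: "subgroup C G" using incl_subgroup[OF H C(1)] .
    have CH: "C \<subseteq> H" using subgroup.subset[OF C(1)] by simp
    obtain x where x: "x \<in> C" "x \<noteq> \<one>"
    proof -
      have "C \<noteq> {\<one>}" using C(2) q(1) by auto
      then show ?thesis using that subgroup.one_closed[OF Cs] by blast
    qed
    have xG: "x \<in> carrier G" using x CH H subgroup.subset by auto
    obtain n where n: "x [^] (p ^ n :: nat) = \<one>" using tor x CH by auto
    interpret C: group "G\<lparr>carrier := C\<rparr>" using subgroup_imp_group[OF Cs] .
    have "x [^]\<^bsub>G\<lparr>carrier := C\<rparr>\<^esub> order (G\<lparr>carrier := C\<rparr>) = \<one>"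
      using C.pow_order_eq_1[of x] x by simp
    moreover have "order (G\<lparr>carrier := C\<rparr>) = q" using C(2) by (simp add: order_def)
    ultimately have "x [^] q = \<one>" by (simp flip: nat_pow_consistent)
    then have "ord x dvd q" "ord x dvd p ^ n" using n xG pow_eq_id by auto
    moreover have "coprime q (p ^ n)" using q(1) p \<open>q \<noteq> p\<close> by (simp add: primes_coprime)
    ultimately have "ord x = 1" using coprime_common_divisor_nat by blast
    then show False using x(2) xG ord_eq_1 by auto
  qed
  moreover obtain y where y: "card H = p ^ multiplicity p (card H) * y" "\<not> p dvd y"
    using multiplicity_decompose'[of "card H" p] c0 p not_prime_unit by metis
  ultimately have "y = 1" by (metis dvd_mult prime_factor_nat)
  then show ?thesis using that y(1) by simp
qed

lemma (in group) p_subgroup_conj_by_normal: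
  assumes fin: "finite (carrier G)" and p: "prime p" and S: "subgroup S G" and M: "M \<lhd> G"
    and H: "subgroup H G" and sub: "H \<subseteq> S <#> M"
    and tor: "\<And>h. h \<in> H \<Longrightarrow> \<exists>n. h [^] (p ^ n :: nat) = \<one>"
    and ci: "coprime_index p (carrier G) S"
  obtains m where "m \<in> M" "\<And>h. h \<in> H \<Longrightarrow> m \<otimes> h \<otimes> inv m \<in> S"
proof -
  interpret M: normal M G by (rule M)
  let ?E = "S <#> M"
  have E: "subgroup ?E G" by (rule set_mult_subgroup(1)[OF S M])
  have SE: "S \<subseteq> ?E" using subset_set_mult(1)[OF S M.is_subgroup] .
  have finE: "finite ?E" using subgroup.subset[OF E] fin finite_subset by blast
  have "coprime_index p ?E S"
    using coprime_index_lower[OF S E subgroup_self SE subgroup.subset[OF E] fin ci] .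
  moreover obtain n where "card H = p ^ n" using p_torsion_card[OF fin p H tor] by metis
  ultimately obtain g where g: "g \<in> ?E" "\<And>h. h \<in> H \<Longrightarrow> g \<otimes> h \<otimes> inv g \<in> S"
    using p_subgroup_conj_into_within[OF finE p E S H SE sub] by metis
  obtain s m where sm: "s \<in> S" "m \<in> M" "g = s \<otimes> m" using g(1) unfolding set_mult_def by auto
  have sG: "s \<in> carrier G" "m \<in> carrier G" using sm subgroup.mem_carrier[OF S] M.mem_carrier by auto
  have "m \<otimes> h \<otimes> inv m \<in> S" if h: "h \<in> H" for h
  proof -
    have hG: "h \<in> carrier G" using subgroup.mem_carrier[OF H h] .
    have "m \<otimes> h \<otimes> inv m = inv s \<otimes> (g \<otimes> h \<otimes> inv g) \<otimes> s"
      using sm(3) sG hG by (simp add: m_assoc inv_mult_group cancel_inv)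
    then show ?thesis
      using g(2)[OF h] sm(1) by (simp add: subgroup.m_closed[OF S] subgroup.m_inv_closed[OF S])
  qed
  then show ?thesis using that sm(2) by blast
qed

section \<open>Compactness and minimal closed sets\<close>

text \<open>Zorn's lemma for reversed inclusion, obtained by passing to complements.\<close>

lemma minimal_set_exists:
  assumes "\<A> \<noteq> {}" and ch: "\<And>\<C>. \<C> \<noteq> {} \<Longrightarrow> subset.chain \<A> \<C> \<Longrightarrow> \<Inter>\<C> \<in> \<A>"
  obtains M where "M \<in> \<A>" "\<And>X. X \<in> \<A> \<Longrightarrow> X \<subseteq> M \<Longrightarrow> X = M"
proof -
  have "\<exists>M\<in>uminus ` \<A>. \<forall>X\<in>uminus ` \<A>. M \<subseteq> X \<longrightarrow> X = M"
  proof (rule subset_Zorn_nonempty)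
    fix \<C> :: "'a set set" assume \<C>: "\<C> \<noteq> {}" "subset.chain (uminus ` \<A>) \<C>"
    have "subset.chain \<A> (uminus ` \<C>)"
      unfolding subset_chain_def
    proof (intro conjI ballI)
      show "uminus ` \<C> \<subseteq> \<A>" using \<C>(2) unfolding subset_chain_def by auto
      fix X Y assume "X \<in> uminus ` \<C>" "Y \<in> uminus ` \<C>"
      then have "- X \<in> \<C>" "- Y \<in> \<C>" by auto
      then have "- X \<subseteq> - Y \<or> - Y \<subseteq> - X" using \<C>(2) unfolding subset_chain_def by blast
      then show "X \<subseteq> Y \<or> Y \<subseteq> X" by auto
    qed
    then have "\<Inter> (uminus ` \<C>) \<in> \<A>" using ch[of "uminus ` \<C>"] \<C>(1) by simp
    moreover have "\<Union>\<C> = - \<Inter> (uminus ` \<C>)" by (simp add: Compl_INT)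
    ultimately show "\<Union>\<C> \<in> uminus ` \<A>" by (metis imageI)
  qed (use assms in auto)
  then obtain M where "M \<in> \<A>" "\<forall>X\<in>\<A>. - M \<subseteq> - X \<longrightarrow> - X = - M" by auto
  then show ?thesis using that by (metis Compl_anti_mono double_complement)
qed

text \<open>A finite part of a chain has a least member, so the finite intersection property holds
  by monotonicity. In the applications \<open>f S\<close> is the closed set of solutions to a
  problem posed by \<open>S\<close>; a common point solves the problem for the intersection of the
  chain.\<close>

lemma compact_chain_common_point:
  assumes T: "compact_space T" and ne: "\<C> \<noteq> {}" and ch: "subset.chain \<A> \<C>"
    and cl: "\<And>S. S \<in> \<C> \<Longrightarrow> closedin T (f S)" and nef: "\<And>S. S \<in> \<C> \<Longrightarrow> f S \<noteq> {}"
    and mono: "\<And>S S'. S \<in> \<C> \<Longrightarrow> S' \<in> \<C> \<Longrightarrow> S \<subseteq> S' \<Longrightarrow> f S \<subseteq> f S'"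
  obtains x where "\<And>S. S \<in> \<C> \<Longrightarrow> x \<in> f S"
proof -
  have least: "\<exists>S \<in> \<C>. \<forall>S' \<in> \<F>. S \<subseteq> S'" if "finite \<F>" "\<F> \<subseteq> \<C>" for \<F>
    using that
  proof (induction rule: finite_induct)
    case (insert a F)
    then obtain S where "S \<in> \<C>" "\<forall>S' \<in> F. S \<subseteq> S'" by auto
    moreover have "S \<subseteq> a \<or> a \<subseteq> S" using ch insert.prems \<open>S \<in> \<C>\<close> unfolding subset_chain_def by blast
    moreover have "a \<in> \<C>" using insert.prems by simp
    ultimately consider "S \<in> \<C>" "\<forall>S' \<in> insert a F. S \<subseteq> S'" | "a \<in> \<C>" "\<forall>S' \<in> insert a F. a \<subseteq> S'"
      by (metis insert_iff order.refl order.trans)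
    then show ?case by cases auto
  qed (use ne in auto)
  have "\<Inter> (f ` \<C>) \<noteq> {}"
  proof (rule T[unfolded compact_space_fip, rule_format], intro conjI ballI allI impI)
    fix \<F> assume "finite \<F> \<and> \<F> \<subseteq> f ` \<C>"
    then obtain \<G> where \<G>: "finite \<G>" "\<G> \<subseteq> \<C>" "\<F> = f ` \<G>" by (metis finite_subset_image)
    obtain S where S: "S \<in> \<C>" "\<forall>S' \<in> \<G>. S \<subseteq> S'" using least \<G> by blast
    then have "f S \<subseteq> \<Inter>\<F>" using \<G> mono by blast
    then show "\<Inter>\<F> \<noteq> {}" using nef S by blast
  qed (use cl in auto)
  then show ?thesis using that by blast
qed

text \<open>In a compact Hausdorff space quasi-components are components, here points. So clopen
  sets separate x from each point outside \<open>W\<close>, and by compactness finitely many of them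
  suffice.\<close>

lemma profinite_space_clopen_nbhd:
  assumes X: "profinite_space X" and W: "openin X W" and x: "x \<in> W"
  obtains C where "openin X C" "closedin X C" "x \<in> C" "C \<subseteq> W"
proof -
  have comp: "compact_space X" and haus: "Hausdorff_space X"
    and td: "\<And>S. connectedin X S \<Longrightarrow> \<exists>a. S \<subseteq> {a}"
    using X unfolding profinite_space_def by auto
  have xX: "x \<in> topspace X" using W x openin_subset by blast
  obtain a where a: "connected_component_of_set X x \<subseteq> {a}"
    using td[OF connectedin_connected_component_of] by metis
  have "x \<in> connected_component_of_set X x"
    using xX by (simp add: connected_component_of_refl)
  then have cc: "connected_component_of_set X x \<subseteq> {x}" using a by (metis singletonD subsetD)
  have "quasi_component_of X x = connected_component_of X x"
    by (intro quasi_eq_connected_component_of) (simp add: comp haus)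
  then have qc: "\<exists>T. x \<in> T \<and> closedin X T \<and> openin X T \<and> y \<notin> T" if "y \<in> topspace X - W" for y
    using cc that x xX quasi_component_of[of X x y] by fastforce
  let ?F = "insert (topspace X - W) {T. x \<in> T \<and> closedin X T \<and> openin X T}"
  have "\<Inter> ?F = {}" using qc by blast
  then obtain \<F> where \<F>: "finite \<F>" "\<F> \<subseteq> ?F" "\<Inter>\<F> = {}"
    using comp[unfolded compact_space_fip, rule_format, of ?F] W by auto
  \<comment> \<open>The whole space is added so that the family is not empty and its intersection
    stays inside the space.\<close>
  define \<G> where "\<G> = insert (topspace X) (\<F> - {topspace X - W})"
  have \<G>: "finite \<G>" "\<And>T. T \<in> \<G> \<Longrightarrow> x \<in> T \<and> closedin X T \<and> openin X T"
    using \<F> xX unfolding \<G>_def by auto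
  have ne: "\<G> \<noteq> {}" unfolding \<G>_def by auto
  have "openin X (\<Inter>\<G>)" using \<G> ne by (intro openin_Inter) auto
  moreover have "closedin X (\<Inter>\<G>)" using \<G> ne by (intro closedin_Inter) auto
  moreover have "\<Inter>\<G> \<subseteq> W"
  proof
    fix y assume y: "y \<in> \<Inter>\<G>"
    then have "y \<in> topspace X" unfolding \<G>_def by auto
    moreover obtain T where "T \<in> \<F>" "y \<notin> T" using \<F>(3) by blast
    moreover have "T = topspace X - W" using y \<open>T \<in> \<F>\<close> \<open>y \<notin> T\<close> unfolding \<G>_def by auto
    ultimately show "y \<in> W" by auto
  qed
  ultimately show ?thesis using that \<G> by blast
qed

text \<open>Finitely many clopen sets, each with a constant solution, cover the space; overriding
  one choice by the next makes a single locally constant one.\<close>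

lemma profinite_space_locally_constant_choice:
  assumes X: "profinite_space X"
    and loc: "\<And>x. x \<in> topspace X \<Longrightarrow> \<exists>W k. openin X W \<and> x \<in> W \<and> (\<forall>y \<in> W. R y k)"
  obtains c where "\<And>x. x \<in> topspace X \<Longrightarrow> R x (c x)"
    "\<And>k. openin X {x \<in> topspace X. c x = k}"
proof -
  have "\<exists>C k. openin X C \<and> closedin X C \<and> x \<in> C \<and> (\<forall>y \<in> C. R y k)" if "x \<in> topspace X" for x
  proof -
    obtain W k where "openin X W" "x \<in> W" "\<forall>y \<in> W. R y k" using loc \<open>x \<in> topspace X\<close> by blast
    then show ?thesis using profinite_space_clopen_nbhd[OF X, of W x] by (metis subsetD)
  qed
  then obtain C k where C: "\<And>x. x \<in> topspace X \<Longrightarrow>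
      openin X (C x) \<and> closedin X (C x) \<and> x \<in> C x \<and> (\<forall>y \<in> C x. R y (k x))" by metis
  have "\<exists>\<F>. finite \<F> \<and> \<F> \<subseteq> C ` topspace X \<and> topspace X \<subseteq> \<Union>\<F>"
  proof -
    have "\<forall>U \<in> C ` topspace X. openin X U" "topspace X \<subseteq> \<Union> (C ` topspace X)" using C by auto
    then show ?thesis using X unfolding profinite_space_def compact_space_alt by simp
  qed
  then obtain F where F: "finite F" "F \<subseteq> topspace X" "topspace X \<subseteq> \<Union> (C ` F)"
    by (metis finite_subset_image)
  have "\<exists>c. (\<forall>x \<in> \<Union> (C ` F'). R x (c x)) \<and> (\<forall>k. openin X {x \<in> \<Union> (C ` F'). c x = k})"
    if "finite F'" "F' \<subseteq> topspace X" for F'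
    using that
  proof (induction rule: finite_induct)
    case empty then show ?case by auto
  next
    case (insert a F')
    then obtain c where c: "\<forall>x \<in> \<Union> (C ` F'). R x (c x)" "\<forall>k. openin X {x \<in> \<Union> (C ` F'). c x = k}" by auto
    have a: "openin X (C a)" "closedin X (C a)" "\<forall>y \<in> C a. R y (k a)" using C insert.prems by auto
    \<comment> \<open>The new value wins on \<open>C a\<close>. Fibres stay open because
      \<open>C a\<close> is closed as well as open.\<close>
    define c' where "c' = (\<lambda>x. if x \<in> C a then k a else c x)"
    have "{x \<in> \<Union> (C ` insert a F'). c' x = j} =
      (if j = k a then C a else {}) \<union> ({x \<in> \<Union> (C ` F'). c x = j} - C a)" for j
      unfolding c'_def by auto
    then have "openin X {x \<in> \<Union> (C ` insert a F'). c' x = j}" for j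
      using a c(2) by (auto intro!: openin_Un openin_diff)
    moreover have "\<forall>x \<in> \<Union> (C ` insert a F'). R x (c' x)" using a c(1) unfolding c'_def by auto
    ultimately show ?case by blast
  qed
  from this[OF F(1,2)] obtain c where c: "\<forall>x \<in> \<Union> (C ` F). R x (c x)"
    "\<forall>k. openin X {x \<in> \<Union> (C ` F). c x = k}" by auto
  have "\<Union> (C ` F) = topspace X" using F C openin_subset by (intro equalityI) blast+
  then show ?thesis using that c by auto
qed

text \<open>The preimage of \<open>C\<close> is the projection of a closed part of the graph, and
  projection along a compact space is a closed map.\<close>

lemma continuous_map_of_closed_graph:
  assumes Y: "compact_space Y" and f: "f ` topspace Z \<subseteq> topspace Y"
    and g: "closedin (prod_topology Z Y) ((\<lambda>z. (z, f z)) ` topspace Z)"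
  shows "continuous_map Z Y f"
  unfolding continuous_map_closedin
proof (intro conjI allI impI)
  fix C assume C: "closedin Y C"
  have "closedin (prod_topology Z Y) ((topspace Z \<times> C) \<inter> (\<lambda>z. (z, f z)) ` topspace Z)"
    using C g by (intro closedin_Int) (auto simp: closedin_prod_Times_iff)
  then have "closedin Z (fst ` ((topspace Z \<times> C) \<inter> (\<lambda>z. (z, f z)) ` topspace Z))"
    using closed_map_fst[OF Y, of Z] unfolding closed_map_def by blast
  moreover have "fst ` ((topspace Z \<times> C) \<inter> (\<lambda>z. (z, f z)) ` topspace Z) = {x \<in> topspace Z. f x \<in> C}"
    by force
  ultimately show "closedin Z {x \<in> topspace Z. f x \<in> C}" by simp
qed (use f in auto)

section \<open>Profinite groups\<close>

locale group_of_tgroup = group G for G :: "'a tgroup" (structure)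

section \<open>Subgroups as topological groups\<close>

lemma tsub_simps [simp]:
  "carrier (tsub G H) = H" "gtop (tsub G H) = subtopology (gtop G) H"
  "monoid.mult (tsub G H) = monoid.mult G" "one (tsub G H) = one G"
  by (simp_all add: tsub_def)

lemma tsub_tsub: "K \<subseteq> H \<Longrightarrow> tsub (tsub G H) K = tsub G K"
  by (simp add: tsub_def subtopology_subtopology Int_absorb1)

lemma r_coset_tsub [simp]: "r_coset (tsub G H) = r_coset G"
  by (simp add: fun_eq_iff r_coset_def)

lemma set_mult_tsub [simp]: "set_mult (tsub G H) = set_mult G"
  by (simp add: fun_eq_iff set_mult_def)

lemma nat_pow_tsub [simp]: "x [^]\<^bsub>tsub G H\<^esub> (n::nat) = x [^]\<^bsub>G\<^esub> n"
  by (simp add: nat_pow_def)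

lemma (in group_of_tgroup) group_tsub:
  assumes H: "subgroup H G"
  shows "group (tsub G H)"
proof (rule groupI)
  fix x assume "x \<in> carrier (tsub G H)"
  then show "\<exists>y\<in>carrier (tsub G H). y \<otimes>\<^bsub>tsub G H\<^esub> x = \<one>\<^bsub>tsub G H\<^esub>"
    using subgroup.m_inv_closed[OF H] subgroup.mem_carrier[OF H] by (auto intro!: bexI[of _ "inv x"])
qed (use subgroup.m_closed[OF H] subgroup.one_closed[OF H] subgroup.mem_carrier[OF H] in \<open>auto simp: m_assoc\<close>)

lemma (in group_of_tgroup) inv_tsub:
  assumes H: "subgroup H G" and x: "x \<in> H"
  shows "inv\<^bsub>tsub G H\<^esub> x = inv x"
proof (rule group.inv_equality[OF group_tsub[OF H]])
  show "inv x \<otimes>\<^bsub>tsub G H\<^esub> x = \<one>\<^bsub>tsub G H\<^esub>" using x subgroup.mem_carrier[OF H] by auto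
qed (use x subgroup.m_inv_closed[OF H] in auto)

lemma (in group_of_tgroup) subgroup_tsub_iff:
  assumes H: "subgroup H G"
  shows "subgroup K (tsub G H) \<longleftrightarrow> subgroup K G \<and> K \<subseteq> H"
proof
  assume K: "subgroup K (tsub G H)"
  then have KH: "K \<subseteq> H" using subgroup.subset by force
  moreover have "subgroup K G"
  proof (rule subgroupI)
    show "K \<subseteq> carrier G" using KH subgroup.subset[OF H] by auto
    show "K \<noteq> {}" using subgroup.one_closed[OF K] by auto
    fix a assume "a \<in> K"
    then show "inv a \<in> K" using subgroup.m_inv_closed[OF K] inv_tsub[OF H] KH by (metis subsetD)
  next
    fix a b assume "a \<in> K" "b \<in> K"
    then show "a \<otimes> b \<in> K" using subgroup.m_closed[OF K] by simp
  qed
  ultimately show "subgroup K G \<and> K \<subseteq> H" by simp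
next
  assume K: "subgroup K G \<and> K \<subseteq> H"
  interpret HH: group "tsub G H" by (rule group_tsub[OF H])
  show "subgroup K (tsub G H)"
  proof (rule HH.subgroupI)
    show "K \<noteq> {}" using K subgroup.one_closed by auto
    fix a assume "a \<in> K"
    then show "inv\<^bsub>tsub G H\<^esub> a \<in> K" using K inv_tsub[OF H, of a] subgroup.m_inv_closed[of K G a] by auto
  qed (use K subgroup.m_closed[of K G] in auto)
qed

lemma (in group_of_tgroup) group_hom_tsub:
  assumes "group_hom G Q \<alpha>" "subgroup S G"
  shows "group_hom (tsub G S) Q \<alpha>"
proof -
  interpret group_hom G Q \<alpha> by (rule assms(1))
  show ?thesis
    using assms(2) group_tsub[OF assms(2)] hom_closed hom_mult subgroup.mem_carrier[OF assms(2)]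
    by (auto simp: group_hom_def group_hom_axioms_def H.is_group intro!: homI)
qed

lemma (in group_of_tgroup) normal_tsub:
  assumes N: "N \<lhd> G" and H: "subgroup H G"
  shows "N \<inter> H \<lhd> tsub G H"
proof -
  interpret HH: group "tsub G H" by (rule group_tsub[OF H])
  show ?thesis
    unfolding HH.normal_inv_iff
  proof (intro conjI ballI)
    show "subgroup (N \<inter> H) (tsub G H)"
      using subgroups_Inter_pair[OF normal_imp_subgroup[OF N] H] subgroup_tsub_iff[OF H] by auto
    fix x h assume "x \<in> carrier (tsub G H)" "h \<in> N \<inter> H"
    then show "x \<otimes>\<^bsub>tsub G H\<^esub> h \<otimes>\<^bsub>tsub G H\<^esub> inv\<^bsub>tsub G H\<^esub> x \<in> N \<inter> H"
      using inv_tsub[OF H] normal.inv_op_closed2[OF N] H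
      by (auto simp: subgroup.mem_carrier subgroup.m_closed subgroup.m_inv_closed)
  qed
qed

lemma closed_subgroupD:
  assumes "closed_subgroup H G"
  shows "subgroup H G" "closedin (gtop G) H" "H \<subseteq> carrier G"
  using assms subgroup.subset unfolding closed_subgroup_def by blast+

locale profinite = group_of_tgroup +
  assumes prof: "profinite_group G"

lemma profiniteI: "profinite_group G \<Longrightarrow> profinite G"
  unfolding profinite_def group_of_tgroup_def profinite_axioms_def profinite_group_def topological_group_def by auto

context profinite
begin

section \<open>Open and closed sets in a profinite group\<close>

abbreviation "T \<equiv> gtop G"

lemma topspace_gtop [simp]: "topspace T = carrier G"
  and mult_cont: "continuous_map (prod_topology T T) T (\<lambda>(x, y). x \<otimes> y)"
  and inv_cont: "continuous_map T T (\<lambda>x. inv x)"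
  and compact: "compact_space T"
  and Hausdorff: "Hausdorff_space T"
  and profinite_gtop: "profinite_space T"
  using prof unfolding profinite_group_def topological_group_def profinite_space_def by auto

lemma continuous_map_mult [intro]:
  assumes "continuous_map Z T f" "continuous_map Z T g"
  shows "continuous_map Z T (\<lambda>z. f z \<otimes> g z)"
  using continuous_map_compose[OF continuous_map_pairedI[OF assms] mult_cont] by (simp add: o_def)

lemma continuous_map_inv [intro]:
  assumes "continuous_map Z T f"
  shows "continuous_map Z T (\<lambda>z. inv (f z))"
  using continuous_map_compose[OF assms inv_cont] by (simp add: o_def)

lemma continuous_map_constG [intro]: "g \<in> carrier G \<Longrightarrow> continuous_map Z T (\<lambda>z. g)"
  by simp

lemma continuous_map_identG [intro]: "continuous_map T T (\<lambda>x. x)"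
  using continuous_map_id[of T] unfolding id_def .

lemma openin_carrier [simp]: "openin T (carrier G)" and closedin_carrier [simp]: "closedin T (carrier G)"
  using openin_topspace[of T] closedin_topspace[of T] by simp_all

lemma closedin_subset_carrier: "closedin T A \<Longrightarrow> A \<subseteq> carrier G"
  using closedin_subset by fastforce

lemma openin_subset_carrier: "openin T A \<Longrightarrow> A \<subseteq> carrier G"
  using openin_subset by fastforce

lemma closedin_singleton: "g \<in> carrier G \<Longrightarrow> closedin T {g}"
  using closedin_Hausdorff_singleton[OF Hausdorff] by simp

lemma closedin_conj_preimage:
  assumes "closedin T S" "a \<in> carrier G"
  shows "closedin T {m \<in> carrier G. m \<otimes> a \<otimes> inv m \<in> S}"
proof -
  have "continuous_map T T (\<lambda>m. m \<otimes> a \<otimes> inv m)"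
    using assms(2) by (intro continuous_map_mult continuous_map_inv continuous_map_identG continuous_map_constG)
  then show ?thesis using closedin_continuous_map_preimage[OF _ assms(1)] by fastforce
qed

lemma closedin_conjugators:
  assumes "closedin T S" "A \<subseteq> carrier G"
  shows "closedin T {m \<in> carrier G. \<forall>a \<in> A. m \<otimes> a \<otimes> inv m \<in> S}"
proof (cases "A = {}")
  case True
  then show ?thesis using closedin_topspace[of T] by simp
next
  case False
  then have "{m \<in> carrier G. \<forall>a \<in> A. m \<otimes> a \<otimes> inv m \<in> S} = (\<Inter>a\<in>A. {m \<in> carrier G. m \<otimes> a \<otimes> inv m \<in> S})"
    by auto
  then show ?thesis using False assms by (auto intro!: closedin_Inter closedin_conj_preimage)
qed

lemma closed_image:
  assumes "continuous_map T Y f" "Hausdorff_space Y" "closedin T A"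
  shows "closedin Y (f ` A)"
  using image_compactin[OF closedin_compact_space[OF compact assms(3)] assms(1)] compactin_imp_closedin assms(2) by blast

lemma closedin_set_mult:
  assumes "closedin T A" "closedin T B"
  shows "closedin T (A <#> B)"
proof -
  have "compactin (prod_topology T T) (A \<times> B)"
    using assms closedin_compact_space compact by (auto simp: compactin_Times)
  then have "compactin T ((\<lambda>(x, y). x \<otimes> y) ` (A \<times> B))" using image_compactin mult_cont by blast
  moreover have "(\<lambda>(x, y). x \<otimes> y) ` (A \<times> B) = A <#> B" unfolding set_mult_def by auto
  ultimately show ?thesis using compactin_imp_closedin Hausdorff by metis
qed

lemma openin_l_coset:
  assumes "openin T B" "g \<in> carrier G"
  shows "openin T (g <# B)"
proof -
  have "g <# B = {x \<in> topspace T. inv g \<otimes> x \<in> B}"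
    using assms openin_subset_carrier[OF assms(1)] unfolding l_coset_def
    by (auto simp: cancel_inv intro!: exI[of _ "inv g \<otimes> _"])
  moreover have "continuous_map T T (\<lambda>x. inv g \<otimes> x)" using assms by auto
  ultimately show ?thesis using openin_continuous_map_preimage[OF _ assms(1)] by metis
qed

lemma openin_set_mult:
  assumes "openin T B" "A \<subseteq> carrier G"
  shows "openin T (A <#> B)"
proof -
  have "A <#> B = (\<Union>a\<in>A. a <# B)" unfolding set_mult_def l_coset_def by auto
  moreover have "openin T (\<Union>a\<in>A. a <# B)"
    by (rule openin_Union) (use openin_l_coset[OF assms(1)] assms(2) in auto)
  ultimately show ?thesis by simp
qed

lemma openin_subgroup:
  assumes H: "subgroup H G" and V: "openin T V" "\<one> \<in> V" "V \<subseteq> H"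
  shows "openin T H"
proof -
  have "H <#> V = H"
    using V subgroup.m_closed[OF H] subgroup.subset[OF H] unfolding set_mult_def
    by (auto intro!: bexI[of _ \<one>] simp: subset_iff)
  then show ?thesis using openin_set_mult[OF V(1) subgroup.subset[OF H]] by simp
qed

lemma closedin_open_subgroup:
  assumes H: "subgroup H G" and op: "openin T H"
  shows "closedin T H"
proof -
  have HG: "H \<subseteq> carrier G" using H subgroup.subset by auto
  have "carrier G - H = (carrier G - H) <#> H"
  proof (intro equalityI subsetI)
    fix x assume "x \<in> carrier G - H"
    then show "x \<in> (carrier G - H) <#> H"
      using subgroup.one_closed[OF H] r_one[of x] unfolding set_mult_def by force
  next
    fix x assume "x \<in> (carrier G - H) <#> H"
    then obtain y h where yh: "y \<in> carrier G" "y \<notin> H" "h \<in> H" "x = y \<otimes> h" unfolding set_mult_def by auto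
    have "y = x \<otimes> inv h" using yh HG by (auto simp: m_assoc)
    then have "x \<notin> H" using yh H by (metis subgroup.m_closed subgroup.m_inv_closed)
    then show "x \<in> carrier G - H" using yh HG by auto
  qed
  then have "openin T (carrier G - H)" using openin_set_mult[OF op, of "carrier G - H"] by auto
  then show ?thesis unfolding closedin_def using HG by simp
qed

text \<open>The tube lemma for multiplication on the compact set \<open>C \<times> {\<one>}\<close>:
  one neighbourhood of \<one> serves all points of \<open>C\<close>.\<close>

lemma nbhd_mult_closed:
  assumes C: "closedin T C" and W: "openin T W" and sub: "C \<subseteq> W"
  obtains V where "openin T V" "\<one> \<in> V" "\<And>c v. c \<in> C \<Longrightarrow> v \<in> V \<Longrightarrow> c \<otimes> v \<in> W"
proof -
  have CG: "C \<subseteq> carrier G" using closedin_subset_carrier C by auto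
  let ?W = "{z \<in> topspace (prod_topology T T). (\<lambda>(x, y). x \<otimes> y) z \<in> W}"
  have 1: "openin (prod_topology T T) ?W" using openin_continuous_map_preimage[OF mult_cont W] .
  have 2: "C \<times> {\<one>} \<subseteq> ?W" using CG sub by (auto simp: subset_iff)
  obtain U V where UV: "openin T U" "openin T V" "C \<subseteq> U" "{\<one>} \<subseteq> V" "U \<times> V \<subseteq> ?W"
    using Wallace_theorem_prod_topology[OF closedin_compact_space[OF compact C] _ 1 2] by auto
  have "c \<otimes> v \<in> W" if "c \<in> C" "v \<in> V" for c v
  proof -
    have "(c, v) \<in> U \<times> V" using that UV(3) by auto
    then show ?thesis using UV(5) by auto
  qed
  then show ?thesis using that[of V] UV by auto
qed

text \<open>A clopen neighbourhood \<open>C\<close> of \<one> inside \<open>W\<close> contains its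
  own right stabilizer, which is an open subgroup; the normal core of that is still open.\<close>

lemma open_normal_nbhd:
  assumes W: "openin T W" "\<one> \<in> W"
  obtains U where "U \<lhd> G" "openin T U" "U \<subseteq> W"
proof -
  obtain C where C: "openin T C" "closedin T C" "\<one> \<in> C" "C \<subseteq> W"
    using profinite_space_clopen_nbhd[OF profinite_gtop W] by blast
  have CG: "C \<subseteq> carrier G" using closedin_subset_carrier C by auto
  obtain V where V: "openin T V" "\<one> \<in> V" "\<And>c v. c \<in> C \<Longrightarrow> v \<in> V \<Longrightarrow> c \<otimes> v \<in> C"
    using nbhd_mult_closed[OF C(2,1)] by auto
  \<comment> \<open>The right stabilizer of \<open>C\<close>; asking for g and its inverse makes
    closure under inversion immediate.\<close>
  define H where "H = {g \<in> carrier G. \<forall>c \<in> C. c \<otimes> g \<in> C \<and> c \<otimes> inv g \<in> C}"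
  have H: "subgroup H G"
  proof (rule subgroupI)
    have "\<one> \<in> H" unfolding H_def using CG by (auto simp: subset_iff)
    then show "H \<noteq> {}" by auto
    fix a b assume ab: "a \<in> H" "b \<in> H"
    then show "a \<otimes> b \<in> H"
      unfolding H_def using CG by (auto simp: inv_mult_group m_assoc[symmetric] subset_iff)
  qed (auto simp: H_def)
  have "openin T ({x \<in> topspace T. inv x \<in> V} \<inter> V)"
    using openin_continuous_map_preimage[OF inv_cont V(1)] V(1) by blast
  then have Ho: "openin T H"
    using V openin_subset_carrier[OF V(1)] by (intro openin_subgroup[OF H, of "{x \<in> topspace T. inv x \<in> V} \<inter> V"]) (auto simp: H_def)
  have HC: "H \<subseteq> C" using C(3) unfolding H_def by force
  define N where "N = {u \<in> carrier G. \<forall>g \<in> carrier G. g \<otimes> u \<otimes> inv g \<in> H}"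
  have "N = (\<Inter>g \<in> carrier G. {u \<in> carrier G. g \<otimes> u \<otimes> inv g \<in> H})" unfolding N_def by auto
  then have Ns: "subgroup N G"
    using group_hom.subgroup_vimage[OF conj_group_hom H] by (auto intro!: subgroups_Inter)
  have Nn: "N \<lhd> G"
    unfolding normal_inv_iff
  proof (intro conjI ballI)
    fix x h assume x: "x \<in> carrier G" and h: "h \<in> N"
    have hG: "h \<in> carrier G" using h unfolding N_def by auto
    have "g \<otimes> (x \<otimes> h \<otimes> inv x) \<otimes> inv g = (g \<otimes> x) \<otimes> h \<otimes> inv (g \<otimes> x)" if "g \<in> carrier G" for g
      using that x hG by (simp add: m_assoc inv_mult_group)
    then show "x \<otimes> h \<otimes> inv x \<in> N" using x h unfolding N_def by auto
  qed (rule Ns)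
  \<comment> \<open>Conjugation sends \<open>carrier G \<times> {\<one>}\<close> into the open
    \<open>H\<close>. By the tube lemma a whole neighbourhood \<open>B\<close> of \<one> is
    conjugated into \<open>H\<close> by every group element, so \<open>B\<close> lies in the
    core.\<close>
  have "openin T N"
  proof -
    let ?f = "\<lambda>z. fst z \<otimes> snd z \<otimes> inv (fst z)"
    have "continuous_map (prod_topology T T) T ?f"
      by (intro continuous_map_mult continuous_map_inv continuous_map_fst continuous_map_snd)
    then have 1: "openin (prod_topology T T) {z \<in> topspace (prod_topology T T). ?f z \<in> H}"
      using openin_continuous_map_preimage Ho by blast
    have 2: "carrier G \<times> {\<one>} \<subseteq> {z \<in> topspace (prod_topology T T). ?f z \<in> H}"
      using subgroup.one_closed[OF H] by auto
    have 3: "compactin T (carrier G)" using compact unfolding compact_space_def by simp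
    obtain A B where AB: "openin T A" "openin T B" "carrier G \<subseteq> A" "{\<one>} \<subseteq> B"
      "A \<times> B \<subseteq> {z \<in> topspace (prod_topology T T). ?f z \<in> H}"
      using Wallace_theorem_prod_topology[OF 3 _ 1 2] by auto
    have "B \<subseteq> N" using AB openin_subset_carrier[OF AB(2)] unfolding N_def by fastforce
    then show ?thesis using openin_subgroup[OF Ns AB(2)] AB(4) by auto
  qed
  moreover have "N \<subseteq> W"
  proof
    fix u assume u: "u \<in> N"
    then have "\<one> \<otimes> u \<otimes> inv \<one> \<in> H" "u \<in> carrier G" unfolding N_def by blast+
    then show "u \<in> W" using HC C(4) by auto
  qed
  ultimately show ?thesis using that Nn by blast
qed

lemma open_normal_mult_nbhd:
  assumes C: "closedin T C" and W: "openin T W" and sub: "C \<subseteq> W"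
  obtains U where "U \<lhd> G" "openin T U" "C <#> U \<subseteq> W"
proof -
  obtain V where V: "openin T V" "\<one> \<in> V" "\<And>c v. c \<in> C \<Longrightarrow> v \<in> V \<Longrightarrow> c \<otimes> v \<in> W"
    using nbhd_mult_closed[OF C W sub] by auto
  obtain U where "U \<lhd> G" "openin T U" "U \<subseteq> V" using open_normal_nbhd[OF V(1,2)] by auto
  then show ?thesis using that V(3) unfolding set_mult_def by blast
qed

lemma open_normal_separate:
  assumes N: "N \<subseteq> carrier G" "n \<in> N" "n \<noteq> \<one>"
  obtains U where "U \<lhd> G" "openin T U" "n \<notin> U"
proof -
  have "openin T (topspace T - {n})" using closedin_singleton[of n] N by (intro openin_diff) auto
  then obtain U where "U \<lhd> G" "openin T U" "U \<subseteq> carrier G - {n}"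
    using open_normal_nbhd[of "carrier G - {n}"] N by auto
  then show ?thesis using that by blast
qed

lemma finite_rcosets_open:
  assumes U: "subgroup U G" and op: "openin T U"
  shows "finite (rcosets U)"
proof -
  have UG: "U \<subseteq> carrier G" using U subgroup.subset by auto
  have opc: "openin T C" if C: "C \<in> rcosets U" for C
  proof -
    obtain g where g: "g \<in> carrier G" "C = U #> g" using C unfolding RCOSETS_def by auto
    have "C = {x \<in> topspace T. x \<otimes> inv g \<in> U}"
      unfolding g(2) r_coset_def using UG g(1)
      by (auto simp: m_assoc subset_iff intro!: bexI[of _ "_ \<otimes> inv g"])
    moreover have "continuous_map T T (\<lambda>x. x \<otimes> inv g)" using g by auto
    ultimately show ?thesis using openin_continuous_map_preimage[OF _ op] by metis
  qed
  have cov: "topspace T \<subseteq> \<Union> (rcosets U)" using rcosets_part_G[OF U] by simp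
  obtain \<F> where \<F>: "finite \<F>" "\<F> \<subseteq> rcosets U" "carrier G \<subseteq> \<Union>\<F>"
  proof -
    have "\<exists>\<F>. finite \<F> \<and> \<F> \<subseteq> rcosets U \<and> topspace T \<subseteq> \<Union>\<F>"
      using compact cov opc unfolding compact_space_alt by simp
    then show ?thesis using that by auto
  qed
  have "rcosets U \<subseteq> \<F>"
  proof
    fix C assume C: "C \<in> rcosets U"
    then obtain g where g: "g \<in> carrier G" "C = U #> g" unfolding RCOSETS_def by auto
    then have "g \<in> C" using rcos_self[OF _ U] by auto
    moreover obtain D where D: "D \<in> \<F>" "g \<in> D" using \<F>(3) g by auto
    ultimately have "\<not> disjnt C D" unfolding disjnt_def by blast
    moreover have "D \<in> rcosets U" using D(1) \<F>(2) by (rule rev_subsetD)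
    ultimately have "C = D" using pairwiseD[OF rcos_disjoint[OF U] C, of D] by metis
    then show "C \<in> \<F>" using D(1) by simp
  qed
  then show ?thesis using \<F>(1) finite_subset by auto
qed

lemma profinite_tsub:
  assumes H: "closed_subgroup H G"
  shows "profinite (tsub G H)"
proof -
  note h = closed_subgroupD[OF H]
  let ?H = "tsub G H" and ?S = "subtopology T H"
  have ts: "topspace ?S = H" using h by auto
  have 1: "continuous_map (prod_topology ?S ?S) ?S (\<lambda>(x, y). x \<otimes> y)"
  proof (rule continuous_map_into_subtopology)
    have "continuous_map (prod_topology ?S ?S) T fst" "continuous_map (prod_topology ?S ?S) T snd"
      using continuous_map_fst[of ?S ?S] continuous_map_snd[of ?S ?S]
      by (auto simp: continuous_map_in_subtopology)
    then have "continuous_map (prod_topology ?S ?S) T (\<lambda>z. fst z \<otimes> snd z)" by (rule continuous_map_mult)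
    then show "continuous_map (prod_topology ?S ?S) T (\<lambda>(x, y). x \<otimes> y)"
      by (simp add: case_prod_unfold)
  qed (use ts subgroup.m_closed[OF h(1)] in auto)
  have 2: "continuous_map ?S ?S (\<lambda>x. inv\<^bsub>?H\<^esub> x)"
  proof (rule continuous_map_eq)
    show "continuous_map ?S ?S (\<lambda>x. inv x)"
      by (rule continuous_map_into_subtopology)
         (use continuous_map_from_subtopology[OF inv_cont] ts subgroup.m_inv_closed[OF h(1)] in auto)
    show "inv x = inv\<^bsub>?H\<^esub> x" if "x \<in> topspace ?S" for x
      using inv_tsub[OF h(1)] that ts by auto
  qed
  have "compact_space ?S"
    using closedin_compact_space[OF compact h(2)] compact_space_subtopology by blast
  moreover have "Hausdorff_space ?S" using Hausdorff Hausdorff_space_subtopology by blast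
  moreover have "\<forall>S. connectedin ?S S \<longrightarrow> (\<exists>a. S \<subseteq> {a})"
    using profinite_gtop unfolding profinite_space_def connectedin_subtopology by blast
  ultimately have "profinite_group ?H"
    unfolding profinite_group_def topological_group_def profinite_space_def
    using group_tsub[OF h(1)] 1 2 ts by simp
  then show ?thesis by (rule profiniteI)
qed

lemma open_trace:
  assumes H: "subgroup H G" and N: "openin (subtopology T H) N" "\<one> \<in> N"
  obtains U where "U \<lhd> G" "openin T U" "U \<inter> H \<subseteq> N"
proof -
  obtain W where W: "openin T W" "N = W \<inter> H" using N(1) unfolding openin_subtopology by auto
  then obtain U where "U \<lhd> G" "openin T U" "U \<subseteq> W" using open_normal_nbhd[of W] N(2) by auto
  then show ?thesis using that W(2) by blast
qed

lemma finite_FactGroup: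
  assumes "U \<lhd> G" "openin T U"
  shows "finite (carrier (G Mod U))"
  using finite_rcosets_open[OF normal_imp_subgroup[OF assms(1)] assms(2)] by (simp add: FactGroup_def)

lemma group_hom_r_coset:
  assumes "U \<lhd> G"
  shows "group_hom G (G Mod U) (\<lambda>x. U #> x)"
  using normal.r_coset_hom_Mod[OF assms] normal.factorgroup_is_group[OF assms]
  by (simp add: group_hom_def group_hom_axioms_def is_group)

end

lemma solvable_of_kernel_subset:
  assumes f: "group_hom G M f" and g: "group_hom G Q g" and surj: "g ` carrier G = carrier Q"
    and ker: "kernel G M f \<subseteq> kernel G Q g" and sol: "solvable M"
  shows "solvable Q"
proof -
  interpret f: group_hom G M f by (rule f)
  interpret g: group_hom G Q g by (rule g)
  have "solvable_seq M (f ` carrier G)" using f.H.solvable_subgroup[OF f.img_is_subgroup sol] .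
  then obtain n where n: "(derived M ^^ n) (f ` carrier G) = {\<one>\<^bsub>M\<^esub>}"
    using f.H.solvable_imp_trivial_derived_seq by blast
  have "f ` ((derived G ^^ n) (carrier G)) = {\<one>\<^bsub>M\<^esub>}"
    using f.exp_of_derived_img[of "carrier G" n] n by auto
  then have "(derived G ^^ n) (carrier G) \<subseteq> kernel G M f"
    using f.G.exp_of_derived_in_carrier[of "carrier G" n] by (auto simp: kernel_def)
  then have "g ` ((derived G ^^ n) (carrier G)) \<subseteq> {\<one>\<^bsub>Q\<^esub>}" using ker by (auto simp: kernel_def)
  then have "(derived Q ^^ n) (carrier Q) \<subseteq> {\<one>\<^bsub>Q\<^esub>}"
    using g.exp_of_derived_img[of "carrier G" n] surj by auto
  moreover have "\<one>\<^bsub>Q\<^esub> \<in> (derived Q ^^ n) (carrier Q)"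
    using subgroup.one_closed[OF g.H.exp_of_derived_is_subgroup[OF g.H.subgroup_self]] .
  ultimately have "(derived Q ^^ n) (carrier Q) = {\<one>\<^bsub>Q\<^esub>}" by blast
  then show ?thesis using g.H.solvable_iff_trivial_derived_seq by blast
qed

section \<open>Pro-C groups and their closed subgroups\<close>

lemma pro_C_profinite: "pro_C_group C G \<Longrightarrow> profinite G"
  unfolding pro_C_group_def by (simp add: profiniteI)

lemma pro_finite_grp_iff: "pro_C_group finite_grp G \<longleftrightarrow> profinite_group G"
  unfolding pro_C_group_def finite_grp_def
  using profinite.finite_FactGroup[OF profiniteI] by blast

text \<open>An open normal \<open>N\<close> of \<open>H\<close> contains the trace of some open
  normal \<open>U\<close> of \<open>G\<close>, so \<open>H Mod N\<close> is a quotient of a subgroup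
  of the soluble group \<open>G Mod U\<close>.\<close>

lemma pro_finite_soluble_tsub:
  fixes G :: "'a tgroup" (structure)
  assumes G: "pro_C_group finite_soluble_grp G" and H: "closed_subgroup H G"
  shows "pro_C_group finite_soluble_grp (tsub G H)"
proof -
  let ?H = "tsub G H"
  interpret profinite G using pro_C_profinite[OF G] .
  note h = closed_subgroupD[OF H]
  interpret H: profinite ?H using profinite_tsub[OF H] .
  have "finite_soluble_grp (?H Mod N)" if N: "N \<lhd> ?H" "openin (gtop ?H) N" for N
  proof -
    have Ns: "subgroup N ?H" using normal_imp_subgroup[OF N(1)] .
    obtain U where U: "U \<lhd> G" "openin T U" "U \<inter> H \<subseteq> N"
      using open_trace[OF h(1), of N] N(2) subgroup.one_closed[OF Ns] by auto
    have sol: "solvable (G Mod U)"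
      using G U unfolding pro_C_group_def finite_soluble_grp_def by blast
    have f: "group_hom ?H (G Mod U) (\<lambda>x. U #> x)"
      by (rule group_hom_tsub[OF group_hom_r_coset[OF U(1)] h(1)])
    have "solvable (?H Mod N)"
    proof (rule solvable_of_kernel_subset[OF f H.group_hom_r_coset[OF N(1)] _ _ sol])
      show "(#>\<^bsub>?H\<^esub>) N ` carrier ?H = carrier (?H Mod N)"
        by (simp add: carrier_FactGroup)
      show "kernel ?H (G Mod U) ((#>) U) \<subseteq> kernel ?H (?H Mod N) ((#>\<^bsub>?H\<^esub>) N)"
      proof
        fix x assume "x \<in> kernel ?H (G Mod U) ((#>) U)"
        then have x: "x \<in> H" "U #> x = U" by (auto simp: kernel_def)
        then have "x \<in> U" using coset_join1[OF _ _ normal_imp_subgroup[OF U(1)]] h(3) by auto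
        then have "N #>\<^bsub>?H\<^esub> x = N" using H.coset_join2[OF _ Ns, of x] x U(3) by auto
        then show "x \<in> kernel ?H (?H Mod N) ((#>\<^bsub>?H\<^esub>) N)" using x by (simp add: kernel_def)
      qed
    qed
    then show ?thesis using H.finite_FactGroup[OF N] unfolding finite_soluble_grp_def by simp
  qed
  then show ?thesis unfolding pro_C_group_def using H.prof by blast
qed

text \<open>An elementwise form of being pro-p, which is visibly invariant under conjugation.\<close>

definition pro_p_set :: "nat \<Rightarrow> 'a tgroup \<Rightarrow> 'a set \<Rightarrow> bool" where
  "pro_p_set p G H \<longleftrightarrow>
     (\<forall>h \<in> H. \<forall>U. subgroup U G \<and> openin (gtop G) U \<longrightarrow> (\<exists>n::nat. h [^]\<^bsub>G\<^esub> (p ^ n) \<in> U))"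

context profinite
begin

text \<open>An open subgroup of \<open>G\<close> contains an open normal subgroup of
  \<open>H\<close>, and in the quotient of \<open>H\<close> by it every element is annihilated by
  the order, a power of p.\<close>

lemma pro_p_setI:
  assumes H: "closed_subgroup H G" and p: "pro_C_group (finite_p_grp p) (tsub G H)"
  shows "pro_p_set p G H"
  unfolding pro_p_set_def
proof (intro ballI allI impI)
  fix h U assume h: "h \<in> H" and U: "subgroup U G \<and> openin T U"
  interpret H: profinite "tsub G H" using profinite_tsub[OF H] .
  have "openin (gtop (tsub G H)) (U \<inter> H)" "\<one>\<^bsub>tsub G H\<^esub> \<in> U \<inter> H"
    using U subgroup.one_closed closed_subgroupD[OF H] by (auto simp: openin_subtopology)
  then obtain N where N: "N \<lhd> tsub G H" "openin (gtop (tsub G H)) N" "N \<subseteq> U \<inter> H"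
    using H.open_normal_nbhd by blast
  obtain n where n: "order (tsub G H Mod N) = p ^ n"
    using p N unfolding pro_C_group_def finite_p_grp_def by blast
  interpret N: group_hom "tsub G H" "tsub G H Mod N" "\<lambda>x. N #>\<^bsub>tsub G H\<^esub> x"
    by (rule H.group_hom_r_coset[OF N(1)])
  have hH: "h \<in> carrier (tsub G H)" using h by simp
  have "N #>\<^bsub>tsub G H\<^esub> (h [^]\<^bsub>tsub G H\<^esub> (p ^ n)) = (N #>\<^bsub>tsub G H\<^esub> h) [^]\<^bsub>tsub G H Mod N\<^esub> (p ^ n)"
    using N.hom_nat_pow[OF hH] by simp
  also have "\<dots> = \<one>\<^bsub>tsub G H Mod N\<^esub>" using N.H.pow_order_eq_1[OF N.hom_closed[OF hH]] n by simp
  finally have "N #>\<^bsub>tsub G H\<^esub> (h [^]\<^bsub>tsub G H\<^esub> (p ^ n)) = N" by simp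
  then have "h [^]\<^bsub>tsub G H\<^esub> (p ^ n) \<in> N"
    using H.coset_join1[OF _ _ normal_imp_subgroup[OF N(1)]] H.nat_pow_closed[OF hH] by metis
  then show "\<exists>n::nat. h [^] (p ^ n) \<in> U" using N(3) by auto
qed

lemma conj_pow:
  assumes "m \<in> carrier G" "h \<in> carrier G"
  shows "(m \<otimes> h \<otimes> inv m) [^] (n::nat) = m \<otimes> h [^] n \<otimes> inv m"
  using group_hom.hom_nat_pow[OF conj_group_hom[OF assms(1)] assms(2), of n] by simp

lemma openin_conj_preimage:
  assumes "openin T U" "m \<in> carrier G"
  shows "openin T {x \<in> carrier G. m \<otimes> x \<otimes> inv m \<in> U}"
proof -
  have "continuous_map T T (\<lambda>x. m \<otimes> x \<otimes> inv m)"
    using assms(2) by (intro continuous_map_mult continuous_map_identG continuous_map_constG) auto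
  then show ?thesis using openin_continuous_map_preimage[OF _ assms(1)] by fastforce
qed

lemma conj_preimage_subgroup:
  assumes U: "subgroup U G" and m: "m \<in> carrier G"
  shows "subgroup {x \<in> carrier G. m \<otimes> x \<otimes> inv m \<in> U} G"
  by (rule group_hom.subgroup_vimage[OF conj_group_hom[OF m] U])

lemma pro_p_set_conj:
  assumes H: "pro_p_set p G H" "H \<subseteq> carrier G" and m: "m \<in> carrier G"
  shows "pro_p_set p G ((\<lambda>h. m \<otimes> h \<otimes> inv m) ` H)"
  unfolding pro_p_set_def
proof (intro ballI allI impI)
  fix x U assume x: "x \<in> (\<lambda>h. m \<otimes> h \<otimes> inv m) ` H" and U: "subgroup U G \<and> openin T U"
  then obtain h where h: "h \<in> H" "x = m \<otimes> h \<otimes> inv m" by auto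
  obtain n :: nat where "h [^] (p ^ n) \<in> {x \<in> carrier G. m \<otimes> x \<otimes> inv m \<in> U}"
    using H(1) h(1) conj_preimage_subgroup[of U m] openin_conj_preimage[of U m] U m
    unfolding pro_p_set_def by blast
  then have "x [^] (p ^ n) \<in> U" using h H(2) m conj_pow[of m h "p ^ n"] by auto
  then show "\<exists>n::nat. x [^] (p ^ n) \<in> U" by blast
qed

end

section \<open>Prosoluble supplements\<close>

context profinite
begin

text \<open>The form in which the existence of a Sylow pro-p subgroup inside \<open>S\<close> is used. Unlike the
  supernatural index, it passes to intersections of chains by compactness alone.\<close>

definition p_absorbing :: "nat \<Rightarrow> 'a set \<Rightarrow> bool" where
  "p_absorbing p S \<longleftrightarrow>
     (\<forall>N H. N \<lhd> G \<and> closedin T N \<and> subgroup H G \<and> pro_p_set p G H \<and> H \<subseteq> S <#> N \<longrightarrow>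
        (\<exists>m \<in> N. \<forall>h \<in> H. m \<otimes> h \<otimes> inv m \<in> S))"

lemma p_absorbingD:
  assumes "p_absorbing p S" "N \<lhd> G" "closedin T N" "subgroup H G" "pro_p_set p G H" "H \<subseteq> S <#> N"
  obtains m where "m \<in> N" "\<And>h. h \<in> H \<Longrightarrow> m \<otimes> h \<otimes> inv m \<in> S"
  using assms unfolding p_absorbing_def by metis

lemma p_absorbing_carrier: "p_absorbing p (carrier G)"
  unfolding p_absorbing_def
proof (intro allI impI)
  fix N H assume "N \<lhd> G \<and> closedin T N \<and> subgroup H G \<and> pro_p_set p G H \<and> H \<subseteq> carrier G <#> N"
  then have "\<one> \<in> N" "H \<subseteq> carrier G"
    using subgroup.one_closed[OF normal_imp_subgroup] subgroup.subset by blast+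
  then show "\<exists>m\<in>N. \<forall>h\<in>H. m \<otimes> h \<otimes> inv m \<in> carrier G" by blast
qed

lemma closed_subgroup_carrier: "closed_subgroup (carrier G) G"
  unfolding closed_subgroup_def using subgroup_self by simp

lemma closed_subgroup_Inter:
  assumes "\<C> \<noteq> {}" "\<And>S. S \<in> \<C> \<Longrightarrow> closed_subgroup S G"
  shows "closed_subgroup (\<Inter>\<C>) G"
  using assms subgroups_Inter[of \<C>] closedin_Inter[of \<C> T] unfolding closed_subgroup_def by blast

text \<open>The fibre over q meets each member of the chain in a nonempty compact set, and these
  sets have a common point.\<close>

lemma chain_image_Inter:
  assumes \<alpha>: "continuous_map T Y \<alpha>" and Y: "Hausdorff_space Y"
    and ne: "\<C> \<noteq> {}" and ch: "subset.chain \<A> \<C>" and cl: "\<And>S. S \<in> \<C> \<Longrightarrow> closedin T S"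
    and q: "\<And>S. S \<in> \<C> \<Longrightarrow> q \<in> \<alpha> ` S"
  shows "q \<in> \<alpha> ` (\<Inter>\<C>)"
proof -
  obtain S0 where S0: "S0 \<in> \<C>" using ne by blast
  then have "q \<in> topspace Y"
    using q[OF S0] closedin_subset[OF cl[OF S0]] continuous_map_image_subset_topspace[OF \<alpha>] by blast
  then have pre: "closedin T {x \<in> topspace T. \<alpha> x \<in> {q}}"
    using closedin_continuous_map_preimage[OF \<alpha>] closedin_Hausdorff_singleton[OF Y] by blast
  have "\<exists>x. \<forall>S \<in> \<C>. x \<in> S \<inter> {x \<in> topspace T. \<alpha> x \<in> {q}}"
  proof (rule compact_chain_common_point[OF compact ne ch, of "\<lambda>S. S \<inter> {x \<in> topspace T. \<alpha> x \<in> {q}}"])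
    fix S assume S: "S \<in> \<C>"
    show "closedin T (S \<inter> {x \<in> topspace T. \<alpha> x \<in> {q}})" using cl[OF S] pre by (rule closedin_Int)
    show "S \<inter> {x \<in> topspace T. \<alpha> x \<in> {q}} \<noteq> {}"
      using q[OF S] closedin_subset[OF cl[OF S]] by blast
  qed auto
  then obtain x where x: "\<And>S. S \<in> \<C> \<Longrightarrow> x \<in> S \<and> \<alpha> x = q" by auto
  then show ?thesis using S0 by blast
qed

lemma closed_supplement_Inter:
  assumes \<alpha>: "continuous_map T (gtop Q) \<alpha>" and Q: "profinite Q" and \<C>: "\<C> \<noteq> {}" "subset.chain \<A> \<C>"
    and mem: "\<And>S. S \<in> \<C> \<Longrightarrow> closed_subgroup S G" "\<And>S. S \<in> \<C> \<Longrightarrow> \<alpha> ` S = carrier Q"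
  shows "closed_subgroup (\<Inter>\<C>) G" "\<alpha> ` (\<Inter>\<C>) = carrier Q"
proof -
  interpret Q: profinite Q by (rule Q)
  show cs: "closed_subgroup (\<Inter>\<C>) G" using closed_subgroup_Inter[OF \<C>(1)] mem by blast
  have "q \<in> \<alpha> ` \<Inter>\<C>" if "q \<in> carrier Q" for q
    using chain_image_Inter[OF \<alpha> Q.Hausdorff \<C>] mem closed_subgroupD(2) that by metis
  moreover have "\<alpha> ` \<Inter>\<C> \<subseteq> carrier Q" using mem \<C>(1) by blast
  ultimately show "\<alpha> ` (\<Inter>\<C>) = carrier Q" by blast
qed

text \<open>For fixed \<open>N\<close> and \<open>H\<close> the admissible conjugators into
  \<open>S\<close> form a closed set that shrinks with \<open>S\<close> and is never empty along the
  chain.\<close>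

lemma p_absorbing_Inter:
  assumes ne: "\<C> \<noteq> {}" and ch: "subset.chain \<A> \<C>" and cl: "\<And>S. S \<in> \<C> \<Longrightarrow> closedin T S"
    and ab: "\<And>S. S \<in> \<C> \<Longrightarrow> p_absorbing p S"
  shows "p_absorbing p (\<Inter>\<C>)"
  unfolding p_absorbing_def
proof (intro allI impI, elim conjE)
  fix N H assume N: "N \<lhd> G" "closedin T N" and H: "subgroup H G" "pro_p_set p G H" "H \<subseteq> \<Inter>\<C> <#> N"
  let ?f = "\<lambda>S. N \<inter> {m \<in> carrier G. \<forall>h \<in> H. m \<otimes> h \<otimes> inv m \<in> S}"
  have "\<exists>m. \<forall>S \<in> \<C>. m \<in> ?f S"
  proof (rule compact_chain_common_point[OF compact ne ch, of ?f])
    fix S assume S: "S \<in> \<C>"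
    show "closedin T (?f S)"
      using closedin_Int[OF N(2) closedin_conjugators[OF cl[OF S] subgroup.subset[OF H(1)]]] .
    have "H \<subseteq> S <#> N" using H(3) S unfolding set_mult_def by blast
    then obtain m where "m \<in> N" "\<And>h. h \<in> H \<Longrightarrow> m \<otimes> h \<otimes> inv m \<in> S"
      using p_absorbingD[OF ab[OF S] N H(1,2)] by metis
    then show "?f S \<noteq> {}" using closedin_subset_carrier[OF N(2)] by blast
  qed auto
  then obtain m where m: "\<And>S. S \<in> \<C> \<Longrightarrow> m \<in> N \<and> (\<forall>h \<in> H. m \<otimes> h \<otimes> inv m \<in> S)" by auto
  then show "\<exists>m\<in>N. \<forall>h\<in>H. m \<otimes> h \<otimes> inv m \<in> \<Inter>\<C>" using ne by blast
qed

lemma cont_hom_tsub: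
  assumes "\<alpha> \<in> cont_hom G Q" "subgroup S G"
  shows "\<alpha> \<in> cont_hom (tsub G S) Q"
  using assms subgroup.mem_carrier[OF assms(2)] unfolding cont_hom_def
  by (auto simp: hom_def continuous_map_from_subtopology Pi_iff)

text \<open>The saturation \<open>W\<close> of \<open>U\<close> is a subgroup containing
  \<open>U\<close>, hence open. Its complement is compact with closed image, and by saturation that
  image is the complement of the image of \<open>U\<close>.\<close>

lemma open_image:
  assumes \<alpha>: "\<alpha> \<in> cont_hom G Q" "\<alpha> ` carrier G = carrier Q" and Q: "profinite Q"
    and U: "subgroup U G" "openin T U"
  shows "openin (gtop Q) (\<alpha> ` U)"
proof -
  interpret Q: profinite Q by (rule Q)
  interpret \<alpha>: group_hom G Q \<alpha>
    using \<alpha> by (simp add: group_hom_def group_hom_axioms_def is_group Q.is_group cont_hom_def)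
  have cont: "continuous_map T (gtop Q) \<alpha>" using \<alpha> by (simp add: cont_hom_def)
  define W where "W = {s \<in> carrier G. \<alpha> s \<in> \<alpha> ` U}"
  have UG: "U \<subseteq> carrier G" using U subgroup.subset by blast
  have UW: "U \<subseteq> W" unfolding W_def using UG by auto
  have W: "subgroup W G"
    unfolding W_def by (rule \<alpha>.subgroup_vimage[OF \<alpha>.subgroup_img_is_subgroup[OF U(1)]])
  have "openin T W" using openin_subgroup[OF W U(2) subgroup.one_closed[OF U(1)] UW] .
  then have "closedin T (topspace T - W)" by blast
  then have "closedin (gtop Q) (\<alpha> ` (carrier G - W))" using closed_image[OF cont Q.Hausdorff] by simp
  moreover have "\<alpha> ` (carrier G - W) = carrier Q - \<alpha> ` U"
    using \<alpha>(2) unfolding W_def by auto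
  ultimately have "openin (gtop Q) (topspace (gtop Q) - (carrier Q - \<alpha> ` U))" by (metis openin_diff openin_topspace)
  moreover have "carrier Q - (carrier Q - \<alpha> ` U) = \<alpha> ` U" using \<alpha>(2) UG by auto
  ultimately show ?thesis by simp
qed

text \<open>The homomorphism induced on quotients is literally the image of a coset as a set, so no
  representatives have to be chosen.\<close>

lemma FactGroup_image_hom:
  assumes \<alpha>: "group_hom G Q \<alpha>" "\<alpha> ` carrier G = carrier Q" and U: "U \<lhd> G"
  shows "group_hom (G Mod U) (Q Mod (\<alpha> ` U)) (\<lambda>C. \<alpha> ` C)"
    "x \<in> carrier G \<Longrightarrow> \<alpha> ` (U #> x) = \<alpha> ` U #>\<^bsub>Q\<^esub> \<alpha> x"
proof -
  interpret \<alpha>: group_hom G Q \<alpha> by (rule \<alpha>(1))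
  interpret U: normal U G by (rule U)
  have V: "\<alpha> ` U \<lhd> Q" using U.surj_hom_normal_subgroup[OF \<alpha>] .
  interpret V: normal "\<alpha> ` U" Q by (rule V)
  have co: "\<alpha> ` (U #> x) = \<alpha> ` U #>\<^bsub>Q\<^esub> \<alpha> x" if "x \<in> carrier G" for x
    using coset_hom(2)[OF \<alpha>.homh U.subset that] .
  then show "x \<in> carrier G \<Longrightarrow> \<alpha> ` (U #> x) = \<alpha> ` U #>\<^bsub>Q\<^esub> \<alpha> x" .
  have "(\<lambda>C. \<alpha> ` C) \<in> hom (G Mod U) (Q Mod (\<alpha> ` U))"
  proof (rule homI)
    fix C assume "C \<in> carrier (G Mod U)"
    then show "\<alpha> ` C \<in> carrier (Q Mod \<alpha> ` U)" using co by (auto simp: carrier_FactGroup)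
  next
    fix C D assume CD: "C \<in> carrier (G Mod U)" "D \<in> carrier (G Mod U)"
    then have "C \<subseteq> carrier G" "D \<subseteq> carrier G"
      using r_coset_subset_G[OF U.subset] by (auto simp: carrier_FactGroup)
    then show "\<alpha> ` (C \<otimes>\<^bsub>G Mod U\<^esub> D) = \<alpha> ` C \<otimes>\<^bsub>Q Mod \<alpha> ` U\<^esub> \<alpha> ` D"
      using set_mult_hom[OF \<alpha>.homh] by simp
  qed
  then show "group_hom (G Mod U) (Q Mod (\<alpha> ` U)) (\<lambda>C. \<alpha> ` C)"
    using U.factorgroup_is_group V.factorgroup_is_group by (simp add: group_hom_def group_hom_axioms_def)
qed

text \<open>Conjugation happens in two stages: an element m1 of \<open>N\<close> brings
  \<open>H\<close> into \<open>S\<close>, since \<open>S\<close> is absorbing, and the finite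
  quotient of \<open>S\<close> provides an element n of \<open>N \<inter> S\<close> that brings the
  result over \<open>S'\<close>. Their product lies in \<open>N\<close>.\<close>

lemma absorbing_preimage:
  assumes p: "prime p" and S: "closed_subgroup S G" "p_absorbing p S"
    and U: "U \<lhd> tsub G S" "openin (subtopology T S) U"
    and S': "subgroup S' (tsub G S Mod U)" "coprime_index p (carrier (tsub G S Mod U)) S'"
  shows "p_absorbing p {s \<in> S. U #> s \<in> S'}"
  unfolding p_absorbing_def
proof (intro allI impI, elim conjE)
  let ?S = "tsub G S"
  let ?S1 = "{s \<in> S. U #> s \<in> S'}"
  note s = closed_subgroupD[OF S(1)]
  interpret S: profinite ?S using profinite_tsub[OF S(1)] .
  let ?F = "?S Mod U"
  interpret pi: group_hom ?S ?F "\<lambda>x. U #> x"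
    using S.group_hom_r_coset[OF U(1)] by simp
  have finF: "finite (carrier ?F)" using S.finite_FactGroup[OF U(1)] U(2) by simp
  fix N H assume N: "N \<lhd> G" "closedin T N" and H: "subgroup H G" "pro_p_set p G H" "H \<subseteq> ?S1 <#> N"
  have NG: "N \<subseteq> carrier G" and HG: "H \<subseteq> carrier G"
    using closedin_subset_carrier[OF N(2)] subgroup.subset[OF H(1)] by auto
  have "H \<subseteq> S <#> N" using H(3) unfolding set_mult_def by blast
  then obtain m1 where m1: "m1 \<in> N" "\<And>h. h \<in> H \<Longrightarrow> m1 \<otimes> h \<otimes> inv m1 \<in> S"
    using p_absorbingD[OF S(2) N H(1,2)] by metis
  have m1G: "m1 \<in> carrier G" using m1 NG by auto
  define H1 where "H1 = (\<lambda>h. m1 \<otimes> h \<otimes> inv m1) ` H"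
  have H1: "subgroup H1 G" "pro_p_set p G H1" "H1 \<subseteq> S"
    unfolding H1_def using conj_subgroup[OF m1G H(1)] pro_p_set_conj[OF H(2) HG m1G] m1(2) by auto
  have H1S: "subgroup H1 ?S" using subgroup_tsub_iff[OF s(1)] H1 by auto
  \<comment> \<open>The image of \<open>N \<inter> S\<close> and not of a larger group, so that the
    conjugator found in the quotient lifts to an element of \<open>N\<close>.\<close>
  define M where "M = (\<lambda>x. U #> x) ` (N \<inter> S)"
  have M: "M \<lhd> ?F"
    unfolding M_def
  proof (rule normal.surj_hom_normal_subgroup[OF normal_tsub[OF N(1) s(1)]])
    show "(#>) U ` carrier ?S = carrier ?F" by (simp add: carrier_FactGroup)
  qed (rule pi.group_hom_axioms)
  define HF where "HF = (\<lambda>x. U #> x) ` H1"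
  have HF: "subgroup HF ?F" unfolding HF_def using pi.subgroup_img_is_subgroup[OF H1S] .
  \<comment> \<open>Conjugating \<open>t \<otimes> n\<close> by m1, an element of \<open>N\<close>,
    changes only the factor in \<open>N\<close>: the result is \<open>t \<otimes> n'\<close>. As t
    and the product lie in \<open>S\<close>, so does n'.\<close>
  have sub: "HF \<subseteq> S' <#>\<^bsub>?F\<^esub> M"
  proof
    fix C assume "C \<in> HF"
    then obtain h where h: "h \<in> H" "C = U #> (m1 \<otimes> h \<otimes> inv m1)" unfolding HF_def H1_def by auto
    obtain t n where t: "t \<in> S" "U #> t \<in> S'" "n \<in> N" "h = t \<otimes> n"
      using H(3) h(1) unfolding set_mult_def by auto
    have G: "t \<in> carrier G" "n \<in> carrier G" using t s(3) NG by auto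
    define n' where "n' = (inv t \<otimes> m1 \<otimes> t) \<otimes> n \<otimes> inv m1"
    have n'N: "n' \<in> N"
      unfolding n'_def using normal.inv_op_closed1[OF N(1) G(1) m1(1)] t(3) m1(1) normal_imp_subgroup[OF N(1)]
      by (simp add: subgroup.m_closed subgroup.m_inv_closed)
    have eq: "m1 \<otimes> h \<otimes> inv m1 = t \<otimes> n'"
      unfolding n'_def t(4) using G m1G by (simp add: m_assoc cancel_inv)
    have n'G: "n' \<in> carrier G" using n'N NG by auto
    have "n' = inv t \<otimes> (m1 \<otimes> h \<otimes> inv m1)" unfolding eq using G n'G by (simp add: cancel_inv)
    then have "n' \<in> S" using t(1) m1(2)[OF h(1)] s(1) by (simp add: subgroup.m_closed subgroup.m_inv_closed)
    then have "U #> n' \<in> M" unfolding M_def using n'N by auto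
    moreover have "C = (U #> t) \<otimes>\<^bsub>?F\<^esub> (U #> n')"
      unfolding h(2) eq using pi.hom_mult[of t n'] t(1) \<open>n' \<in> S\<close> by simp
    ultimately show "C \<in> S' <#>\<^bsub>?F\<^esub> M" unfolding set_mult_def using t(2) by blast
  qed
  have tor: "\<exists>n. C [^]\<^bsub>?F\<^esub> (p ^ n :: nat) = \<one>\<^bsub>?F\<^esub>" if C: "C \<in> HF" for C
  proof -
    obtain h where h: "h \<in> H1" "C = U #> h" using C unfolding HF_def by auto
    have Us: "subgroup U ?S" using normal_imp_subgroup[OF U(1)] .
    obtain W where W: "W \<lhd> G" "openin T W" "W \<inter> S \<subseteq> U"
      using open_trace[OF s(1) U(2)] subgroup.one_closed[OF Us] by auto
    obtain n :: nat where n: "h [^] (p ^ n) \<in> W"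
      using H1(2) h(1) W normal_imp_subgroup[OF W(1)] unfolding pro_p_set_def by blast
    have hS: "h \<in> carrier ?S" using h H1(3) by auto
    have "h [^] (p ^ n) \<in> S" using S.nat_pow_closed[OF hS, of "p ^ n"] by simp
    then have "h [^] (p ^ n) \<in> U" using n W(3) by auto
    then have "U #> (h [^] (p ^ n)) = U"
      using S.coset_join2[OF _ Us, of "h [^] (p ^ n)"] \<open>h [^] (p ^ n) \<in> S\<close> by simp
    then have "C [^]\<^bsub>?F\<^esub> (p ^ n) = \<one>\<^bsub>?F\<^esub>"
      unfolding h(2) using pi.hom_nat_pow[OF hS, of "p ^ n"] by simp
    then show ?thesis by blast
  qed
  obtain C where C: "C \<in> M" "\<And>D. D \<in> HF \<Longrightarrow> C \<otimes>\<^bsub>?F\<^esub> D \<otimes>\<^bsub>?F\<^esub> inv\<^bsub>?F\<^esub> C \<in> S'"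
    using pi.H.p_subgroup_conj_by_normal[OF finF p S'(1) M HF sub tor S'(2)] by metis
  obtain n where n: "n \<in> N" "n \<in> S" "C = U #> n" using C(1) unfolding M_def by auto
  have nG: "n \<in> carrier G" using n NG by auto
  have "n \<otimes> m1 \<otimes> h \<otimes> inv (n \<otimes> m1) \<in> ?S1" if h: "h \<in> H" for h
  proof -
    define x where "x = m1 \<otimes> h \<otimes> inv m1"
    have xS: "x \<in> S" and xH: "x \<in> H1" using m1(2)[OF h] h unfolding x_def H1_def by auto
    have hG: "h \<in> carrier G" using h HG by auto
    have "n \<otimes> m1 \<otimes> h \<otimes> inv (n \<otimes> m1) = n \<otimes> x \<otimes> inv n"
      unfolding x_def using nG m1G hG by (simp add: m_assoc inv_mult_group)
    moreover have "n \<otimes> x \<otimes> inv n \<in> S"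
      using n(2) xS s(1) by (simp add: subgroup.m_closed subgroup.m_inv_closed)
    moreover have "U #> (n \<otimes> x \<otimes> inv n) \<in> S'"
    proof -
      have nx: "n \<in> carrier ?S" "x \<in> carrier ?S" using n xS by auto
      have "C \<otimes>\<^bsub>?F\<^esub> (U #> x) \<otimes>\<^bsub>?F\<^esub> inv\<^bsub>?F\<^esub> C \<in> S'" using C(2) xH unfolding HF_def by auto
      moreover have "U #> (n \<otimes>\<^bsub>?S\<^esub> x \<otimes>\<^bsub>?S\<^esub> inv\<^bsub>?S\<^esub> n) =
          C \<otimes>\<^bsub>?F\<^esub> (U #> x) \<otimes>\<^bsub>?F\<^esub> inv\<^bsub>?F\<^esub> C"
        unfolding n(3) using pi.hom_mult pi.hom_inv nx S.inv_closed S.m_closed by metis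
      ultimately show ?thesis using inv_tsub[OF s(1) n(2)] by simp
    qed
    ultimately show ?thesis by simp
  qed
  moreover have "n \<otimes> m1 \<in> N" using n(1) m1(1) normal_imp_subgroup[OF N(1)] by (simp add: subgroup.m_closed)
  ultimately show "\<exists>m\<in>N. \<forall>h\<in>H. m \<otimes> h \<otimes> inv m \<in> ?S1" by blast
qed

theorem prosoluble_supplement:
  assumes p: "prime p" and Q: "pro_C_group finite_soluble_grp Q"
    and \<alpha>: "\<alpha> \<in> cont_hom G Q" and surj: "\<alpha> ` carrier G = carrier Q"
  obtains S where "closed_subgroup S G" "\<alpha> ` S = carrier Q" "p_absorbing p S"
    "pro_C_group finite_soluble_grp (tsub G S)"
proof -
  interpret Q: profinite Q using pro_C_profinite[OF Q] .
  interpret \<alpha>: group_hom G Q \<alpha>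
    using \<alpha> by (simp add: group_hom_def group_hom_axioms_def is_group Q.is_group cont_hom_def)
  have cont: "continuous_map T (gtop Q) \<alpha>" using \<alpha> by (simp add: cont_hom_def)
  define \<A> where "\<A> = {S. closed_subgroup S G \<and> \<alpha> ` S = carrier Q \<and> p_absorbing p S}"
  have "carrier G \<in> \<A>" unfolding \<A>_def using surj closed_subgroup_carrier p_absorbing_carrier by simp
  then have ne: "\<A> \<noteq> {}" by auto
  have chain: "\<Inter>\<C> \<in> \<A>" if \<C>: "\<C> \<noteq> {}" "subset.chain \<A> \<C>" for \<C>
  proof -
    have mem: "closed_subgroup S G" "\<alpha> ` S = carrier Q" "p_absorbing p S" if "S \<in> \<C>" for S
      using \<C>(2) that unfolding subset_chain_def \<A>_def by blast+
    note closed_supplement_Inter[OF cont Q.profinite_axioms \<C> mem(1,2)]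
    moreover have "p_absorbing p (\<Inter>\<C>)"
      using p_absorbing_Inter[OF \<C>] mem(3) closed_subgroupD(2)[OF mem(1)] by metis
    ultimately show ?thesis unfolding \<A>_def by simp
  qed
  obtain S where S: "S \<in> \<A>" and Smin: "\<And>S'. S' \<in> \<A> \<Longrightarrow> S' \<subseteq> S \<Longrightarrow> S' = S"
    using minimal_set_exists[OF ne chain] by metis
  have cS: "closed_subgroup S G" and aS: "\<alpha> ` S = carrier Q" and abS: "p_absorbing p S"
    using S unfolding \<A>_def by auto
  note s = closed_subgroupD[OF cS]
  let ?S = "tsub G S"
  interpret S: profinite ?S using profinite_tsub[OF cS] .
  have \<alpha>S: "group_hom ?S Q \<alpha>" "\<alpha> ` carrier ?S = carrier Q" "\<alpha> \<in> cont_hom ?S Q"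
    using group_hom_tsub[OF \<alpha>.group_hom_axioms s(1)] cont_hom_tsub[OF \<alpha> s(1)] aS by auto
  have "finite_soluble_grp (?S Mod U)" if U: "U \<lhd> ?S" "openin (gtop ?S) U" for U
  proof -
    let ?F = "?S Mod U"
    let ?V = "\<alpha> ` U"
    have Us: "subgroup U ?S" using normal_imp_subgroup[OF U(1)] .
    have US: "U \<subseteq> S" using subgroup.subset[OF Us] by simp
    have fin: "finite (carrier ?F)" using S.finite_FactGroup[OF U] .
    have V: "?V \<lhd> Q" using normal.surj_hom_normal_subgroup[OF U(1) \<alpha>S(1,2)] .
    have "openin (gtop Q) ?V"
      using S.open_image[OF \<alpha>S(3,2) Q.profinite_axioms Us U(2)] .
    then have solV: "solvable (Q Mod ?V)"
      using Q V unfolding pro_C_group_def finite_soluble_grp_def by blast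
    interpret pi: group_hom ?S ?F "\<lambda>x. U #> x"
      using S.group_hom_r_coset[OF U(1)] by simp
    interpret f: group_hom ?F "Q Mod ?V" "\<lambda>C. \<alpha> ` C"
      using S.FactGroup_image_hom(1)[OF \<alpha>S(1,2) U(1)] .
    have f_coset: "\<alpha> ` (U #> x) = ?V #>\<^bsub>Q\<^esub> \<alpha> x" if "x \<in> S" for x
      using S.FactGroup_image_hom(2)[OF \<alpha>S(1,2) U(1), of x] that by simp
    have "solvable ?F"
    proof (rule f.minimal_supplement_solvable[OF fin p solV])
      fix S' assume S': "subgroup S' ?F" "(\<lambda>C. \<alpha> ` C) ` S' = (\<lambda>C. \<alpha> ` C) ` carrier ?F"
        "coprime_index p (carrier ?F) S'"
      \<comment> \<open>Minimality of \<open>S\<close> is carried to the finite quotient: the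
        preimage of a supplement \<open>S'\<close> of index prime to p belongs to
        \<open>\<A>\<close>, so it is \<open>S\<close>.\<close>
      define S1 where "S1 = {s \<in> S. U #> s \<in> S'}"
      have S1S: "subgroup S1 ?S" unfolding S1_def using pi.subgroup_vimage[OF S'(1)] by simp
      have "U \<subseteq> S1"
      proof
        fix u assume u: "u \<in> U"
        then have "U #> u = U" using S.coset_join2[OF _ Us, of u] US by auto
        then show "u \<in> S1" using u US subgroup.one_closed[OF S'(1)] unfolding S1_def by auto
      qed
      then have "openin (gtop ?S) S1"
        using S.openin_subgroup[OF S1S U(2) subgroup.one_closed[OF Us]] by simp
      then have "closedin (gtop ?S) S1" using S.closedin_open_subgroup[OF S1S] by simp
      then have "closedin T S1" using s(2) by (simp add: closedin_closed_subtopology)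
      then have cS1: "closed_subgroup S1 G"
        using S1S subgroup_tsub_iff[OF s(1)] unfolding closed_subgroup_def by auto
      have "\<alpha> ` S1 = carrier Q"
      proof (intro equalityI subsetI)
        fix q assume "q \<in> carrier Q"
        then obtain x where x: "x \<in> S" "\<alpha> x = q" using aS by (metis imageE)
        have "U #> x \<in> carrier ?F" using pi.hom_closed x by simp
        then have "\<alpha> ` (U #> x) \<in> (\<lambda>C. \<alpha> ` C) ` S'" unfolding S'(2) by simp
        then obtain C where C: "C \<in> S'" "\<alpha> ` (U #> x) = \<alpha> ` C" by auto
        have "C \<in> carrier ?F" using subgroup.mem_carrier[OF S'(1) C(1)] .
        then obtain y where y: "y \<in> S" "C = U #> y" by (auto simp: carrier_FactGroup)
        have "q \<in> ?V #>\<^bsub>Q\<^esub> \<alpha> x"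
          using x Q.rcos_self[of "\<alpha> x" ?V] normal_imp_subgroup[OF V] aS by auto
        \<comment> \<open>The cosets of x and of \<open>C\<close> have the same image in
          \<open>Q\<close>, so q has a preimage z in \<open>C\<close> itself, and every element of
          \<open>C\<close> lies over \<open>S'\<close>.\<close>
        then have "q \<in> \<alpha> ` C" using C(2) f_coset[OF x(1)] by simp
        then obtain z where z: "z \<in> C" "q = \<alpha> z" by auto
        have "z \<in> S" "U #> z = C"
        proof -
          show "z \<in> S" using z(1) y US s(1) subgroup.m_closed unfolding r_coset_def by fastforce
          show "U #> z = C" using S.repr_independence[of z U y] z(1) y Us by auto
        qed
        then show "q \<in> \<alpha> ` S1" using C(1) z unfolding S1_def by auto
      qed (use s(3) in \<open>auto simp: S1_def\<close>)
      moreover have "p_absorbing p S1"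
        unfolding S1_def using absorbing_preimage[OF p cS abS U(1) _ S'(1,3)] U(2) by simp
      ultimately have "S1 \<in> \<A>" using cS1 unfolding \<A>_def by simp
      then have "S1 = S" using Smin unfolding S1_def by auto
      then show "S' = carrier ?F"
        using subgroup.subset[OF S'(1)] unfolding S1_def by (auto simp: carrier_FactGroup)
    qed
    then show ?thesis using fin unfolding finite_soluble_grp_def by simp
  qed
  then have "pro_C_group finite_soluble_grp ?S"
    unfolding pro_C_group_def using S.prof by blast
  then show ?thesis using that cS aS abS by blast
qed

end

section \<open>Continuous choice of conjugators\<close>

context profinite
begin

section \<open>Intersections of normal subgroups, and cosets\<close>

lemma normal_Inter:
  assumes "\<C> \<noteq> {}" "\<And>N. N \<in> \<C> \<Longrightarrow> N \<lhd> G"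
  shows "\<Inter>\<C> \<lhd> G"
  unfolding normal_inv_iff
proof (intro conjI ballI)
  show "subgroup (\<Inter>\<C>) G" using assms normal_imp_subgroup by (intro subgroups_Inter) auto
  fix x h assume "x \<in> carrier G" "h \<in> \<Inter>\<C>"
  then show "x \<otimes> h \<otimes> inv x \<in> \<Inter>\<C>"
    using normal.inv_op_closed2[OF assms(2)] by (meson InterE InterI)
qed

lemma l_coset_iff:
  assumes "k \<in> carrier G" "N \<subseteq> carrier G" "g \<in> carrier G"
  shows "g \<in> k <# N \<longleftrightarrow> inv k \<otimes> g \<in> N"
proof
  assume "inv k \<otimes> g \<in> N"
  moreover have "g = k \<otimes> (inv k \<otimes> g)" using assms by (simp add: cancel_inv)
  ultimately show "g \<in> k <# N" unfolding l_coset_def by blast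
qed (use assms in \<open>auto simp: l_coset_def cancel_inv\<close>)

lemma l_coset_self: "subgroup N G \<Longrightarrow> k \<in> carrier G \<Longrightarrow> k \<in> k <# N"
  using subgroup.one_closed by (force simp: l_coset_def)

lemma closedin_l_coset:
  assumes "closedin T B" "g \<in> carrier G"
  shows "closedin T (g <# B)"
  unfolding l_coset_eq_set_mult using closedin_set_mult[OF closedin_singleton] assms by blast

lemma l_coset_mono_iff:
  assumes N: "subgroup N G" "subgroup N' G" and k: "k \<in> carrier G" "k' \<in> carrier G" and sub: "k <# N \<subseteq> k' <# N'"
  shows "N \<subseteq> N'"
proof
  fix n assume n: "n \<in> N"
  have nG: "n \<in> carrier G" using n N subgroup.mem_carrier by metis
  have NG: "N' \<subseteq> carrier G" using N subgroup.subset by metis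
  have "inv k' \<otimes> k \<in> N'"
    using sub l_coset_self[OF N(1) k(1)] l_coset_iff[OF k(2) NG k(1)] by blast
  moreover have "k \<otimes> n \<in> k' <# N'" using sub n unfolding l_coset_def by blast
  then have "inv k' \<otimes> (k \<otimes> n) \<in> N'" using l_coset_iff[OF k(2) NG] k nG by simp
  moreover have "n = inv (inv k' \<otimes> k) \<otimes> (inv k' \<otimes> (k \<otimes> n))"
    using k nG by (simp add: inv_mult_group m_assoc cancel_inv)
  ultimately show "n \<in> N'" using N(2) by (metis subgroup.m_closed subgroup.m_inv_closed)
qed

text \<open>The inclusion fails for general \<open>W\<close>. It holds for small \<open>W\<close>, because \<open>S (N \<inter> V)\<close> is open
  in \<open>S N\<close> for every open \<open>V\<close>.\<close>

lemma compatible_open_normal: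
  assumes N: "N \<lhd> G" "closedin T N" and S: "closed_subgroup S G" and n: "n \<in> N" "n \<noteq> \<one>"
  obtains W where "W \<lhd> G" "openin T W" "n \<notin> W" "(S <#> N) \<inter> (S <#> W) \<subseteq> S <#> (N \<inter> W)"
proof -
  note s = closed_subgroupD[OF S]
  have Ns: "subgroup N G" and NG: "N \<subseteq> carrier G"
    using normal_imp_subgroup[OF N(1)] closedin_subset_carrier[OF N(2)] by auto
  obtain V where V: "V \<lhd> G" "openin T V" "n \<notin> V" using open_normal_separate[OF NG n] by auto
  have Vs: "subgroup V G" and VG: "V \<subseteq> carrier G"
    using normal_imp_subgroup[OF V(1)] openin_subset_carrier[OF V(2)] by auto
  define M where "M = N \<inter> V"
  have M: "M \<lhd> G" unfolding M_def using normal_subgroup_intersect[OF N(1) V(1)] .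
  have Ms: "subgroup M G" using normal_imp_subgroup[OF M] .
  have SM: "subgroup (S <#> M) G" using set_mult_subgroup(1)[OF s(1) M] .
  have SN: "subgroup (S <#> N) G" using set_mult_subgroup(1)[OF s(1) N(1)] .
  \<comment> \<open>The elements of \<open>N\<close> that lie in \<open>S <#> M\<close> up to a
    factor in \<open>V\<close>; all of \<open>N \<inter> S\<close> is among them. Hence \<one> is
    not in \<open>C\<close>, and a small \<open>W'\<close> avoids \<open>C\<close>: an element
    \<open>t \<otimes> n1\<close> of \<open>W'\<close>, with t in \<open>S\<close> and n1 in
    \<open>N\<close>, has n1 in \<open>?O\<close>.\<close>
  let ?O = "(N \<inter> (S <#> M)) <#> V"
  define C where "C = S <#> (N - ?O)"
  have "openin T ?O" using openin_set_mult[OF V(2), of "N \<inter> (S <#> M)"] NG by auto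
  then have cC: "closedin T C" unfolding C_def using closedin_set_mult[OF s(2)] closedin_diff[OF N(2)] by blast
  have "\<one> \<notin> C"
  proof
    assume "\<one> \<in> C"
    then obtain t c where t: "t \<in> S" "c \<in> N" "c \<notin> ?O" "\<one> = t \<otimes> c" unfolding C_def set_mult_def by auto
    have tG: "t \<in> carrier G" "c \<in> carrier G" using t s(3) NG by auto
    then have "c = inv t" using t(4) by (metis inv_equality inv_inv inv_closed)
    then have "c \<in> S" using t(1) subgroup.m_inv_closed[OF s(1)] by simp
    then have "c \<in> N \<inter> (S <#> M)" using t(2) subset_set_mult(1)[OF s(1) Ms] by blast
    then have "c \<otimes> \<one> \<in> ?O" using subgroup.one_closed[OF Vs] unfolding set_mult_def by blast
    then show False using t(3) tG by simp
  qed
  then obtain W' where W': "W' \<lhd> G" "openin T W'" "W' \<subseteq> (carrier G - C) \<inter> V"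
    using open_normal_nbhd[of "(carrier G - C) \<inter> V"] cC V(2) subgroup.one_closed[OF Vs] openin_diff[of T "carrier G" C]
    by (auto simp: openin_Int)
  have W's: "subgroup W' G" using normal_imp_subgroup[OF W'(1)] .
  \<comment> \<open>Adjoining \<open>M\<close> makes \<open>N \<inter> W\<close> equal to
    \<open>M\<close>, as the product remains inside \<open>V\<close>. What has to be shown thus
    becomes membership in \<open>S <#> M\<close>.\<close>
  define W where "W = W' <#> M"
  have W: "W \<lhd> G" unfolding W_def using normal_subgroup_set_mult_closed[OF W'(1) M] .
  have Ws: "subgroup W G" using normal_imp_subgroup[OF W] .
  have "W' \<subseteq> W" "M \<subseteq> W" unfolding W_def using subset_set_mult[OF W's Ms] by auto
  then have oW: "openin T W" using openin_subgroup[OF Ws W'(2) subgroup.one_closed[OF W's]] by blast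
  have "W \<subseteq> V" unfolding W_def set_mult_def M_def using W'(3) subgroup.m_closed[OF Vs] by auto
  then have nW: "n \<notin> W" using V(3) by auto
  have key: "w \<in> S <#> M" if w: "w \<in> S <#> N" "w \<in> W" for w
  proof -
    obtain w' m where wm: "w' \<in> W'" "m \<in> M" "w = w' \<otimes> m" using w(2) unfolding W_def set_mult_def by auto
    have G: "w' \<in> carrier G" "m \<in> carrier G"
      using wm subgroup.mem_carrier[OF W's] subgroup.mem_carrier[OF Ms] by auto
    have "m \<in> S <#> N" using subset_set_mult(2)[OF s(1) Ns] wm(2) unfolding M_def by auto
    moreover have "w' = w \<otimes> inv m" using G wm(3) by (simp add: m_assoc)
    ultimately have "w' \<in> S <#> N" using w(1) SN by (metis subgroup.m_closed subgroup.m_inv_closed)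
    then obtain t n1 where t: "t \<in> S" "n1 \<in> N" "w' = t \<otimes> n1" unfolding set_mult_def by auto
    have "w' \<notin> C" using wm(1) W'(3) by auto
    then have "n1 \<in> ?O" using t unfolding C_def set_mult_def by blast
    then obtain y v where y: "y \<in> N" "y \<in> S <#> M" "v \<in> V" "n1 = y \<otimes> v" unfolding set_mult_def by auto
    \<comment> \<open>Being a quotient of two elements of \<open>N\<close>, the factor v lies in
      \<open>N \<inter> V\<close>, that is, in \<open>M\<close>.\<close>
    have "v = inv y \<otimes> n1" using y NG VG by (auto simp: cancel_inv subset_iff)
    then have "v \<in> N" using y(1) t(2) Ns by (simp add: subgroup.m_closed subgroup.m_inv_closed)
    then have "v \<in> S <#> M" using y(3) subset_set_mult(2)[OF s(1) Ms] unfolding M_def by auto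
    then have "n1 \<in> S <#> M" using y SM by (simp add: subgroup.m_closed)
    moreover have "t \<in> S <#> M" "m \<in> S <#> M" using subset_set_mult[OF s(1) Ms] t(1) wm(2) by auto
    ultimately show ?thesis using wm(3) t(3) SM by (simp add: subgroup.m_closed)
  qed
  have "(S <#> N) \<inter> (S <#> W) \<subseteq> S <#> (N \<inter> W)"
  proof
    fix x assume x: "x \<in> (S <#> N) \<inter> (S <#> W)"
    then obtain t w where t: "t \<in> S" "w \<in> W" "x = t \<otimes> w" unfolding set_mult_def by auto
    have tG: "t \<in> carrier G" "w \<in> carrier G" using t s(3) subgroup.mem_carrier[OF Ws] by auto
    have "w = inv t \<otimes> x" using tG t(3) by (simp add: cancel_inv)
    moreover have "t \<in> S <#> N" using subset_set_mult(1)[OF s(1) Ns] t(1) by auto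
    ultimately have "w \<in> S <#> N" using x SN by (metis IntD1 subgroup.m_closed subgroup.m_inv_closed)
    then have "w \<in> S <#> M" using key t(2) by auto
    moreover have "t \<in> S <#> M" using subset_set_mult(1)[OF s(1) Ms] t(1) by auto
    ultimately have "x \<in> S <#> M" using t(3) SM by (simp add: subgroup.m_closed)
    moreover have "M \<subseteq> N \<inter> W" using \<open>M \<subseteq> W\<close> unfolding M_def by auto
    ultimately show "x \<in> S <#> (N \<inter> W)" unfolding set_mult_def by blast
  qed
  then show ?thesis using that W oW nW by blast
qed

text \<open>\<open>R\<close> is the graph, modulo \<open>N\<close>, of a map \<open>x \<mapsto> k x\<close> with \<open>k x A x (k x)\<inverse> \<le> S\<close>.\<close>

definition conj_approx ::
  "'x topology \<Rightarrow> ('x \<Rightarrow> 'a set) \<Rightarrow> 'a set \<Rightarrow> 'a set \<Rightarrow> 'a set \<Rightarrow> ('x \<times> 'a) set \<Rightarrow> bool" where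
  "conj_approx X A S K N R \<longleftrightarrow>
     closedin (prod_topology X T) R \<and> N \<lhd> G \<and> closedin T N \<and> N \<subseteq> K \<and>
     (\<forall>x \<in> topspace X. \<exists>k \<in> K. (\<forall>a \<in> A x. k \<otimes> a \<otimes> inv k \<in> S) \<and> R `` {x} = k <# N)"

text \<open>The group can be read off a single fibre. In particular \<open>R\<close> alone
  determines \<open>N\<close> when there is a point, which is why minimality may be stated for the
  sets \<open>R\<close>.\<close>

lemma conj_approx_mono:
  assumes "conj_approx X A S K N R" "conj_approx X A S K N' R'" "R \<subseteq> R'" "x \<in> topspace X" "K \<subseteq> carrier G"
  shows "N \<subseteq> N'"
proof -
  obtain k where k: "k \<in> K" "R `` {x} = k <# N" using assms(1,4) unfolding conj_approx_def by blast
  obtain k' where k': "k' \<in> K" "R' `` {x} = k' <# N'" using assms(2,4) unfolding conj_approx_def by blast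
  show ?thesis
  proof (rule l_coset_mono_iff)
    show "k <# N \<subseteq> k' <# N'" using k(2) k'(2) assms(3) by blast
    show "subgroup N G" "subgroup N' G" using assms(1,2) normal_imp_subgroup unfolding conj_approx_def by auto
  qed (use k k' assms(5) in auto)
qed

text \<open>Over a fixed point the exact conjugators inside the fibres are closed, nonempty and
  decreasing, so some k lies in all of them. It represents every coset of the chain, and the
  intersection of the \<open>k <# N R\<close> is the coset of the intersection.\<close>

lemma conj_approx_Inter:
  assumes ne: "\<C> \<noteq> {}" and ch: "subset.chain \<A> \<C>"
    and mem: "\<And>R. R \<in> \<C> \<Longrightarrow> conj_approx X A S K (N R) R"
    and K: "subgroup K G" and S: "closedin T S"
    and A: "\<And>x. x \<in> topspace X \<Longrightarrow> A x \<subseteq> carrier G"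
  shows "conj_approx X A S K (\<Inter>(N ` \<C>)) (\<Inter>\<C>)"
  unfolding conj_approx_def
proof (intro conjI ballI)
  have KG: "K \<subseteq> carrier G" using subgroup.subset[OF K] .
  have R: "closedin (prod_topology X T) R" "N R \<lhd> G" "closedin T (N R)" "N R \<subseteq> K" if "R \<in> \<C>" for R
    using mem[OF that] unfolding conj_approx_def by auto
  show "closedin (prod_topology X T) (\<Inter>\<C>)" using ne R(1) by (intro closedin_Inter) auto
  show "\<Inter>(N ` \<C>) \<lhd> G" using ne R(2) by (intro normal_Inter) auto
  show "closedin T (\<Inter>(N ` \<C>))" using ne R(3) by (intro closedin_Inter) auto
  show "\<Inter>(N ` \<C>) \<subseteq> K" using ne R(4) by blast
  fix x assume x: "x \<in> topspace X"
  let ?f = "\<lambda>R. R `` {x} \<inter> {k \<in> carrier G. \<forall>a \<in> A x. k \<otimes> a \<otimes> inv k \<in> S}"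
  have fib: "\<exists>k \<in> K. (\<forall>a \<in> A x. k \<otimes> a \<otimes> inv k \<in> S) \<and> R `` {x} = k <# N R" if "R \<in> \<C>" for R
    using mem[OF that] x unfolding conj_approx_def by blast
  have "\<exists>k. \<forall>R \<in> \<C>. k \<in> ?f R"
  proof (rule compact_chain_common_point[OF compact ne ch, of ?f])
    fix R assume RC: "R \<in> \<C>"
    obtain k where k: "k \<in> K" "\<forall>a \<in> A x. k \<otimes> a \<otimes> inv k \<in> S" "R `` {x} = k <# N R" using fib[OF RC] by blast
    have kG: "k \<in> carrier G" using k KG by auto
    show "closedin T (?f R)"
      unfolding k(3) using closedin_l_coset[OF R(3)[OF RC] kG] closedin_conjugators[OF S A[OF x]] by blast
    show "?f R \<noteq> {}"
      unfolding k(3) using l_coset_self[OF normal_imp_subgroup[OF R(2)[OF RC]] kG] kG k(2) by blast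
  qed auto
  then obtain k where k: "\<And>R. R \<in> \<C> \<Longrightarrow> k \<in> R `` {x} \<and> k \<in> carrier G \<and> (\<forall>a \<in> A x. k \<otimes> a \<otimes> inv k \<in> S)"
    by auto
  have Rx: "R `` {x} = k <# N R \<and> k \<in> K" if RC: "R \<in> \<C>" for R
  proof -
    obtain k' where k': "k' \<in> K" "R `` {x} = k' <# N R" using fib[OF RC] by blast
    have "k \<in> k' <# N R" using k[OF RC] k'(2) by simp
    then have "k' <# N R = k <# N R"
      using l_repr_independence[of k k' "N R"] k'(1) KG normal_imp_subgroup[OF R(2)[OF RC]] by auto
    moreover have "k \<in> K"
      using \<open>k \<in> k' <# N R\<close> k'(1) R(4)[OF RC] subgroup.m_closed[OF K] unfolding l_coset_def by auto
    ultimately show ?thesis using k'(2) by simp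
  qed
  have "(\<Inter>\<C>) `` {x} = (\<Inter>R\<in>\<C>. R `` {x})" by blast
  also have "\<dots> = (\<Inter>R\<in>\<C>. k <# N R)" using Rx by simp
  also have "\<dots> = k <# \<Inter>(N ` \<C>)"
  proof -
    obtain R0 where R0: "R0 \<in> \<C>" using ne by blast
    have kG: "k \<in> carrier G" using k[OF R0] by simp
    have NG: "N R \<subseteq> carrier G" if "R \<in> \<C>" for R using R(4)[OF that] KG by blast
    have "g \<in> k <# \<Inter>(N ` \<C>)" if g: "\<And>R. R \<in> \<C> \<Longrightarrow> g \<in> k <# N R" for g
    proof -
      have gG: "g \<in> carrier G" using g[OF R0] NG[OF R0] kG unfolding l_coset_def by auto
      then have "inv k \<otimes> g \<in> N R" if "R \<in> \<C>" for R
        using g[OF that] l_coset_iff[OF kG NG[OF that] gG] by simp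
      then show ?thesis using l_coset_iff[OF kG _ gG, of "\<Inter>(N ` \<C>)"] NG[OF R0] R0 by blast
    qed
    then have "(\<Inter>R\<in>\<C>. k <# N R) \<subseteq> k <# \<Inter>(N ` \<C>)" by (meson INT_D subsetI)
    moreover have "k <# \<Inter>(N ` \<C>) \<subseteq> k <# N R" if "R \<in> \<C>" for R
      using that unfolding l_coset_def by auto
    ultimately show ?thesis by (meson INT_greatest subset_antisym)
  qed
  finally have "(\<Inter>\<C>) `` {x} = k <# \<Inter>(N ` \<C>)" .
  moreover have "k \<in> K" "\<forall>a \<in> A x. k \<otimes> a \<otimes> inv k \<in> S" using ne Rx k by blast+
  ultimately show "\<exists>k\<in>K. (\<forall>a\<in>A x. k \<otimes> a \<otimes> inv k \<in> S) \<and> \<Inter> \<C> `` {x} = k <# \<Inter> (N ` \<C>)" by blast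
qed

text \<open>With \<open>W\<close> from \<open>compatible_open_normal\<close>, a locally constant
  function c prescribes the value modulo \<open>W\<close>, and \<open>R'\<close> keeps the part of
  \<open>R\<close> that agrees with c. By compatibility, an element conjugating into both
  \<open>S <#> N\<close> and \<open>S <#> W\<close> conjugates into
  \<open>S <#> (N \<inter> W)\<close>; absorption then corrects it within its coset modulo
  \<open>N \<inter> W\<close>.\<close>

lemma conj_approx_refine:
  assumes R: "conj_approx X A S K N R" and X: "profinite_space X" and K: "subgroup K G"
    and S: "closed_subgroup S G" "p_absorbing p S"
    and A: "\<And>x. x \<in> topspace X \<Longrightarrow> subgroup (A x) G" "\<And>x. x \<in> topspace X \<Longrightarrow> pro_p_set p G (A x)"
    and cont: "\<And>U. subgroup U G \<Longrightarrow> openin T U \<Longrightarrow> openin X {x \<in> topspace X. A x \<subseteq> U}"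
    and n: "n \<in> N" "n \<noteq> \<one>"
  obtains N' R' where "conj_approx X A S K N' R'" "R' \<subseteq> R" "n \<notin> N'"
proof -
  have cR: "closedin (prod_topology X T) R" and N: "N \<lhd> G" "closedin T N" "N \<subseteq> K"
    and fib: "\<And>x. x \<in> topspace X \<Longrightarrow> \<exists>k \<in> K. (\<forall>a \<in> A x. k \<otimes> a \<otimes> inv k \<in> S) \<and> R `` {x} = k <# N"
    using R unfolding conj_approx_def by auto
  note s = closed_subgroupD[OF S(1)]
  have KG: "K \<subseteq> carrier G" using subgroup.subset[OF K] .
  have Ns: "subgroup N G" and NG: "N \<subseteq> carrier G" using normal_imp_subgroup[OF N(1)] N(3) KG by auto
  have Rsub: "R \<subseteq> topspace X \<times> carrier G" using closedin_subset[OF cR] by simp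
  obtain W where W: "W \<lhd> G" "openin T W" "n \<notin> W" "(S <#> N) \<inter> (S <#> W) \<subseteq> S <#> (N \<inter> W)"
    using compatible_open_normal[OF N(1,2) S(1) n] by metis
  have Ws: "subgroup W G" and WG: "W \<subseteq> carrier G"
    using normal_imp_subgroup[OF W(1)] openin_subset_carrier[OF W(2)] by auto
  have cW: "closedin T W" using closedin_open_subgroup[OF Ws W(2)] .
  have SWs: "subgroup (S <#> W) G" using set_mult_subgroup(1)[OF s(1) W(1)] .
  have oSW: "openin T (S <#> W)" using openin_set_mult[OF W(2) s(3)] .
  have SNs: "subgroup (S <#> N) G" using set_mult_subgroup(1)[OF s(1) N(1)] .
  have oWN: "openin T (W <#> N)"
    using openin_set_mult[OF W(2) NG] set_mult_subgroup(2)[OF Ns W(1)] by simp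
  \<comment> \<open>The last condition forces the coset of k modulo \<open>W\<close> to meet the
    fibre of \<open>R\<close> over y, so that the refined fibre is not empty.\<close>
  define P where "P = (\<lambda>y k. k \<in> carrier G \<and> (\<forall>a \<in> A y. k \<otimes> a \<otimes> inv k \<in> S <#> W) \<and> R `` {y} \<subseteq> k <# (W <#> N))"
  have loc: "\<exists>O' k. openin X O' \<and> x \<in> O' \<and> (\<forall>y \<in> O'. P y k)" if x: "x \<in> topspace X" for x
  proof -
    obtain k where k: "k \<in> K" "\<forall>a \<in> A x. k \<otimes> a \<otimes> inv k \<in> S" "R `` {x} = k <# N" using fib[OF x] by blast
    have kG: "k \<in> carrier G" using k KG by auto
    let ?U = "{g \<in> carrier G. k \<otimes> g \<otimes> inv k \<in> S <#> W}"
    let ?\<Omega> = "k <# (W <#> N)"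
    have o1: "openin X {y \<in> topspace X. A y \<subseteq> ?U}"
      using cont[OF conj_preimage_subgroup[OF SWs kG] openin_conj_preimage[OF oSW kG]] .
    \<comment> \<open>The points whose fibre leaves \<open>?\<Omega>\<close> are the projection of
      this closed set along the compact group, hence form a closed set.\<close>
    have "closedin (prod_topology X T) (R \<inter> (topspace X \<times> (carrier G - ?\<Omega>)))"
      using cR openin_l_coset[OF oWN kG]
      by (intro closedin_Int) (auto simp: closedin_prod_Times_iff intro!: closedin_diff)
    then have c: "closedin X (fst ` (R \<inter> (topspace X \<times> (carrier G - ?\<Omega>))))"
      using closed_map_fst[OF compact, of X] unfolding closed_map_def by blast
    let ?O = "{y \<in> topspace X. A y \<subseteq> ?U} - fst ` (R \<inter> (topspace X \<times> (carrier G - ?\<Omega>)))"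
    have "openin X ?O" using openin_diff[OF o1 c] .
    moreover have "x \<in> ?O"
    proof -
      have "A x \<subseteq> ?U"
        using k(2) subgroup.subset[OF A(1)[OF x]] subset_set_mult(1)[OF s(1) Ws] by blast
      moreover have "k <# N \<subseteq> ?\<Omega>"
        using subset_set_mult(2)[OF Ws Ns] unfolding l_coset_def by blast
      ultimately show ?thesis using x k(3) by auto
    qed
    moreover have "P y k" if y: "y \<in> ?O" for y
      unfolding P_def using y kG Rsub by force
    ultimately show ?thesis by blast
  qed
  obtain c where c: "\<And>x. x \<in> topspace X \<Longrightarrow> P x (c x)" "\<And>k. openin X {x \<in> topspace X. c x = k}"
    using profinite_space_locally_constant_choice[OF X, of P] loc by metis
  have cG: "c x \<in> carrier G" if "x \<in> topspace X" for x using c(1)[OF that] unfolding P_def by simp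
  define D where "D = {z \<in> topspace X \<times> carrier G. snd z \<in> c (fst z) <# W}"
  have cD: "closedin (prod_topology X T) D"
  proof -
    have "topspace (prod_topology X T) - D = (\<Union>k\<in>carrier G. {x \<in> topspace X. c x = k} \<times> (carrier G - (k <# W)))"
      unfolding D_def using cG by auto
    moreover have "openin (prod_topology X T) (\<Union>k\<in>carrier G. {x \<in> topspace X. c x = k} \<times> (carrier G - (k <# W)))"
      using c(2) closedin_l_coset[OF cW]
      by (intro openin_Union) (auto simp: openin_prod_Times_iff intro!: openin_diff)
    ultimately have "openin (prod_topology X T) (topspace (prod_topology X T) - D)" by simp
    moreover have "D \<subseteq> topspace (prod_topology X T)" unfolding D_def by auto
    ultimately show ?thesis unfolding closedin_def by blast
  qed
  define R' where "R' = R \<inter> D"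
  let ?M = "N \<inter> W"
  have M: "?M \<lhd> G" using normal_subgroup_intersect[OF N(1) W(1)] .
  have Ms: "subgroup ?M G" using normal_imp_subgroup[OF M] .
  have cM: "closedin T ?M" using N(2) cW by blast
  have "conj_approx X A S K ?M R'"
    unfolding conj_approx_def
  proof (intro conjI ballI)
    show "closedin (prod_topology X T) R'" unfolding R'_def using cR cD by blast
    show "?M \<subseteq> K" using N(3) by auto
    fix y assume y: "y \<in> topspace X"
    have yP: "\<forall>a \<in> A y. c y \<otimes> a \<otimes> inv (c y) \<in> S <#> W" "R `` {y} \<subseteq> c y <# (W <#> N)"
      using c(1)[OF y] unfolding P_def by auto
    have Ay: "A y \<subseteq> carrier G" using subgroup.subset[OF A(1)[OF y]] .
    obtain k1 where k1: "k1 \<in> K" "\<forall>a \<in> A y. k1 \<otimes> a \<otimes> inv k1 \<in> S" "R `` {y} = k1 <# N" using fib[OF y] by blast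
    have k1G: "k1 \<in> carrier G" using k1 KG by auto
    have "k1 \<in> c y <# (W <#> N)" using yP(2) k1(3) l_coset_self[OF Ns k1G] by blast
    then obtain w n1 where wn: "w \<in> W" "n1 \<in> N" "k1 = c y \<otimes> (w \<otimes> n1)" unfolding l_coset_def set_mult_def by auto
    have G: "w \<in> carrier G" "n1 \<in> carrier G" "c y \<in> carrier G" using wn WG NG cG[OF y] by auto
    \<comment> \<open>This element lies in \<open>k1 <# N\<close> and in \<open>c y <# W\<close>. It
      represents both cosets, so they intersect in \<open>k <# (N \<inter> W)\<close>.\<close>
    define k where "k = c y \<otimes> w"
    have kG: "k \<in> carrier G" unfolding k_def using G by simp
    have k_eq: "k = k1 \<otimes> inv n1" unfolding k_def wn(3) using G by (simp add: m_assoc)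
    have "inv n1 \<in> N" using wn(2) Ns subgroup.m_inv_closed by metis
    then have kK: "k \<in> K" unfolding k_eq using k1(1) N(3) K by (auto simp: subgroup.m_closed)
    have "k \<in> k1 <# N" unfolding k_eq l_coset_def using \<open>inv n1 \<in> N\<close> by blast
    then have kN: "R `` {y} = k <# N" using k1(3) l_repr_independence[of k k1 N] k1G Ns by simp
    have "k \<in> c y <# W" unfolding k_def l_coset_def using wn(1) by blast
    then have kW: "c y <# W = k <# W" using l_repr_independence[of k "c y" W] G Ws by simp
    have "R' `` {y} = (R `` {y}) \<inter> (c y <# W)"
      unfolding R'_def D_def using Rsub by auto
    also have "\<dots> = k <# ?M"
    proof -
      have "g \<in> (k <# N) \<inter> (k <# W) \<longleftrightarrow> g \<in> k <# ?M" for g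
      proof (cases "g \<in> carrier G")
        case True
        then show ?thesis
          using l_coset_iff[OF kG NG] l_coset_iff[OF kG WG] l_coset_iff[OF kG subgroup.subset[OF Ms]] by simp
      next
        case False
        then show ?thesis using l_coset_subset_G[OF NG kG] l_coset_subset_G[OF subgroup.subset[OF Ms] kG] by blast
      qed
      then show ?thesis unfolding kN kW by blast
    qed
    finally have R'y: "R' `` {y} = k <# ?M" .
    \<comment> \<open>Replacing k1 by k conjugates the result by an element n2 of \<open>N\<close>,
      and replacing c y by k conjugates it by an element w2 of \<open>W\<close>; neither leaves
      \<open>S <#> N\<close>, respectively \<open>S <#> W\<close>.\<close>
    have in_both: "k \<otimes> a \<otimes> inv k \<in> S <#> ?M" if a: "a \<in> A y" for a
    proof -
      have aG: "a \<in> carrier G" using a Ay by auto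
      define n2 where "n2 = k1 \<otimes> inv n1 \<otimes> inv k1"
      have n2: "n2 \<in> S <#> N"
        unfolding n2_def using normal.inv_op_closed2[OF N(1) k1G \<open>inv n1 \<in> N\<close>] subset_set_mult(2)[OF s(1) Ns] by auto
      have "k1 \<otimes> a \<otimes> inv k1 \<in> S <#> N" using k1(2) a subset_set_mult(1)[OF s(1) Ns] by auto
      moreover have "k \<otimes> a \<otimes> inv k = n2 \<otimes> (k1 \<otimes> a \<otimes> inv k1) \<otimes> inv n2"
        unfolding k_eq n2_def using k1G aG G by (simp add: m_assoc inv_mult_group cancel_inv)
      ultimately have 1: "k \<otimes> a \<otimes> inv k \<in> S <#> N"
        using n2 by (simp add: subgroup.m_closed[OF SNs] subgroup.m_inv_closed[OF SNs])
      define w2 where "w2 = c y \<otimes> w \<otimes> inv (c y)"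
      have w2: "w2 \<in> S <#> W"
        unfolding w2_def using normal.inv_op_closed2[OF W(1) G(3) wn(1)] subset_set_mult(2)[OF s(1) Ws] by auto
      have "k \<otimes> a \<otimes> inv k = w2 \<otimes> (c y \<otimes> a \<otimes> inv (c y)) \<otimes> inv w2"
        unfolding k_def w2_def using aG G by (simp add: m_assoc inv_mult_group cancel_inv)
      then have 2: "k \<otimes> a \<otimes> inv k \<in> S <#> W"
        using w2 yP(1) a by (simp add: subgroup.m_closed[OF SWs] subgroup.m_inv_closed[OF SWs])
      show ?thesis using W(4) 1 2 by blast
    qed
    obtain m where m: "m \<in> ?M" "\<And>h. h \<in> (\<lambda>a. k \<otimes> a \<otimes> inv k) ` A y \<Longrightarrow> m \<otimes> h \<otimes> inv m \<in> S"
    proof -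
      have "(\<lambda>a. k \<otimes> a \<otimes> inv k) ` A y \<subseteq> S <#> ?M" using in_both by (rule image_subsetI)
      then show ?thesis
        using p_absorbingD[OF S(2) M cM conj_subgroup[OF kG A(1)[OF y]] pro_p_set_conj[OF A(2)[OF y] Ay kG]] that
        by blast
    qed
    have mG: "m \<in> carrier G" using m(1) NG by auto
    have "\<forall>a \<in> A y. (m \<otimes> k) \<otimes> a \<otimes> inv (m \<otimes> k) \<in> S"
    proof
      fix a assume a: "a \<in> A y"
      have "m \<otimes> (k \<otimes> a \<otimes> inv k) \<otimes> inv m \<in> S" using m(2) a by blast
      moreover have "(m \<otimes> k) \<otimes> a \<otimes> inv (m \<otimes> k) = m \<otimes> (k \<otimes> a \<otimes> inv k) \<otimes> inv m"
        using mG kG a Ay by (simp add: m_assoc inv_mult_group subset_iff)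
      ultimately show "(m \<otimes> k) \<otimes> a \<otimes> inv (m \<otimes> k) \<in> S" by simp
    qed
    moreover have "m \<otimes> k \<in> K" using m(1) N(3) kK K by (auto simp: subgroup.m_closed)
    \<comment> \<open>The correction m lies in the normal subgroup \<open>?M\<close>, so the exact
      conjugator \<open>m \<otimes> k\<close> stays in the coset already found.\<close>
    moreover have "k <# ?M = (m \<otimes> k) <# ?M"
    proof (rule l_repr_independence)
      have "m \<otimes> k = k \<otimes> (inv k \<otimes> m \<otimes> k)" using mG kG by (simp add: m_assoc cancel_inv)
      moreover have "inv k \<otimes> m \<otimes> k \<in> ?M" using normal.inv_op_closed1[OF M kG m(1)] .
      ultimately show "m \<otimes> k \<in> k <# ?M" unfolding l_coset_def by blast
    qed (use kG Ms in auto)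
    ultimately show "\<exists>k\<in>K. (\<forall>a\<in>A y. k \<otimes> a \<otimes> inv k \<in> S) \<and> R' `` {y} = k <# ?M" using R'y by metis
  qed (use M cM in auto)
  moreover have "R' \<subseteq> R" unfolding R'_def by auto
  moreover have "n \<notin> ?M" using W(3) by auto
  ultimately show ?thesis using that by blast
qed

theorem continuous_conjugators:
  assumes X: "profinite_space X" and K: "K \<lhd> G" "closedin T K"
    and S: "closed_subgroup S G" "p_absorbing p S"
    and A: "\<And>x. x \<in> topspace X \<Longrightarrow> subgroup (A x) G" "\<And>x. x \<in> topspace X \<Longrightarrow> pro_p_set p G (A x)"
      "\<And>x. x \<in> topspace X \<Longrightarrow> A x \<subseteq> S <#> K"
    and cont: "\<And>U. subgroup U G \<Longrightarrow> openin T U \<Longrightarrow> openin X {x \<in> topspace X. A x \<subseteq> U}"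
  obtains \<nu> where "continuous_map X T \<nu>" "\<And>x. x \<in> topspace X \<Longrightarrow> \<nu> x \<in> K"
    "\<And>x a. x \<in> topspace X \<Longrightarrow> a \<in> A x \<Longrightarrow> \<nu> x \<otimes> a \<otimes> inv (\<nu> x) \<in> S"
proof (cases "topspace X = {}")
  case True
  then show ?thesis using that[of "\<lambda>x. \<one>"] by simp
next
  case False
  \<comment> \<open>A point is needed to compare the groups \<open>N\<close> through the fibres of
    \<open>R\<close>.\<close>
  then obtain x0 where x0: "x0 \<in> topspace X" by blast
  have Ks: "subgroup K G" and KG: "K \<subseteq> carrier G"
    using normal_imp_subgroup[OF K(1)] closedin_subset_carrier[OF K(2)] by auto
  define \<A> where "\<A> = {R. \<exists>N. conj_approx X A S K N R}"
  \<comment> \<open>The coarsest approximation: modulo \<open>K\<close> no choice is made, and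
    absorption yields a conjugator at each point separately.\<close>
  have "conj_approx X A S K K (topspace X \<times> K)"
    unfolding conj_approx_def
  proof (intro conjI ballI)
    fix x assume x: "x \<in> topspace X"
    obtain k where k: "k \<in> K" "\<And>a. a \<in> A x \<Longrightarrow> k \<otimes> a \<otimes> inv k \<in> S"
      using p_absorbingD[OF S(2) K A(1-3)[OF x]] by metis
    have "k <# K = K" using coset_join3[of k K] k(1) KG Ks by auto
    then show "\<exists>k\<in>K. (\<forall>a\<in>A x. k \<otimes> a \<otimes> inv k \<in> S) \<and> (topspace X \<times> K) `` {x} = k <# K"
      using k x by auto
  qed (use K in \<open>auto simp: closedin_prod_Times_iff\<close>)
  then have ne: "\<A> \<noteq> {}" unfolding \<A>_def by auto
  have "\<Inter>\<C> \<in> \<A>" if \<C>: "\<C> \<noteq> {}" "subset.chain \<A> \<C>" for \<C>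
  proof -
    have "\<forall>R \<in> \<C>. \<exists>N. conj_approx X A S K N R" using \<C>(2) unfolding subset_chain_def \<A>_def by auto
    then obtain N where "\<And>R. R \<in> \<C> \<Longrightarrow> conj_approx X A S K (N R) R" by metis
    then have "conj_approx X A S K (\<Inter>(N ` \<C>)) (\<Inter>\<C>)"
      using conj_approx_Inter[OF \<C>, of X A S K N] Ks closed_subgroupD(2)[OF S(1)] subgroup.subset[OF A(1)]
      by blast
    then show ?thesis unfolding \<A>_def by blast
  qed
  then obtain R where R: "R \<in> \<A>" and Rmin: "\<And>R'. R' \<in> \<A> \<Longrightarrow> R' \<subseteq> R \<Longrightarrow> R' = R"
    using minimal_set_exists[OF ne] by metis
  obtain N where N: "conj_approx X A S K N R" using R unfolding \<A>_def by auto
  have Ns: "subgroup N G" using N normal_imp_subgroup unfolding conj_approx_def by auto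
  have "n = \<one>" if n: "n \<in> N" for n
  proof (rule ccontr)
    assume "n \<noteq> \<one>"
    obtain N' R' where R': "conj_approx X A S K N' R'" "R' \<subseteq> R" "n \<notin> N'"
      using conj_approx_refine[OF N X Ks S A(1,2) cont n \<open>n \<noteq> \<one>\<close>] by metis
    then have "R' = R" using Rmin unfolding \<A>_def by auto
    then have "N \<subseteq> N'" using conj_approx_mono[OF N R'(1) _ x0 KG] by simp
    then show False using n R'(3) by auto
  qed
  then have N1: "N = {\<one>}" using subgroup.one_closed[OF Ns] by blast
  have "\<exists>k \<in> K. (\<forall>a \<in> A x. k \<otimes> a \<otimes> inv k \<in> S) \<and> R `` {x} = {k}" if "x \<in> topspace X" for x
  proof -
    obtain k where "k \<in> K" "\<forall>a \<in> A x. k \<otimes> a \<otimes> inv k \<in> S" "R `` {x} = k <# N"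
      using N \<open>x \<in> topspace X\<close> unfolding conj_approx_def by blast
    moreover have "k <# N = {k}" unfolding N1 l_coset_def using \<open>k \<in> K\<close> KG by auto
    ultimately show ?thesis by auto
  qed
  then obtain \<nu> where \<nu>: "\<And>x. x \<in> topspace X \<Longrightarrow> \<nu> x \<in> K \<and> (\<forall>a \<in> A x. \<nu> x \<otimes> a \<otimes> inv (\<nu> x) \<in> S) \<and> R `` {x} = {\<nu> x}"
    by metis
  have cR: "closedin (prod_topology X T) R" using N unfolding conj_approx_def by simp
  have "R = (\<lambda>x. (x, \<nu> x)) ` topspace X"
  proof (intro equalityI subsetI)
    fix z assume z: "z \<in> R"
    then have "fst z \<in> topspace X" using closedin_subset[OF cR] by auto
    moreover have "snd z \<in> R `` {fst z}" using z by (auto simp: Image_iff)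
    ultimately show "z \<in> (\<lambda>x. (x, \<nu> x)) ` topspace X" using \<nu> by (auto intro!: image_eqI[of _ _ "fst z"] prod_eqI)
  next
    fix z assume "z \<in> (\<lambda>x. (x, \<nu> x)) ` topspace X"
    then obtain x where x: "x \<in> topspace X" "z = (x, \<nu> x)" by auto
    then show "z \<in> R" using \<nu>[OF x(1)] by blast
  qed
  then have "continuous_map X T \<nu>"
    using continuous_map_of_closed_graph[OF compact, of \<nu> X] cR \<nu> KG by auto
  then show ?thesis using that \<nu> by blast
qed

end

section \<open>Sections over projective groups\<close>

text \<open>Quotient groups have elements in \<open>'u set\<close>, while
  \<open>projective_group\<close> tests only embedding problems in \<open>'u\<close>. The structure
  is transported along an injection of the carrier.\<close>

lemma finite_group_copy:
  assumes inf: "infinite (UNIV :: 'u set)" and Q: "group Q" and fin: "finite (carrier Q)"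
  obtains A :: "'u tgroup" and e where "group A" "finite (carrier A)"
    "gtop A = discrete_topology (carrier A)" "e \<in> iso Q A"
proof -
  interpret Q: group Q by (rule Q)
  obtain Y :: "'u set" where Y: "finite Y" "card Y = card (carrier Q)"
    using infinite_arbitrarily_large[OF inf] by blast
  obtain e where e: "e ` carrier Q \<subseteq> Y" "inj_on e (carrier Q)"
    using card_le_inj[OF fin Y(1)] Y(2) by auto
  define d where "d = the_inv_into (carrier Q) e"
  have d: "d (e x) = x" if "x \<in> carrier Q" for x
    unfolding d_def using the_inv_into_f_f[OF e(2) that] .
  define A :: "'u tgroup" where "A = \<lparr>carrier = e ` carrier Q, monoid.mult = (\<lambda>x y. e (d x \<otimes>\<^bsub>Q\<^esub> d y)),
    one = e \<one>\<^bsub>Q\<^esub>, gtop = discrete_topology (e ` carrier Q)\<rparr>"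
  have iso: "e \<in> iso Q A"
    unfolding iso_def hom_def bij_betw_def A_def using e(2) d by auto
  have "A\<lparr>one := e \<one>\<^bsub>Q\<^esub>\<rparr> = A" unfolding A_def by simp
  then have "group A" using Q.iso_imp_img_group[OF iso] by simp
  moreover have "finite (carrier A)" "gtop A = discrete_topology (carrier A)" unfolding A_def using fin by auto
  ultimately show ?thesis using that iso by blast
qed

lemma cont_homI: "f \<in> hom G H \<Longrightarrow> continuous_map (gtop G) (gtop H) f \<Longrightarrow> f \<in> cont_hom G H"
  unfolding cont_hom_def by simp

lemma cont_homD:
  assumes "f \<in> cont_hom G H"
  shows "f \<in> hom G H" "continuous_map (gtop G) (gtop H) f"
  using assms unfolding cont_hom_def by auto

lemma cont_hom_group_hom: "f \<in> cont_hom G H \<Longrightarrow> group G \<Longrightarrow> group H \<Longrightarrow> group_hom G H f"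
  unfolding cont_hom_def group_hom_def group_hom_axioms_def by simp

context profinite
begin

text \<open>A continuous map from a compact space onto a Hausdorff space is closed, so the
  homomorphism induced algebraically is continuous.\<close>

lemma cont_hom_factor:
  assumes f: "f \<in> cont_hom G H" "f ` carrier G = carrier H" and H: "group H" "Hausdorff_space (gtop H)" "topspace (gtop H) = carrier H"
    and g: "g \<in> cont_hom G K" and K: "group K" and ker: "kernel G H f \<subseteq> kernel G K g"
  obtains h where "h \<in> cont_hom H K" "\<And>x. x \<in> carrier G \<Longrightarrow> h (f x) = g x"
proof -
  interpret f: group_hom G H f using cont_hom_group_hom[OF f(1) is_group H(1)] .
  interpret g: group_hom G K g using cont_hom_group_hom[OF g is_group K] .
  have wd: "g x = g y" if xy: "x \<in> carrier G" "y \<in> carrier G" "f x = f y" for x y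
  proof -
    have "x \<otimes> inv y \<in> kernel G H f" using xy by (simp add: kernel_def)
    then have "g (x \<otimes> inv y) = \<one>\<^bsub>K\<^esub>" using ker by (auto simp: kernel_def)
    then have "g x \<otimes>\<^bsub>K\<^esub> inv\<^bsub>K\<^esub> g y = \<one>\<^bsub>K\<^esub>" using xy by simp
    then show ?thesis using xy by (metis K group.inv_equality group.inv_inv g.hom_closed g.H.inv_closed)
  qed
  define h where "h = (\<lambda>q. g (SOME x. x \<in> carrier G \<and> f x = q))"
  have hf: "h (f x) = g x" if x: "x \<in> carrier G" for x
  proof -
    have "\<exists>y. y \<in> carrier G \<and> f y = f x" using x by auto
    then have "(SOME y. y \<in> carrier G \<and> f y = f x) \<in> carrier G \<and> f (SOME y. y \<in> carrier G \<and> f y = f x) = f x"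
      by (rule someI_ex)
    then show ?thesis unfolding h_def using wd x by blast
  qed
  have "h \<in> hom H K"
  proof (rule homI)
    fix q assume "q \<in> carrier H"
    then obtain x where "x \<in> carrier G" "q = f x" using f(2) by auto
    then show "h q \<in> carrier K" using hf by simp
  next
    fix q q' assume q: "q \<in> carrier H" "q' \<in> carrier H"
    obtain x where "x \<in> carrier G" "q = f x" using f(2) q(1) by blast
    moreover obtain x' where "x' \<in> carrier G" "q' = f x'" using f(2) q(2) by blast
    ultimately show "h (q \<otimes>\<^bsub>H\<^esub> q') = h q \<otimes>\<^bsub>K\<^esub> h q'" using hf by (simp flip: f.hom_mult)
  qed
  moreover have "continuous_map (gtop H) (gtop K) h"
    unfolding continuous_map_closedin
  proof (intro conjI allI impI)
    show "h \<in> topspace (gtop H) \<rightarrow> topspace (gtop K)"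
    proof
      fix q assume "q \<in> topspace (gtop H)"
      then obtain x where x: "x \<in> carrier G" "q = f x" using f(2) H(3) by auto
      have "g x \<in> topspace (gtop K)"
        using continuous_map_image_subset_topspace[OF cont_homD(2)[OF g]] x by auto
      then show "h q \<in> topspace (gtop K)" using hf x by simp
    qed
    fix C assume C: "closedin (gtop K) C"
    have "closedin T {x \<in> topspace T. g x \<in> C}"
      using closedin_continuous_map_preimage[OF cont_homD(2)[OF g] C] .
    then have "closedin (gtop H) (f ` {x \<in> topspace T. g x \<in> C})"
      using closed_image[OF cont_homD(2)[OF f(1)] H(2)] by simp
    moreover have "f ` {x \<in> topspace T. g x \<in> C} = {q \<in> topspace (gtop H). h q \<in> C}"
      using f(2) H(3) hf by (auto simp: image_iff) (metis imageE)
    ultimately show "closedin (gtop H) {q \<in> topspace (gtop H). h q \<in> C}" by simp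
  qed
  ultimately show ?thesis using that hf cont_homI by blast
qed

text \<open>Every preimage is a union of cosets of the open kernel.\<close>

lemma cont_hom_discrete:
  assumes g: "group_hom G A g" and A: "gtop A = discrete_topology (carrier A)"
    and op: "openin T (kernel G A g)"
  shows "g \<in> cont_hom G A"
proof (rule cont_homI)
  interpret g: group_hom G A g by (rule g)
  show "g \<in> hom G A" by (rule g.homh)
  show "continuous_map T (gtop A) g"
    unfolding continuous_map_def A
  proof (intro conjI allI impI)
    show "g \<in> topspace T \<rightarrow> topspace (discrete_topology (carrier A))" by auto
    fix V assume "openin (discrete_topology (carrier A)) V"
    have eq: "{x \<in> topspace T. g x \<in> V} = {x \<in> carrier G. g x \<in> V} <#> kernel G A g"
    proof (intro equalityI subsetI)
      fix x assume "x \<in> {x \<in> topspace T. g x \<in> V}"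
      then have x: "x \<in> {x \<in> carrier G. g x \<in> V}" "x \<in> carrier G" by auto
      have "\<one> \<in> kernel G A g" by (simp add: kernel_def)
      then have "x \<otimes> \<one> \<in> {x \<in> carrier G. g x \<in> V} <#> kernel G A g"
        unfolding set_mult_def using x(1) by blast
      then show "x \<in> {x \<in> carrier G. g x \<in> V} <#> kernel G A g" using x(2) by simp
    qed (auto simp: set_mult_def kernel_def)
    show "openin T {x \<in> topspace T. g x \<in> V}"
      unfolding eq by (rule openin_set_mult[OF op]) auto
  qed
qed

lemma finite_quotient_copy:
  assumes inf: "infinite (UNIV :: 'u set)" and N: "N \<lhd> G" "openin T N"
  obtains A :: "'u tgroup" and q where "group A" "finite (carrier A)"
    "gtop A = discrete_topology (carrier A)" "q \<in> cont_hom G A" "q ` carrier G = carrier A" "kernel G A q = N"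
proof -
  interpret pi: group_hom G "G Mod N" "\<lambda>x. N #> x" by (rule group_hom_r_coset[OF N(1)])
  obtain A :: "'u tgroup" and e where A: "group A" "finite (carrier A)"
    "gtop A = discrete_topology (carrier A)" "e \<in> iso (G Mod N) A"
    using finite_group_copy[OF inf pi.H.is_group finite_FactGroup[OF N]] by metis
  have e: "e \<in> hom (G Mod N) A" "bij_betw e (carrier (G Mod N)) (carrier A)" using A(4) unfolding iso_def by auto
  interpret e: group_hom "G Mod N" A e
    using e(1) A(1) pi.H.is_group by (simp add: group_hom_def group_hom_axioms_def)
  define q where "q = (\<lambda>x. e (N #> x))"
  have "q \<in> hom G A"
    unfolding q_def by (rule homI) (simp_all only: pi.hom_mult e.hom_mult pi.hom_closed e.hom_closed)
  then have q: "group_hom G A q" using A(1) by (simp add: group_hom_def group_hom_axioms_def is_group)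
  have "(\<lambda>x. N #> x) ` carrier G = carrier (G Mod N)" by (simp add: carrier_FactGroup)
  then have surj: "q ` carrier G = carrier A"
    unfolding q_def using e(2) unfolding bij_betw_def by (metis image_image)
  have Ns: "subgroup N G" using normal_imp_subgroup[OF N(1)] .
  have "x \<in> kernel G A q \<longleftrightarrow> x \<in> N" for x
  proof (cases "x \<in> carrier G")
    case True
    have "q x = \<one>\<^bsub>A\<^esub> \<longleftrightarrow> N #> x = \<one>\<^bsub>G Mod N\<^esub>"
      unfolding q_def using e(2) pi.hom_closed[OF True] e.hom_one pi.H.one_closed unfolding bij_betw_def
      by (metis inj_onD)
    also have "\<dots> \<longleftrightarrow> x \<in> N" using coset_join1[OF _ True Ns] coset_join2[OF True Ns] by auto
    finally show ?thesis using True by (simp add: kernel_def)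
  next
    case False
    then show ?thesis using subgroup.subset[OF Ns] by (auto simp: kernel_def)
  qed
  then have ker: "kernel G A q = N" by blast
  show ?thesis using that[OF A(1-3) cont_hom_discrete[OF q A(3)] surj ker] ker N(2) by simp
qed

text \<open>Were d nontrivial in the kernel \<open>D\<close>, an open normal \<open>U\<close> would
  miss it. Projectivity lifts the map from \<open>P\<close> to the quotient of \<open>G\<close> by
  \<open>D <#> U\<close> to a map \<psi> into the quotient by \<open>U\<close>. The elements on
  which qA agrees with \<open>\<psi> \<circ> \<beta>\<close> form a closed supplement, hence all of
  \<open>G\<close> by minimality. So qA factors through \<beta> and kills d, that is, d lies in
  \<open>U\<close>.\<close>

lemma projective_minimal_cover:
  fixes P :: "'u tgroup"
  assumes inf: "infinite (UNIV :: 'u set)" and proj: "projective_group P"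
    and \<beta>: "\<beta> \<in> cont_hom G P" "\<beta> ` carrier G = carrier P"
    and minimal: "\<And>S. closed_subgroup S G \<Longrightarrow> \<beta> ` S = carrier P \<Longrightarrow> S = carrier G"
    and d: "d \<in> carrier G" "\<beta> d = \<one>\<^bsub>P\<^esub>"
  shows "d = \<one>"
proof (rule ccontr)
  interpret P: profinite P using proj profiniteI unfolding projective_group_def by blast
  interpret \<beta>: group_hom G P \<beta> using cont_hom_group_hom[OF \<beta>(1) is_group P.is_group] .
  assume "d \<noteq> \<one>"
  obtain U where U: "U \<lhd> G" "openin T U" "d \<notin> U"
    using open_normal_separate[of "carrier G" d] d(1) \<open>d \<noteq> \<one>\<close> by auto
  define D where "D = kernel G P \<beta>"
  have D: "D \<lhd> G" unfolding D_def by (rule \<beta>.normal_kernel)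
  define W where "W = D <#> U"
  have W: "W \<lhd> G" unfolding W_def using normal_subgroup_set_mult_closed[OF D U(1)] .
  have Us: "subgroup U G" and Ds: "subgroup D G" and Ws: "subgroup W G"
    using normal_imp_subgroup U(1) D W by auto
  have UW: "U \<subseteq> W" and DW: "D \<subseteq> W" unfolding W_def using subset_set_mult[OF Ds Us] by auto
  have oW: "openin T W" using openin_subgroup[OF Ws U(2) subgroup.one_closed[OF Us] UW] .
  obtain A :: "'u tgroup" and qA where A: "group A" "finite (carrier A)" "gtop A = discrete_topology (carrier A)"
    and cA: "qA \<in> cont_hom G A" and qA: "qA ` carrier G = carrier A" "kernel G A qA = U"
    using finite_quotient_copy[OF inf U(1,2)] by metis
  obtain B :: "'u tgroup" and qB where B: "group B" "finite (carrier B)" "gtop B = discrete_topology (carrier B)"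
    and cB: "qB \<in> cont_hom G B" and qB: "qB ` carrier G = carrier B" "kernel G B qB = W"
    using finite_quotient_copy[OF inf W oW] by metis
  interpret A: group A by (rule A(1))
  interpret qA: group_hom G A qA using cont_hom_group_hom[OF cA is_group A(1)] .
  interpret qB: group_hom G B qB using cont_hom_group_hom[OF cB is_group B(1)] .
  obtain \<pi> where \<pi>: "\<pi> \<in> cont_hom A B" "\<And>x. x \<in> carrier G \<Longrightarrow> \<pi> (qA x) = qB x"
    using cont_hom_factor[OF cA qA(1) A(1) _ _ cB B(1)] A(3) qA(2) qB(2) UW by auto
  obtain \<phi> where \<phi>: "\<phi> \<in> cont_hom P B" "\<And>x. x \<in> carrier G \<Longrightarrow> \<phi> (\<beta> x) = qB x"
    using cont_hom_factor[OF \<beta> P.is_group P.Hausdorff _ cB B(1)] DW qB(2) unfolding D_def by auto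
  have "\<pi> ` carrier A = carrier B"
  proof -
    have "\<pi> ` carrier A = (\<lambda>x. \<pi> (qA x)) ` carrier G" using qA(1) by (metis image_image)
    also have "\<dots> = qB ` carrier G" using \<pi>(2) by (rule image_cong[OF refl])
    finally show ?thesis using qB(1) by simp
  qed
  then have \<pi>epi: "\<pi> \<in> epi A B" using cont_homD(1)[OF \<pi>(1)] unfolding epi_def by simp
  have "\<phi> ` carrier P = carrier B"
  proof -
    have "\<phi> ` carrier P = (\<lambda>x. \<phi> (\<beta> x)) ` carrier G" using \<beta>(2) by (metis image_image)
    also have "\<dots> = qB ` carrier G" using \<phi>(2) by (rule image_cong[OF refl])
    finally show ?thesis using qB(1) by simp
  qed
  then have \<phi>epi: "\<phi> \<in> epi P B" using cont_homD(1)[OF \<phi>(1)] unfolding epi_def by simp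
  have "\<exists>\<psi>\<in>cont_hom P A. \<forall>g\<in>carrier P. \<pi> (\<psi> g) = \<phi> g"
    using proj[unfolded projective_group_def] A(1-3) B(1-3) \<pi>epi \<phi>(1) \<phi>epi by blast
  then obtain \<psi> where \<psi>: "\<psi> \<in> cont_hom P A" "\<And>g. g \<in> carrier P \<Longrightarrow> \<pi> (\<psi> g) = \<phi> g" by blast
  interpret \<psi>: group_hom P A \<psi> using cont_hom_group_hom[OF \<psi>(1) P.is_group A(1)] .
  define S' where "S' = {x \<in> carrier G. qA x = \<psi> (\<beta> x)}"
  have "subgroup S' G" unfolding S'_def by (rule subgroupI) (auto intro!: exI[of _ \<one>])
  moreover have "closedin T S'"
  proof -
    have "continuous_map T (gtop A) (\<lambda>x. \<psi> (\<beta> x))"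
      using continuous_map_compose[OF cont_homD(2)[OF \<beta>(1)] cont_homD(2)[OF \<psi>(1)]] by (simp add: o_def)
    then have "closedin T {x \<in> topspace T. qA x = \<psi> (\<beta> x)}"
      using closedin_continuous_maps_eq[OF _ cont_homD(2)[OF cA]] A(3) by simp
    then show ?thesis unfolding S'_def by simp
  qed
  ultimately have cS': "closed_subgroup S' G"
    unfolding closed_subgroup_def by simp
  have "q \<in> \<beta> ` S'" if q: "q \<in> carrier P" for q
  proof -
    have "q \<in> \<beta> ` carrier G" unfolding \<beta>(2) by (rule q)
    then obtain x where x: "x \<in> carrier G" "\<beta> x = q" by (metis imageE)
    obtain y where y: "y \<in> carrier G" "qA y = \<psi> q" using qA(1) \<psi>.hom_closed[OF q] by (metis imageE)
    have "qB y = qB x" using \<pi>(2)[OF y(1)] \<phi>(2)[OF x(1)] \<psi>(2)[OF q] x(2) y(2) by simp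
    then have "y \<otimes> inv x \<in> kernel G B qB"
      using x(1) y(1) by (simp add: kernel_def)
    then have "y \<otimes> inv x \<in> W" using qB(2) by simp
    \<comment> \<open>Surjectivity of \<beta> on \<open>S'\<close>: y has the right value under qA
      and x the right value under \<beta>. Dropping u from y leaves
      \<open>\<delta> \<otimes> x\<close>, which has both.\<close>
    then obtain \<delta> u where du: "\<delta> \<in> D" "u \<in> U" "y \<otimes> inv x = \<delta> \<otimes> u"
      unfolding W_def set_mult_def by auto
    have duG: "\<delta> \<in> carrier G" "u \<in> carrier G"
      using du subgroup.mem_carrier[OF Ds] subgroup.mem_carrier[OF Us] by auto
    have y_eq: "y = \<delta> \<otimes> u \<otimes> x"
      by (rule iffD1[OF inv_solve_right[OF m_closed[OF duG] y(1) x(1)] du(3)[symmetric]])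
    have "qA u = \<one>\<^bsub>A\<^esub>" using du(2) qA(2) by (auto simp: kernel_def)
    then have "qA y = qA (\<delta> \<otimes> x)"
      unfolding y_eq
      by (simp only: qA.hom_mult[OF m_closed[OF duG] x(1)] qA.hom_mult[OF duG] qA.hom_mult[OF duG(1) x(1)]
          A.r_one[OF qA.hom_closed[OF duG(1)]])
    moreover have "\<beta> (\<delta> \<otimes> x) = q"
      using \<beta>.hom_mult[OF duG(1) x(1)] du(1) x(2) q by (simp add: D_def kernel_def)
    ultimately have "\<delta> \<otimes> x \<in> S'"
      unfolding S'_def using y(2) m_closed[OF duG(1) x(1)] by simp
    then show ?thesis using \<open>\<beta> (\<delta> \<otimes> x) = q\<close> by (metis imageI)
  qed
  moreover have "\<beta> ` S' \<subseteq> carrier P" unfolding S'_def by auto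
  ultimately have "S' = carrier G" using minimal[OF cS'] by blast
  then have "d \<in> S'" using d(1) by simp
  then have "qA d = \<psi> \<one>\<^bsub>P\<^esub>" unfolding S'_def using d(2) by simp
  then have "d \<in> kernel G A qA" using d(1) by (simp add: kernel_def)
  then show False using qA(2) U(3) by simp
qed

text \<open>Weak solvability of finite embedding problems gives a section for an arbitrary profinite
  kernel: on a minimal closed supplement, which exists by compactness, \<beta> is injective, and its
  inverse is the section.\<close>

theorem projective_section:
  fixes P :: "'u tgroup"
  assumes inf: "infinite (UNIV :: 'u set)" and proj: "projective_group P"
    and \<beta>: "\<beta> \<in> cont_hom G P" "\<beta> ` carrier G = carrier P"
  obtains \<rho> where "\<rho> \<in> cont_hom P G" "\<And>q. q \<in> carrier P \<Longrightarrow> \<beta> (\<rho> q) = q"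
proof -
  interpret P: profinite P using proj profiniteI unfolding projective_group_def by blast
  define \<A> where "\<A> = {S. closed_subgroup S G \<and> \<beta> ` S = carrier P}"
  have "carrier G \<in> \<A>" unfolding \<A>_def using \<beta>(2) closed_subgroup_carrier by simp
  then have ne: "\<A> \<noteq> {}" by auto
  have chain: "\<Inter>\<C> \<in> \<A>" if \<C>: "\<C> \<noteq> {}" "subset.chain \<A> \<C>" for \<C>
  proof -
    have mem: "closed_subgroup S G" "\<beta> ` S = carrier P" if "S \<in> \<C>" for S
      using \<C>(2) that unfolding subset_chain_def \<A>_def by blast+
    show ?thesis
      using closed_supplement_Inter[OF cont_homD(2)[OF \<beta>(1)] P.profinite_axioms \<C> mem] unfolding \<A>_def by simp
  qed
  obtain S where S: "S \<in> \<A>" and Smin: "\<And>S'. S' \<in> \<A> \<Longrightarrow> S' \<subseteq> S \<Longrightarrow> S' = S"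
    using minimal_set_exists[OF ne chain] by metis
  have cS: "closed_subgroup S G" and bS: "\<beta> ` S = carrier P" using S unfolding \<A>_def by auto
  note s = closed_subgroupD[OF cS]
  let ?S = "tsub G S"
  interpret S: profinite ?S using profinite_tsub[OF cS] .
  have \<beta>S: "\<beta> \<in> cont_hom ?S P" "\<beta> ` carrier ?S = carrier P" using cont_hom_tsub[OF \<beta>(1) s(1)] bS by auto
  have triv: "d = \<one>" if d: "d \<in> S" "\<beta> d = \<one>\<^bsub>P\<^esub>" for d
  proof -
    have "S' = carrier ?S" if S': "closed_subgroup S' ?S" "\<beta> ` S' = carrier P" for S'
      using Smin[of S'] S' subgroup_tsub_iff[OF s(1)] s(2) unfolding \<A>_def closed_subgroup_def
      by (simp add: closedin_closed_subtopology)
    then show ?thesis using S.projective_minimal_cover[OF inf proj \<beta>S] d by simp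
  qed
  have incl: "(\<lambda>x. x) \<in> cont_hom ?S G"
    using s(3) by (intro cont_homI) (auto simp: hom_def continuous_map_from_subtopology)
  have "kernel ?S P \<beta> \<subseteq> kernel ?S G (\<lambda>x. x)" using triv by (auto simp: kernel_def)
  then obtain \<rho> where \<rho>: "\<rho> \<in> cont_hom P G" "\<And>x. x \<in> carrier ?S \<Longrightarrow> \<rho> (\<beta> x) = x"
    using S.cont_hom_factor[OF \<beta>S P.is_group P.Hausdorff _ incl is_group] by auto
  have "\<beta> (\<rho> q) = q" if "q \<in> carrier P" for q
  proof -
    have "q \<in> \<beta> ` carrier ?S" unfolding \<beta>S(2) by (rule that)
    then obtain x where "x \<in> carrier ?S" "\<beta> x = q" by (metis imageE)
    then show ?thesis using \<rho>(2) by auto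
  qed
  then show ?thesis using that \<rho>(1) by blast
qed

end

section \<open>Free products\<close>

lemma free_pro_productD:
  assumes "free_pro_product C L X A"
  shows "pro_C_group C L" "profinite_space X"
    "\<And>x. x \<in> topspace X \<Longrightarrow> closed_subgroup (A x) L"
    "\<And>U. subgroup U L \<Longrightarrow> openin (gtop L) U \<Longrightarrow> openin X {x \<in> topspace X. A x \<subseteq> U}"
    "\<And>x y. x \<in> topspace X \<Longrightarrow> y \<in> topspace X \<Longrightarrow> x \<noteq> y \<Longrightarrow> A x \<inter> A y = {\<one>\<^bsub>L\<^esub>}"
proof -
  note f = assms[unfolded free_pro_product_def]
  show "pro_C_group C L" by (rule f[THEN conjunct1])
  have c: "continuous_system L X A" by (rule f[THEN conjunct2, THEN conjunct1])
  show "profinite_space X" "\<And>x. x \<in> topspace X \<Longrightarrow> closed_subgroup (A x) L"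
    "\<And>U. subgroup U L \<Longrightarrow> openin (gtop L) U \<Longrightarrow> openin X {x \<in> topspace X. A x \<subseteq> U}"
    using c unfolding continuous_system_def by simp_all
  show "A x \<inter> A y = {\<one>\<^bsub>L\<^esub>}" if "x \<in> topspace X" "y \<in> topspace X" "x \<noteq> y" for x y
    using f[THEN conjunct2, THEN conjunct2, THEN conjunct1] that by simp
qed

lemma free_pro_product_universal:
  fixes K :: "'u tgroup"
  assumes "free_pro_product C L X A" "pro_C_group C K"
    "continuous_map (system_union L X A) (gtop K) f"
    "\<And>x. x \<in> topspace X \<Longrightarrow> f \<in> hom (tsub L (A x)) K"
  shows "\<exists>h \<in> cont_hom L K. (\<forall>x \<in> topspace X. \<forall>a \<in> A x. h a = f a) \<and>
    (\<forall>h' \<in> cont_hom L K. (\<forall>x \<in> topspace X. \<forall>a \<in> A x. h' a = f a) \<longrightarrow> (\<forall>g \<in> carrier L. h' g = h g))"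
  by (rule assms(1)[unfolded free_pro_product_def, THEN conjunct2, THEN conjunct2, THEN conjunct2, rule_format])
     (use assms(2-4) in simp)

lemma free_pro_product_ext:
  fixes K :: "'u tgroup"
  assumes "free_pro_product C L X A" "pro_C_group C K"
    "continuous_map (system_union L X A) (gtop K) f"
    "\<And>x. x \<in> topspace X \<Longrightarrow> f \<in> hom (tsub L (A x)) K"
  obtains h where "h \<in> cont_hom L K" "\<And>x a. x \<in> topspace X \<Longrightarrow> a \<in> A x \<Longrightarrow> h a = f a"
  using free_pro_product_universal[OF assms] that by blast

lemma cont_hom_restrict_union:
  assumes "h \<in> cont_hom L K"
  shows "continuous_map (system_union L X A) (gtop K) h"
  unfolding system_union_def using continuous_map_from_subtopology[OF cont_homD(2)[OF assms]] .

lemma cont_hom_restrict_sub: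
  assumes "h \<in> cont_hom L K" "H \<subseteq> carrier L"
  shows "h \<in> hom (tsub L H) K"
  using cont_homD(1)[OF assms(1)] assms(2) by (auto simp: hom_def Pi_iff)

lemma free_pro_product_unique:
  fixes K :: "'u tgroup"
  assumes L: "free_pro_product C L X A" and K: "pro_C_group C K"
    and h: "h \<in> cont_hom L K" "h' \<in> cont_hom L K"
    and eq: "\<And>x a. x \<in> topspace X \<Longrightarrow> a \<in> A x \<Longrightarrow> h' a = h a" and g: "g \<in> carrier L"
  shows "h' g = h g"
proof -
  have hom: "h \<in> hom (tsub L (A x)) K" if "x \<in> topspace X" for x
    using cont_hom_restrict_sub[OF h(1) closed_subgroupD(3)[OF free_pro_productD(3)[OF L that]]] .
  have "\<exists>k \<in> cont_hom L K. (\<forall>x \<in> topspace X. \<forall>a \<in> A x. k a = h a) \<and>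
      (\<forall>k' \<in> cont_hom L K. (\<forall>x \<in> topspace X. \<forall>a \<in> A x. k' a = h a) \<longrightarrow> (\<forall>g \<in> carrier L. k' g = k g))"
    using free_pro_product_universal[OF L K cont_hom_restrict_union[OF h(1)] hom] .
  then obtain k where k: "\<And>k' g. k' \<in> cont_hom L K \<Longrightarrow> (\<forall>x \<in> topspace X. \<forall>a \<in> A x. k' a = h a) \<Longrightarrow>
      g \<in> carrier L \<Longrightarrow> k' g = k g" by blast
  have "h' g = k g" "h g = k g" using k[of h' g] k[of h g] h eq g by auto
  then show ?thesis by simp
qed

lemma cont_hom_incl:
  assumes "H \<subseteq> carrier G" "topspace (gtop G) = carrier G"
  shows "(\<lambda>x. x) \<in> cont_hom (tsub G H) G"
  using assms by (intro cont_homI) (auto simp: hom_def continuous_map_from_subtopology)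

lemma cont_hom_into:
  assumes "f \<in> cont_hom K (tsub G H)" "H \<subseteq> carrier G"
  shows "f \<in> cont_hom K G"
  using assms by (auto simp: cont_hom_def hom_def continuous_map_in_subtopology)

lemma cont_hom_trans:
  assumes "f \<in> cont_hom G H" "g \<in> cont_hom H K"
  shows "(\<lambda>x. g (f x)) \<in> cont_hom G K"
  using assms continuous_map_compose[of "gtop G" "gtop H" f "gtop K" g]
  by (auto simp: cont_hom_def hom_def o_def Pi_iff)

text \<open>The identity on the factors extends to a homomorphism from \<open>L\<close> to
  \<open>H\<close>, for which \<open>H\<close> has to be an admissible target. Followed by the
  inclusion it is the identity of \<open>L\<close> by uniqueness, so nothing lies outside
  \<open>H\<close>.\<close>

lemma free_pro_product_generated:
  assumes L: "free_pro_product C L X A" and H: "closed_subgroup H L" and pro: "pro_C_group C (tsub L H)"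
    and sub: "\<And>x. x \<in> topspace X \<Longrightarrow> A x \<subseteq> H"
  shows "H = carrier L"
proof
  show HL: "H \<subseteq> carrier L" using closed_subgroupD(3)[OF H] .
  interpret L: profinite L using pro_C_profinite[OF free_pro_productD(1)[OF L]] .
  have id: "(\<lambda>x. x) \<in> cont_hom L L" by (intro cont_homI) (auto simp: hom_def)
  have "continuous_map (system_union L X A) (gtop (tsub L H)) (\<lambda>x. x)"
    using cont_hom_restrict_union[OF id, of X A] sub
    by (auto simp: continuous_map_in_subtopology system_union_def)
  moreover have "(\<lambda>x. x) \<in> hom (tsub L (A x)) (tsub L H)" if "x \<in> topspace X" for x
    using sub[OF that] by (auto simp: hom_def)
  ultimately obtain h where h: "h \<in> cont_hom L (tsub L H)" "\<And>x a. x \<in> topspace X \<Longrightarrow> a \<in> A x \<Longrightarrow> h a = a"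
    using free_pro_product_ext[OF L pro] by metis
  show "carrier L \<subseteq> H"
  proof
    fix g assume g: "g \<in> carrier L"
    have "h g = g"
      using free_pro_product_unique[OF L free_pro_productD(1)[OF L] id cont_hom_into[OF h(1) HL] _ g] h(2) by auto
    moreover have "h g \<in> H" using cont_homD(1)[OF h(1)] g by (auto simp: hom_def)
    ultimately show "g \<in> H" by simp
  qed
qed

lemma free_pro_product2D:
  assumes "free_pro_product2 C G H P"
  shows "pro_C_group C G" "closed_subgroup H G" "closed_subgroup P G" "H \<inter> P = {\<one>\<^bsub>G\<^esub>}"
proof -
  note f = free_pro_productD[OF assms[unfolded free_pro_product2_def]]
  show "pro_C_group C G" by (rule f(1))
  show "closed_subgroup H G" using f(3)[of True] by simp
  show "closed_subgroup P G" using f(3)[of False] by simp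
  show "H \<inter> P = {\<one>\<^bsub>G\<^esub>}" using f(5)[of True False] by simp
qed

text \<open>The factors are two closed sets meeting only in the neutral element, where both
  homomorphisms are trivial; so the two pieces paste to a continuous map on the union.\<close>

lemma free_pro_product2_ext:
  fixes K :: "'u tgroup"
  assumes G: "free_pro_product2 C G H P" and K: "pro_C_group C K"
    and f: "f1 \<in> cont_hom (tsub G H) K" "f2 \<in> cont_hom (tsub G P) K"
  obtains h where "h \<in> cont_hom G K" "\<And>a. a \<in> H \<Longrightarrow> h a = f1 a" "\<And>a. a \<in> P \<Longrightarrow> h a = f2 a"
proof -
  note g = free_pro_product2D[OF G]
  interpret profinite G using pro_C_profinite[OF g(1)] .
  interpret K: profinite K using pro_C_profinite[OF K] .
  note H = closed_subgroupD[OF g(2)] and P = closed_subgroupD[OF g(3)]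
  interpret f1: group_hom "tsub G H" K f1 using cont_hom_group_hom[OF f(1) group_tsub[OF H(1)] K.is_group] .
  interpret f2: group_hom "tsub G P" K f2 using cont_hom_group_hom[OF f(2) group_tsub[OF P(1)] K.is_group] .
  define f where "f = (\<lambda>a. if a \<in> H then f1 a else f2 a)"
  have fH: "f a = f1 a" if "a \<in> H" for a using that unfolding f_def by simp
  have fP: "f a = f2 a" if a: "a \<in> P" for a
  proof (cases "a \<in> H")
    case True
    then have "a = \<one>\<^bsub>G\<^esub>" using a g(4) by auto
    then show ?thesis using f1.hom_one f2.hom_one True unfolding f_def by simp
  qed (simp add: f_def)
  let ?X = "discrete_topology (UNIV :: bool set)" and ?A = "\<lambda>b. if b then H else P"
  have un: "(\<Union>x \<in> topspace ?X. ?A x) = H \<union> P" by (auto split: if_splits)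
  have top: "topspace (subtopology T (H \<union> P)) = H \<union> P" using H(3) P(3) by auto
  have "continuous_map (subtopology T (H \<union> P)) (gtop K) f"
    unfolding continuous_map_closedin top
  proof (intro conjI allI impI)
    show "f \<in> H \<union> P \<rightarrow> topspace (gtop K)" using fH fP f1.hom_closed f2.hom_closed by auto
    fix C assume C: "closedin (gtop K) C"
    have 1: "closedin T {x \<in> H. f1 x \<in> C}"
      using closedin_continuous_map_preimage[OF cont_homD(2)[OF f(1)] C] H(2,3)
      by (simp add: closedin_closed_subtopology Int_absorb1)
    have 2: "closedin T {x \<in> P. f2 x \<in> C}"
      using closedin_continuous_map_preimage[OF cont_homD(2)[OF f(2)] C] P(2,3)
      by (simp add: closedin_closed_subtopology Int_absorb1)
    have "{x \<in> H \<union> P. f x \<in> C} = {x \<in> H. f1 x \<in> C} \<union> {x \<in> P. f2 x \<in> C}" using fH fP by auto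
    then have "closedin T {x \<in> H \<union> P. f x \<in> C}" using closedin_Un[OF 1 2] by simp
    then show "closedin (subtopology T (H \<union> P)) {x \<in> H \<union> P. f x \<in> C}"
      by (auto intro: closedin_subset_topspace)
  qed
  then have c: "continuous_map (system_union G ?X ?A) (gtop K) f" unfolding system_union_def un .
  have "f \<in> hom (tsub G (?A b)) K" for b
    using f1.homh f2.homh fH fP subgroup.m_closed[OF H(1)] subgroup.m_closed[OF P(1)]
    by (cases b) (auto simp: hom_def)
  then obtain h where h: "h \<in> cont_hom G K" "\<And>b a. b \<in> topspace ?X \<Longrightarrow> a \<in> ?A b \<Longrightarrow> h a = f a"
    using free_pro_product_ext[OF G[unfolded free_pro_product2_def] K c] by metis
  have "h a = f1 a" if "a \<in> H" for a using h(2)[of True a] fH that by simp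
  moreover have "h a = f2 a" if "a \<in> P" for a using h(2)[of False a] fP that by simp
  ultimately show ?thesis using that h(1) by blast
qed

lemma free_pro_product2_unique:
  fixes K :: "'u tgroup"
  assumes G: "free_pro_product2 C G H P" and K: "pro_C_group C K"
    and h: "h \<in> cont_hom G K" "h' \<in> cont_hom G K"
    and eq: "\<And>a. a \<in> H \<Longrightarrow> h' a = h a" "\<And>a. a \<in> P \<Longrightarrow> h' a = h a" and g: "g \<in> carrier G"
  shows "h' g = h g"
  by (rule free_pro_product_unique[OF G[unfolded free_pro_product2_def] K h _ g])
     (use eq in \<open>auto split: if_splits\<close>)

lemma free_pro_product2_generated:
  assumes G: "free_pro_product2 C G H P" and M: "closed_subgroup M G" and pro: "pro_C_group C (tsub G M)"
    and sub: "H \<subseteq> M" "P \<subseteq> M"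
  shows "M = carrier G"
  by (rule free_pro_product_generated[OF G[unfolded free_pro_product2_def] M pro]) (use sub in auto)

text \<open>If g is not in \<open>A x\<close>, some open subgroup \<open>A x <#> U\<close> misses g.
  It contains \<open>A y\<close> for all y near x, and its complement is a neighbourhood of
  g.\<close>

lemma (in profinite) closedin_system:
  assumes A: "\<And>x. x \<in> topspace X \<Longrightarrow> closed_subgroup (A x) G"
    and cont: "\<And>U. subgroup U G \<Longrightarrow> openin T U \<Longrightarrow> openin X {x \<in> topspace X. A x \<subseteq> U}"
  shows "closedin (prod_topology X T) {z \<in> topspace X \<times> carrier G. snd z \<in> A (fst z)}"
proof -
  let ?E = "{z \<in> topspace X \<times> carrier G. snd z \<in> A (fst z)}"
  have "\<exists>W. openin (prod_topology X T) W \<and> z \<in> W \<and> W \<subseteq> topspace (prod_topology X T) - ?E"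
    if z: "z \<in> topspace (prod_topology X T) - ?E" for z
  proof -
    obtain x g where xg: "z = (x, g)" "x \<in> topspace X" "g \<in> carrier G" "g \<notin> A x" using z by (cases z) auto
    note a = closed_subgroupD[OF A[OF xg(2)]]
    have "openin T (carrier G - {g})" using openin_diff[OF openin_carrier closedin_singleton[OF xg(3)]] .
    then obtain U where U: "U \<lhd> G" "openin T U" "A x <#> U \<subseteq> carrier G - {g}"
      using open_normal_mult_nbhd[OF a(2), of "carrier G - {g}"] a(3) xg(4) by blast
    let ?H = "A x <#> U"
    have H: "subgroup ?H G" "openin T ?H"
      using set_mult_subgroup(1)[OF a(1) U(1)] openin_set_mult[OF U(2) a(3)] by auto
    have "closedin T ?H" using closedin_open_subgroup[OF H] .
    then have "openin (prod_topology X T) ({y \<in> topspace X. A y \<subseteq> ?H} \<times> (carrier G - ?H))"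
      using cont[OF H] by (simp add: openin_prod_Times_iff openin_diff)
    moreover have "A x \<subseteq> ?H" using subset_set_mult(1)[OF a(1) normal_imp_subgroup[OF U(1)]] .
    then have "z \<in> {y \<in> topspace X. A y \<subseteq> ?H} \<times> (carrier G - ?H)" using xg U(3) by auto
    moreover have "{y \<in> topspace X. A y \<subseteq> ?H} \<times> (carrier G - ?H) \<subseteq> topspace (prod_topology X T) - ?E" by auto
    ultimately show ?thesis by blast
  qed
  then have "openin (prod_topology X T) (topspace (prod_topology X T) - ?E)"
    by (subst openin_subopen) blast
  moreover have "?E \<subseteq> topspace (prod_topology X T)" by auto
  ultimately show ?thesis unfolding closedin_def by blast
qed

text \<open>The members of a continuous system meet in \<open>\<one>\<close>, where the index is not determined by the
  element; the closed graph replaces an argument by cases.\<close>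

lemma (in profinite) continuous_map_conj_system:
  assumes X: "compact_space X" and A: "\<And>x. x \<in> topspace X \<Longrightarrow> closed_subgroup (A x) G"
    and cont: "\<And>U. subgroup U G \<Longrightarrow> openin T U \<Longrightarrow> openin X {x \<in> topspace X. A x \<subseteq> U}"
    and disj: "\<And>x y. x \<in> topspace X \<Longrightarrow> y \<in> topspace X \<Longrightarrow> x \<noteq> y \<Longrightarrow> A x \<inter> A y = {\<one>}"
    and \<nu>: "continuous_map X T \<nu>"
  obtains \<phi> where "continuous_map (subtopology T (\<Union>x \<in> topspace X. A x)) T \<phi>"
    "\<And>x a. x \<in> topspace X \<Longrightarrow> a \<in> A x \<Longrightarrow> \<phi> a = \<nu> x \<otimes> a \<otimes> inv (\<nu> x)"
proof -
  let ?U = "\<Union>x \<in> topspace X. A x" and ?XT = "prod_topology X T" and ?TT = "prod_topology T T"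
  let ?E = "{z \<in> topspace X \<times> carrier G. snd z \<in> A (fst z)}"
  let ?F = "\<lambda>z. (snd z, \<nu> (fst z) \<otimes> snd z \<otimes> inv (\<nu> (fst z)))"
  have UG: "?U \<subseteq> carrier G" using A closed_subgroupD(3) by blast
  have \<nu>G: "\<nu> x \<in> carrier G" if "x \<in> topspace X" for x
    using continuous_map_image_subset_topspace[OF \<nu>] that by auto
  define \<phi> where "\<phi> = (\<lambda>a. let x = (SOME x. x \<in> topspace X \<and> a \<in> A x) in \<nu> x \<otimes> a \<otimes> inv (\<nu> x))"
  have \<phi>: "\<phi> a = \<nu> x \<otimes> a \<otimes> inv (\<nu> x)" if xa: "x \<in> topspace X" "a \<in> A x" for x a
  proof -
    define y where "y = (SOME x. x \<in> topspace X \<and> a \<in> A x)"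
    have y: "y \<in> topspace X \<and> a \<in> A y" unfolding y_def by (rule someI[of _ x]) (use xa in simp)
    have \<phi>y: "\<phi> a = \<nu> y \<otimes> a \<otimes> inv (\<nu> y)" unfolding \<phi>_def y_def Let_def ..
    show ?thesis
    proof (cases "y = x")
      case False
      then have "a = \<one>" using disj[of y x] y xa by blast
      then show ?thesis using \<phi>y \<nu>G y xa(1) by simp
    qed (use \<phi>y in simp)
  qed
  have "compact_space ?XT" using X compact by (simp add: compact_space_prod_topology)
  then have cE: "compactin ?XT ?E" using closedin_compact_space closedin_system[OF A cont] by blast
  have "continuous_map ?XT T (\<lambda>z. \<nu> (fst z))"
    using continuous_map_compose[OF continuous_map_fst \<nu>] by (simp add: o_def)
  then have "continuous_map ?XT ?TT ?F"
    by (intro continuous_map_pairedI continuous_map_mult continuous_map_inv continuous_map_snd)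
  then have "compactin ?TT (?F ` ?E)" using image_compactin[OF cE] by blast
  then have cl: "closedin ?TT (?F ` ?E)"
    by (intro compactin_imp_closedin) (simp_all add: Hausdorff_space_prod_topology Hausdorff)
  \<comment> \<open>\<open>?F\<close> forgets the index and maps the compact incidence relation onto
    the graph of \<phi>, which is therefore closed.\<close>
  have eq: "?F ` ?E = (\<lambda>a. (a, \<phi> a)) ` ?U"
  proof (intro equalityI subsetI)
    fix w assume "w \<in> ?F ` ?E"
    then obtain x a where "x \<in> topspace X" "a \<in> A x" "w = (a, \<nu> x \<otimes> a \<otimes> inv (\<nu> x))" by auto
    then show "w \<in> (\<lambda>a. (a, \<phi> a)) ` ?U" using \<phi> by auto
  next
    fix w assume "w \<in> (\<lambda>a. (a, \<phi> a)) ` ?U"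
    then obtain x a where xa: "x \<in> topspace X" "a \<in> A x" "w = (a, \<phi> a)" by auto
    then have "w = ?F (x, a)" "(x, a) \<in> ?E" using \<phi> UG by auto
    then show "w \<in> ?F ` ?E" by blast
  qed
  have "continuous_map (subtopology T ?U) T \<phi>"
  proof (rule continuous_map_of_closed_graph[OF compact])
    have "closedin (subtopology ?TT (?U \<times> carrier G)) ((\<lambda>a. (a, \<phi> a)) ` ?U)"
    proof (rule closedin_subset_topspace)
      show "closedin ?TT ((\<lambda>a. (a, \<phi> a)) ` ?U)" using cl eq by simp
      show "(\<lambda>a. (a, \<phi> a)) ` ?U \<subseteq> ?U \<times> carrier G" using \<phi> \<nu>G UG by auto
    qed
    moreover have "prod_topology (subtopology T ?U) T = subtopology ?TT (?U \<times> carrier G)"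
      using prod_topology_subtopology(1)[of T ?U T] by simp
    moreover have "topspace (subtopology T ?U) = ?U" using UG by auto
    ultimately show "closedin (prod_topology (subtopology T ?U) T) ((\<lambda>z. (z, \<phi> z)) ` topspace (subtopology T ?U))"
      by simp
  qed (use \<phi> \<nu>G UG in auto)
  then show ?thesis using that \<phi> by blast
qed

lemma top_isoD:
  assumes "\<eta> \<in> top_iso G H"
  shows "\<eta> \<in> cont_hom G H" "\<eta> ` carrier G = carrier H" "inj_on \<eta> (carrier G)"
  using assms homeomorphic_imp_continuous_map[of "gtop G" "gtop H" \<eta>]
  unfolding top_iso_def cont_hom_def iso_def bij_betw_def by auto

lemma (in profinite) closed_subgroup_tsub_iff:
  assumes "closed_subgroup H G"
  shows "closed_subgroup K (tsub G H) \<longleftrightarrow> closed_subgroup K G \<and> K \<subseteq> H"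
  using subgroup_tsub_iff[OF closed_subgroupD(1)[OF assms]] closedin_closed_subtopology[of T H K] closed_subgroupD(2)[OF assms]
  unfolding closed_subgroup_def by auto

lemma (in profinite) closed_subgroup_vimage:
  assumes \<alpha>: "\<alpha> \<in> cont_hom G Q" and Q: "profinite Q" and M: "closed_subgroup M Q"
  shows "closed_subgroup {x \<in> carrier G. \<alpha> x \<in> M} G"
proof -
  interpret Q: profinite Q by (rule Q)
  interpret \<alpha>: group_hom G Q \<alpha> using cont_hom_group_hom[OF \<alpha> is_group Q.is_group] .
  note m = closed_subgroupD[OF M]
  have "subgroup {x \<in> carrier G. \<alpha> x \<in> M} G" by (rule \<alpha>.subgroup_vimage[OF m(1)])
  then show ?thesis
    using closedin_continuous_map_preimage[OF cont_homD(2)[OF \<alpha>] m(2)] unfolding closed_subgroup_def by simp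
qed

lemma (in profinite) closed_subgroup_img:
  assumes \<alpha>: "\<alpha> \<in> cont_hom G Q" and Q: "profinite Q"
  shows "closed_subgroup (\<alpha> ` carrier G) Q"
proof -
  interpret Q: profinite Q by (rule Q)
  interpret \<alpha>: group_hom G Q \<alpha> using cont_hom_group_hom[OF \<alpha> is_group Q.is_group] .
  show ?thesis
    using \<alpha>.img_is_subgroup closed_image[OF cont_homD(2)[OF \<alpha>] Q.Hausdorff closedin_carrier]
    unfolding closed_subgroup_def by simp
qed

section \<open>The retraction\<close>

theorem corollary1p7:
  fixes p :: nat
    and G Gs :: "'u tgroup"
    and X :: "'x topology"
    and A B :: "'x \<Rightarrow> 'u set"
    and L P Ls Ps :: "'u set"
    and \<theta> \<eta> :: "'u \<Rightarrow> 'u"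
  assumes universe: "infinite (UNIV :: 'u set)"
    and p: "prime p"
    and G: "free_pro_product2 finite_grp G L P"
    and L: "free_pro_product finite_grp (tsub G L) X A"
    and Gs: "free_pro_product2 finite_soluble_grp Gs Ls Ps"
    and Ls: "free_pro_product finite_soluble_grp (tsub Gs Ls) X B"
    and pro_p: "\<And>x. x \<in> topspace X \<Longrightarrow> pro_C_group (finite_p_grp p) (tsub G (A x))"
    and prosoluble: "pro_C_group finite_soluble_grp (tsub G P)"
    and projective: "projective_group (tsub G P)"
    and \<theta>: "system_iso X (tsub G L) A (tsub Gs Ls) B \<theta>"
    and \<eta>: "\<eta> \<in> top_iso (tsub G P) (tsub Gs Ps)"
  shows "(\<exists>\<alpha>. natural_hom G Gs X A \<theta> P \<eta> \<alpha>) \<and>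
         (\<forall>\<alpha>. natural_hom G Gs X A \<theta> P \<eta> \<alpha> \<longrightarrow>
            \<alpha> \<in> epi G Gs \<and>
            (\<exists>r \<in> cont_hom Gs G.
               (\<forall>h \<in> carrier Gs. \<alpha> (r h) = h) \<and>
               (\<forall>x \<in> topspace X. \<exists>g \<in> carrier G.
                  r ` B x = (\<lambda>a. g \<otimes>\<^bsub>G\<^esub> a \<otimes>\<^bsub>G\<^esub> inv\<^bsub>G\<^esub> g) ` A x)))"
proof (intro conjI allI impI)
  let ?L = "tsub G L" and ?P = "tsub G P" and ?Ls = "tsub Gs Ls" and ?Ps = "tsub Gs Ps"
  note g = free_pro_product2D[OF G] and gs = free_pro_product2D[OF Gs]
  interpret G: profinite G using pro_C_profinite[OF g(1)] .
  interpret Gs: profinite Gs using pro_C_profinite[OF gs(1)] .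
  note l = closed_subgroupD[OF g(2)] and pp = closed_subgroupD[OF g(3)]
  note ls = closed_subgroupD[OF gs(2)] and ps = closed_subgroupD[OF gs(3)]
  interpret L: profinite ?L using G.profinite_tsub[OF g(2)] .
  interpret P: profinite ?P using G.profinite_tsub[OF g(3)] .
  interpret Ls: profinite ?Ls using Gs.profinite_tsub[OF gs(2)] .
  interpret Ps: profinite ?Ps using Gs.profinite_tsub[OF gs(3)] .
  have A: "closed_subgroup (A x) G" "A x \<subseteq> L" if "x \<in> topspace X" for x
    using free_pro_productD(3)[OF L that] G.closed_subgroup_tsub_iff[OF g(2)] by auto
  have B: "closed_subgroup (B x) Gs" "B x \<subseteq> Ls" if "x \<in> topspace X" for x
    using free_pro_productD(3)[OF Ls that] Gs.closed_subgroup_tsub_iff[OF gs(2)] by auto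
  have X: "profinite_space X" using free_pro_productD(2)[OF L] .
  \<comment> \<open>The system is continuous with respect to open subgroups of \<open>L\<close>;
    every open subgroup of \<open>G\<close> is replaced by its trace on \<open>L\<close>.\<close>
  have cont: "openin X {x \<in> topspace X. A x \<subseteq> U}" if U: "subgroup U G" "openin (gtop G) U" for U
  proof -
    have "subgroup (U \<inter> L) ?L"
      using G.subgroup_tsub_iff[OF l(1)] G.subgroups_Inter_pair[OF U(1) l(1)] by auto
    moreover have "openin (gtop ?L) (U \<inter> L)" using U(2) by (auto simp: openin_subtopology)
    ultimately have "openin X {x \<in> topspace X. A x \<subseteq> U \<inter> L}" using free_pro_productD(4)[OF L] by blast
    moreover have "{x \<in> topspace X. A x \<subseteq> U \<inter> L} = {x \<in> topspace X. A x \<subseteq> U}" using A(2) by auto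
    ultimately show ?thesis by simp
  qed
  have \<theta>x: "\<theta> \<in> top_iso (tsub G (A x)) (tsub Gs (B x))" if "x \<in> topspace X" for x
    using \<theta> that A(2)[OF that] B(2)[OF that] unfolding system_iso_def by (auto simp: tsub_tsub)
  note eta = top_isoD[OF \<eta>]
  have \<theta>img: "\<theta> ` A x = B x" if "x \<in> topspace X" for x using top_isoD(2)[OF \<theta>x[OF that]] by simp
  have homeo: "homeomorphic_map (system_union ?L X A) (system_union ?Ls X B) \<theta>"
    using \<theta> unfolding system_iso_def by simp
  have \<eta>Gs: "\<eta> \<in> cont_hom ?P Gs" using cont_hom_into[OF eta(1) ps(3)] .

  \<comment> \<open>Existence of the natural homomorphism\<close>
  show "\<exists>\<alpha>. natural_hom G Gs X A \<theta> P \<eta> \<alpha>"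
  proof -
    \<comment> \<open>Only the profiniteness of \<open>?Ls\<close> and \<open>Gs\<close> matters
      here: it makes them admissible targets for the profinite products.\<close>
    have "continuous_map (system_union ?L X A) (gtop ?Ls) \<theta>"
      using homeomorphic_imp_continuous_map[OF homeo]
      by (auto simp: system_union_def continuous_map_in_subtopology)
    moreover have "\<theta> \<in> hom (tsub ?L (A x)) ?Ls" if "x \<in> topspace X" for x
      using cont_homD(1)[OF top_isoD(1)[OF \<theta>x[OF that]]] B(2)[OF that] by (auto simp: hom_def)
    ultimately obtain \<kappa> where \<kappa>: "\<kappa> \<in> cont_hom ?L ?Ls"
      "\<And>x a. x \<in> topspace X \<Longrightarrow> a \<in> A x \<Longrightarrow> \<kappa> a = \<theta> a"
      using free_pro_product_ext[OF L, of ?Ls \<theta>] Ls.prof by (auto simp: pro_finite_grp_iff)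
    obtain \<alpha> where \<alpha>: "\<alpha> \<in> cont_hom G Gs" "\<And>a. a \<in> L \<Longrightarrow> \<alpha> a = \<kappa> a" "\<And>a. a \<in> P \<Longrightarrow> \<alpha> a = \<eta> a"
      using free_pro_product2_ext[OF G _ cont_hom_into[OF \<kappa>(1) ls(3)] \<eta>Gs] Gs.prof by (auto simp: pro_finite_grp_iff)
    then have "natural_hom G Gs X A \<theta> P \<eta> \<alpha>"
      unfolding natural_hom_def using \<kappa>(2) A(2) by (metis subsetD)
    then show ?thesis by blast
  qed

  fix \<alpha> assume "natural_hom G Gs X A \<theta> P \<eta> \<alpha>"
  then have \<alpha>: "\<alpha> \<in> cont_hom G Gs" and \<alpha>A: "\<And>x a. x \<in> topspace X \<Longrightarrow> a \<in> A x \<Longrightarrow> \<alpha> a = \<theta> a"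
    and \<alpha>P: "\<And>a. a \<in> P \<Longrightarrow> \<alpha> a = \<eta> a"
    unfolding natural_hom_def by auto
  interpret \<alpha>: group_hom G Gs \<alpha> using cont_hom_group_hom[OF \<alpha> G.is_group Gs.is_group] .
  have surj: "\<alpha> ` carrier G = carrier Gs"
  proof -
    define M where "M = \<alpha> ` carrier G"
    have M: "closed_subgroup M Gs" unfolding M_def using G.closed_subgroup_img[OF \<alpha> Gs.profinite_axioms] .
    have "closed_subgroup (M \<inter> Ls) Gs" using Gs.closed_subgroup_Inter[of "{M, Ls}"] M gs(2) by auto
    then have cML: "closed_subgroup (M \<inter> Ls) ?Ls" using Gs.closed_subgroup_tsub_iff[OF gs(2)] by auto
    \<comment> \<open>Closed subgroups of prosoluble groups are prosoluble, so the generation lemma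
      applies at both levels: inside \<open>Ls\<close> to the factors \<open>B x\<close>, and inside
      \<open>Gs\<close> to \<open>Ls\<close> and \<open>Ps\<close>.\<close>
    have "M \<inter> Ls = carrier ?Ls"
    proof (rule free_pro_product_generated[OF Ls cML])
      show "pro_C_group finite_soluble_grp (tsub ?Ls (M \<inter> Ls))"
        using pro_finite_soluble_tsub[OF free_pro_productD(1)[OF Ls] cML] .
      fix x assume x: "x \<in> topspace X"
      have "B x = \<alpha> ` A x" using \<theta>img[OF x] \<alpha>A[OF x] by auto
      then show "B x \<subseteq> M \<inter> Ls" unfolding M_def using B(2)[OF x] closed_subgroupD(3)[OF A(1)[OF x]] by auto
    qed
    then have "Ls \<subseteq> M" by auto
    moreover have "Ps \<subseteq> M"
    proof -
      have "Ps = \<alpha> ` P" using eta(2) \<alpha>P by auto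
      then show ?thesis unfolding M_def using pp(3) by auto
    qed
    ultimately show ?thesis
      using free_pro_product2_generated[OF Gs M pro_finite_soluble_tsub[OF gs(1) M]] unfolding M_def by simp
  qed
  then show "\<alpha> \<in> epi G Gs" unfolding epi_def using \<alpha>.homh by simp

  obtain S where S: "closed_subgroup S G" "\<alpha> ` S = carrier Gs" "G.p_absorbing p S"
    "pro_C_group finite_soluble_grp (tsub G S)"
    using G.prosoluble_supplement[OF p gs(1) \<alpha> surj] by metis
  note s = closed_subgroupD[OF S(1)]
  let ?S = "tsub G S"
  interpret S: profinite ?S using G.profinite_tsub[OF S(1)] .
  have \<alpha>S: "\<alpha> \<in> cont_hom ?S Gs" using G.cont_hom_tsub[OF \<alpha> s(1)] .
  define K where "K = kernel G Gs \<alpha>"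
  have K: "K \<lhd> G" unfolding K_def by (rule \<alpha>.normal_kernel)
  have cK: "closedin (gtop G) K"
  proof -
    have "closedin (gtop G) {x \<in> topspace (gtop G). \<alpha> x \<in> {\<one>\<^bsub>Gs\<^esub>}}"
      using closedin_continuous_map_preimage[OF cont_homD(2)[OF \<alpha>] Gs.closedin_singleton] by blast
    then show ?thesis unfolding K_def kernel_def by simp
  qed
  have SK: "carrier G \<subseteq> S <#>\<^bsub>G\<^esub> K"
  proof
    fix x assume x: "x \<in> carrier G"
    then have "\<alpha> x \<in> \<alpha> ` S" using S(2) by simp
    then obtain t where t: "t \<in> S" "\<alpha> x = \<alpha> t" by auto
    have tG: "t \<in> carrier G" using t s(3) by auto
    have "inv\<^bsub>G\<^esub> t \<otimes>\<^bsub>G\<^esub> x \<in> K" unfolding K_def kernel_def using x tG t(2) by simp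
    moreover have "x = t \<otimes>\<^bsub>G\<^esub> (inv\<^bsub>G\<^esub> t \<otimes>\<^bsub>G\<^esub> x)" using x tG by (simp add: G.cancel_inv)
    ultimately show "x \<in> S <#>\<^bsub>G\<^esub> K" unfolding set_mult_def using t(1) by blast
  qed
  obtain \<nu> where \<nu>: "continuous_map X (gtop G) \<nu>" "\<And>x. x \<in> topspace X \<Longrightarrow> \<nu> x \<in> K"
    "\<And>x a. x \<in> topspace X \<Longrightarrow> a \<in> A x \<Longrightarrow> \<nu> x \<otimes>\<^bsub>G\<^esub> a \<otimes>\<^bsub>G\<^esub> inv\<^bsub>G\<^esub> (\<nu> x) \<in> S"
  proof (rule G.continuous_conjugators[OF X K cK S(1,3), of A])
    fix x assume x: "x \<in> topspace X"
    show "subgroup (A x) G" using closed_subgroupD(1)[OF A(1)[OF x]] .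
    show "pro_p_set p G (A x)" using G.pro_p_setI[OF A(1)[OF x] pro_p[OF x]] .
    show "A x \<subseteq> S <#>\<^bsub>G\<^esub> K" using closed_subgroupD(3)[OF A(1)[OF x]] SK by auto
  qed (use cont that in auto)
  have \<nu>G: "\<nu> x \<in> carrier G" and \<nu>1: "\<alpha> (\<nu> x) = \<one>\<^bsub>Gs\<^esub>" if "x \<in> topspace X" for x
    using \<nu>(2)[OF that] unfolding K_def kernel_def by auto

  \<comment> \<open>The homomorphism on the factor \<open>Ls\<close>\<close>
  let ?UA = "\<Union>x \<in> topspace X. A x" and ?UB = "\<Union>x \<in> topspace X. B x"
  have suA: "system_union ?L X A = subtopology (gtop G) ?UA"
    unfolding system_union_def using A(2) by (simp add: subtopology_subtopology Int_absorb1 UN_least)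
  have suB: "system_union ?Ls X B = subtopology (gtop Gs) ?UB"
    unfolding system_union_def using B(2) by (simp add: subtopology_subtopology Int_absorb1 UN_least)
  have UA: "?UA \<subseteq> carrier G" and UB: "?UB \<subseteq> carrier Gs" using A(1) B(1) closed_subgroupD(3) by blast+
  let ?c = "\<lambda>x a. \<nu> x \<otimes>\<^bsub>G\<^esub> a \<otimes>\<^bsub>G\<^esub> inv\<^bsub>G\<^esub> (\<nu> x)"
  have disj: "A x \<inter> A y = {\<one>\<^bsub>G\<^esub>}" if "x \<in> topspace X" "y \<in> topspace X" "x \<noteq> y" for x y
    using free_pro_productD(5)[OF L that] by simp
  obtain \<phi> where \<phi>c: "continuous_map (subtopology (gtop G) ?UA) (gtop G) \<phi>"
    and \<phi>: "\<And>x a. x \<in> topspace X \<Longrightarrow> a \<in> A x \<Longrightarrow> \<phi> a = ?c x a"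
    using G.continuous_map_conj_system[OF _ A(1) cont disj \<nu>(1)] X unfolding profinite_space_def by blast
  obtain \<theta>' where \<theta>': "homeomorphic_maps (subtopology (gtop G) ?UA) (subtopology (gtop Gs) ?UB) \<theta> \<theta>'"
    using homeo unfolding suA suB homeomorphic_map_maps by blast
  have \<theta>'c: "continuous_map (subtopology (gtop Gs) ?UB) (subtopology (gtop G) ?UA) \<theta>'"
    using \<theta>' unfolding homeomorphic_maps_def by simp
  have \<theta>'\<theta>: "\<theta>' (\<theta> a) = a" if "x \<in> topspace X" "a \<in> A x" for x a
    using \<theta>' that UA unfolding homeomorphic_maps_def by auto
  \<comment> \<open>Going back along \<theta> and conjugating by \<nu>. Since \<nu> takes values in
    the kernel of \<alpha>, applying \<alpha> to the result returns b.\<close>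
  define f where "f = (\<lambda>b. \<phi> (\<theta>' b))"
  have f: "f (\<theta> a) = ?c x a" if "x \<in> topspace X" "a \<in> A x" for x a
    unfolding f_def using \<theta>'\<theta>[OF that] \<phi>[OF that] by simp
  have fB: "f b \<in> S" "\<alpha> (f b) = b" if xb: "x \<in> topspace X" "b \<in> B x" for x b
  proof -
    obtain a where a: "a \<in> A x" "b = \<theta> a" using \<theta>img[OF xb(1)] xb(2) by blast
    have aG: "a \<in> carrier G" using a closed_subgroupD(3)[OF A(1)[OF xb(1)]] by auto
    show "f b \<in> S" using f[OF xb(1) a(1)] \<nu>(3)[OF xb(1) a(1)] a(2) by simp
    have "\<alpha> (f b) = \<alpha> a" using f[OF xb(1) a(1)] a(2) \<nu>1[OF xb(1)] \<nu>G[OF xb(1)] aG by simp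
    then show "\<alpha> (f b) = b" using \<alpha>A[OF xb(1) a(1)] a(2) by simp
  qed
  have fc: "continuous_map (system_union ?Ls X B) (gtop ?S) f"
  proof -
    have "continuous_map (subtopology (gtop Gs) ?UB) (gtop G) f"
      unfolding f_def using continuous_map_compose[OF \<theta>'c \<phi>c] by (simp add: o_def)
    then show ?thesis unfolding suB using fB(1) UB by (auto simp: continuous_map_in_subtopology)
  qed
  have fhom: "f \<in> hom (tsub ?Ls (B x)) ?S" if x: "x \<in> topspace X" for x
  proof (rule homI)
    fix b assume "b \<in> carrier (tsub ?Ls (B x))"
    then show "f b \<in> carrier ?S" using fB(1)[OF x] by simp
  next
    fix b b' assume "b \<in> carrier (tsub ?Ls (B x))" "b' \<in> carrier (tsub ?Ls (B x))"
    then have "b \<in> \<theta> ` A x" "b' \<in> \<theta> ` A x" using \<theta>img[OF x] by auto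
    then obtain a a' where a: "a \<in> A x" "b = \<theta> a" "a' \<in> A x" "b' = \<theta> a'" by blast
    have aG: "a \<in> carrier G" "a' \<in> carrier G" using a closed_subgroupD(3)[OF A(1)[OF x]] by auto
    have aa: "a \<otimes>\<^bsub>G\<^esub> a' \<in> A x" using a closed_subgroupD(1)[OF A(1)[OF x]] by (simp add: subgroup.m_closed)
    have "\<theta> (a \<otimes>\<^bsub>G\<^esub> a') = b \<otimes>\<^bsub>Gs\<^esub> b'"
      using cont_homD(1)[OF top_isoD(1)[OF \<theta>x[OF x]]] a unfolding hom_def by simp
    then show "f (b \<otimes>\<^bsub>tsub ?Ls (B x)\<^esub> b') = f b \<otimes>\<^bsub>?S\<^esub> f b'"
      using f[OF x aa] f[OF x a(1)] f[OF x a(3)] a(2,4) aG \<nu>G[OF x]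
      by (simp add: G.m_assoc G.cancel_inv)
  qed
  obtain h1 where h1: "h1 \<in> cont_hom ?Ls ?S" "\<And>x b. x \<in> topspace X \<Longrightarrow> b \<in> B x \<Longrightarrow> h1 b = f b"
    using free_pro_product_ext[OF Ls S(4) fc fhom] by metis

  \<comment> \<open>The homomorphism on the factor \<open>Ps\<close>\<close>
  obtain \<xi> where \<xi>: "\<xi> \<in> cont_hom ?Ps ?P" "\<And>a. a \<in> P \<Longrightarrow> \<xi> (\<eta> a) = a"
  proof -
    have "(\<lambda>x. x) \<in> cont_hom ?P ?P" by (intro cont_homI) (auto simp: hom_def)
    moreover have "kernel ?P ?Ps \<eta> \<subseteq> kernel ?P ?P (\<lambda>x. x)"
    proof
      interpret \<eta>: group_hom ?P ?Ps \<eta>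
        using cont_hom_group_hom[OF eta(1) P.is_group Ps.is_group] .
      fix a assume "a \<in> kernel ?P ?Ps \<eta>"
      then have "a \<in> carrier ?P" "\<eta> a = \<eta> \<one>\<^bsub>?P\<^esub>" unfolding kernel_def using \<eta>.hom_one by auto
      then have "a = \<one>\<^bsub>?P\<^esub>" using inj_onD[OF eta(3)] P.one_closed by blast
      then show "a \<in> kernel ?P ?P (\<lambda>x. x)" using P.one_closed unfolding kernel_def by simp
    qed
    ultimately obtain \<xi> where "\<xi> \<in> cont_hom ?Ps ?P" "\<And>a. a \<in> carrier ?P \<Longrightarrow> \<xi> (\<eta> a) = a"
      using P.cont_hom_factor[OF eta(1,2) Ps.is_group Ps.Hausdorff Ps.topspace_gtop _ P.is_group] by metis
    then show ?thesis using that by simp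
  qed
  \<comment> \<open>The part of \<open>S\<close> lying over \<open>Ps\<close>. Projectivity is known
    for \<open>?P\<close>, so the cover to be split is \<alpha> followed by \<xi>, the continuous
    inverse of \<eta>.\<close>
  define E where "E = S \<inter> {x \<in> carrier G. \<alpha> x \<in> Ps}"
  have E: "closed_subgroup E G"
    unfolding E_def using G.closed_subgroup_Inter[of "{S, {x \<in> carrier G. \<alpha> x \<in> Ps}}"] S(1)
      G.closed_subgroup_vimage[OF \<alpha> Gs.profinite_axioms gs(3)] by auto
  interpret E: profinite "tsub G E" using G.profinite_tsub[OF E] .
  have \<alpha>E: "\<alpha> \<in> cont_hom (tsub G E) ?Ps"
    using G.cont_hom_tsub[OF \<alpha> closed_subgroupD(1)[OF E]] closed_subgroupD(3)[OF E]
    unfolding cont_hom_def E_def by (auto simp: hom_def continuous_map_in_subtopology)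
  have \<beta>: "(\<lambda>x. \<xi> (\<alpha> x)) \<in> cont_hom (tsub G E) ?P" using cont_hom_trans[OF \<alpha>E \<xi>(1)] .
  have \<beta>surj: "(\<lambda>x. \<xi> (\<alpha> x)) ` carrier (tsub G E) = carrier ?P"
  proof (intro equalityI subsetI)
    fix q assume "q \<in> carrier ?P"
    then have q: "q \<in> P" by simp
    have "\<eta> q \<in> Ps" using eta(2) q by auto
    then have "\<eta> q \<in> \<alpha> ` S" using S(2) ps(3) by auto
    then obtain t where t: "t \<in> S" "\<eta> q = \<alpha> t" by auto
    then have "t \<in> E" unfolding E_def using \<open>\<eta> q \<in> Ps\<close> s(3) by auto
    moreover have "q = \<xi> (\<alpha> t)" using \<xi>(2)[OF q] t(2) by simp
    ultimately show "q \<in> (\<lambda>x. \<xi> (\<alpha> x)) ` carrier (tsub G E)" by auto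
  qed (use cont_homD(1)[OF \<beta>] in \<open>auto simp: hom_def\<close>)
  obtain \<rho> where \<rho>: "\<rho> \<in> cont_hom ?P (tsub G E)" "\<And>q. q \<in> carrier ?P \<Longrightarrow> \<xi> (\<alpha> (\<rho> q)) = q"
    using E.projective_section[OF universe projective \<beta> \<beta>surj] by metis
  define h2 where "h2 = (\<lambda>y. \<rho> (\<xi> y))"
  have h2E: "h2 \<in> cont_hom ?Ps (tsub G E)" unfolding h2_def using cont_hom_trans[OF \<xi>(1) \<rho>(1)] .
  have h2: "h2 \<in> cont_hom ?Ps ?S"
    using h2E unfolding cont_hom_def E_def by (auto simp: hom_def continuous_map_in_subtopology)
  have \<alpha>h2: "\<alpha> (h2 y) = y" if y: "y \<in> Ps" for y
  proof -
    have y\<xi>: "\<eta> (\<xi> z) = z \<and> \<xi> z \<in> P" if z: "z \<in> Ps" for z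
    proof -
      have "z \<in> \<eta> ` P" using eta(2) z by simp
      then show ?thesis using \<xi>(2) by auto
    qed
    \<comment> \<open>Values of \<open>h2\<close> lie in \<open>E\<close>, so both sides stay in
      \<open>Ps\<close>, where \<xi> is injective.\<close>
    have e: "\<alpha> (h2 y) \<in> Ps" using cont_homD(1)[OF h2E] y unfolding hom_def E_def by auto
    have "\<xi> (\<alpha> (h2 y)) = \<xi> y" unfolding h2_def using \<rho>(2)[of "\<xi> y"] y\<xi>[OF y] by simp
    then show ?thesis using y\<xi>[OF e] y\<xi>[OF y] by metis
  qed

  \<comment> \<open>The retraction and the images of the factors\<close>
  obtain r where rS: "r \<in> cont_hom Gs ?S" "\<And>y. y \<in> Ls \<Longrightarrow> r y = h1 y" "\<And>y. y \<in> Ps \<Longrightarrow> r y = h2 y"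
    using free_pro_product2_ext[OF Gs S(4) h1(1) h2] by metis
  have r: "r \<in> cont_hom Gs G" using cont_hom_into[OF rS(1) s(3)] .
  have idGs: "(\<lambda>x. x) \<in> cont_hom Gs Gs" by (intro cont_homI) (auto simp: hom_def)
  \<comment> \<open>\<open>\<alpha> \<circ> h1\<close> and the inclusion of \<open>Ls\<close> are
    compared as maps into the prosoluble group \<open>Gs\<close>; they agree on every
    \<open>B x\<close>.\<close>
  have \<alpha>h1: "\<alpha> (h1 y) = y" if y: "y \<in> Ls" for y
  proof (rule free_pro_product_unique[OF Ls gs(1)])
    show "(\<lambda>y. \<alpha> (h1 y)) \<in> cont_hom ?Ls Gs" using cont_hom_trans[OF h1(1) \<alpha>S] .
    show "(\<lambda>y. y) \<in> cont_hom ?Ls Gs" using cont_hom_incl[OF ls(3)] by simp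
    show "\<alpha> (h1 b) = b" if "x \<in> topspace X" "b \<in> B x" for x b using h1(2)[OF that] fB(2)[OF that] by simp
  qed (use y in simp)
  have "\<alpha> (r h) = h" if "h \<in> carrier Gs" for h
    by (rule free_pro_product2_unique[OF Gs gs(1) idGs cont_hom_trans[OF r \<alpha>] _ _ that])
       (use rS(2,3) \<alpha>h1 \<alpha>h2 in auto)
  moreover have "\<exists>g \<in> carrier G. r ` B x = (\<lambda>a. g \<otimes>\<^bsub>G\<^esub> a \<otimes>\<^bsub>G\<^esub> inv\<^bsub>G\<^esub> g) ` A x" if x: "x \<in> topspace X" for x
  proof
    show "\<nu> x \<in> carrier G" using \<nu>G[OF x] .
    have "r (\<theta> a) = ?c x a" if a: "a \<in> A x" for a
    proof -
      have b: "\<theta> a \<in> B x" using \<theta>img[OF x] a by blast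
      then show ?thesis using rS(2)[of "\<theta> a"] h1(2)[OF x b] f[OF x a] B(2)[OF x] by auto
    qed
    then show "r ` B x = ?c x ` A x"
      unfolding \<theta>img[OF x, symmetric] image_image by (rule image_cong[OF refl])
  qed
  ultimately show "\<exists>r \<in> cont_hom Gs G. (\<forall>h \<in> carrier Gs. \<alpha> (r h) = h) \<and>
      (\<forall>x \<in> topspace X. \<exists>g \<in> carrier G. r ` B x = (\<lambda>a. g \<otimes>\<^bsub>G\<^esub> a \<otimes>\<^bsub>G\<^esub> inv\<^bsub>G\<^esub> g) ` A x)"
    using r by blast
qed

end
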